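(* Let $N\xrightarrow{\varphi}G$ be a crossed module of Lie groupoids, let $N\rtimes G\rightrightarrows N$ be the associated crossed product groupoid, and let $$\Phi:H^{\ast}(G_\bullet,\mathbb{Z})\to H^{\ast-1}((N\rtimes G)_\bullet,\mathbb{Z})$$ be the transgression map defined as the composition $\Phi=(\wedge\xi\otimes\mathrm{id})\circ\kappa\circ\rho^*\circ\pi^*$ described in the context. For $p\ge 1$ and $1\le i\le p$ let $f_i:(N\rtimes G)_{p-1}\cong N\rtimes G_{p-1}\to G_p$ be the map $$f_i(x,g_1,\dots,g_{p-1})=(g_1,\dots,g_{i-1},\varphi(x)^{g_1\cdots g_{i-1}},g_i,\dots,g_{p-1}),$$ where $\varphi(x)^{g}:=g^{-1}\varphi(x)g$. Then $\Phi$ is induced on the cochain level by the maps $$\sum_{i=1}^{p}(-1)^i f_i^{*}:C^q(G_p,\mathbb{Z})\to C^q((N\rtimes G)_{p-1},\mathbb{Z})\qquad(p\ge 1,\ q\ge 0)$$ (and by $0$ on $C^q(G_0,\mathbb{Z})$). Consequently $\Phi$ coincides, up to a sign, with the Tu–Xu transgression map $T_1:H^{\ast}(G_\bullet,\mathbb{Z})\to H^{\ast-1}((N\rtimes G)_\bullet,\mathbb{Z})$, which is induced on cochains by $\sum_{i=0}^{p-1}(-1)^i\tilde f_i^{\,*}$, where $\tilde f_i:N\rtimes G_{p-1}\to G_p$ is $\tilde f_i(x,g_1,\dots,g_{p-1})=(g_1,\dots,g_i,\varphi(x)^{g_1\cdots g_i},g_{i+1},\dots,g_{p-1})$; explicitly,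 with the sign conventions of the context, $\Phi=-T_1$.
   Context: Groupoid conventions: for a groupoid $G\rightrightarrows G_0$ with source $s$ and target $t$, the product $gh$ is defined when $s(g)=t(h)$. A right action of $G\rightrightarrows G_0$ on a space $X$ consists of a momentum map $J:X\to G_0$ and a map $(x,g)\mapsto x^g$ defined when $J(x)=t(g)$, with $J(x^g)=s(g)$, $x^{gh}=(x^g)^h$, $x^{J(x)}=x$ (units identified with objects). The crossed product groupoid $X\rtimes G\rightrightarrows X$ has arrows $(x,g)$ with $J(x)=t(g)$, source $s(x,g)=x^g$, target $t(x,g)=x$, product $(x,g)(x^g,h)=(x,gh)$. $G$ acts on a groupoid $N\rightrightarrows N_0$ by automorphisms if $N_0$ and the arrow space $N$ are right $G$-spaces, source and target of $N$ are $G$-equivariant, and $x^gy^g=(xy)^g$ whenever either side makes sense. A crossed module of groupoids $N\xrightarrow{\varphi}G$ is a groupoid homomorphism $\varphi$ from $N\rightrightarrows N_0$ to $G\rightrightarrows G_0$ with $N_0=G_0$ and $\varphi$ the identity on objects, where $N$ is a bundle of groups (source equals target), together with a right action of $G$ on $N$ by automorphisms (the momentum map on $N$ is the bundle projection $N\to G_0$, and on $N_0=G_0$ the action is $t(g)^g=s(g)$) such that $\varphi(x^g)=\varphi(x)^g:=g^{-1}\varphi(x)g$ whenever $x^g$ makes sense and $x^{\varphi(y)}=x^y:=y^{-1}xy$ for composable $x,y\in N$. Here all groupoids are Lie groupoids and all structure maps are smooth. The crossed product $N\rtimes G\rightrightarrows N$ is that of the action of $G$ on the arrow space $N$. Nerve: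 for a Lie groupoid $K\rightrightarrows K_0$, $K_\bullet$ is the simplicial manifold with $K_n$ the manifold of composable $n$-tuples $(g_1,\dots,g_n)$; the $i$-th face drops $g_1$ ($i=0$), replaces $g_i,g_{i+1}$ by $g_ig_{i+1}$ ($0<i<n$), or drops $g_n$ ($i=n$); degeneracies insert a unit arrow at one of the $n+1$ objects of the string. The nerve $(N\rtimes G)_l$ is identified with $N\rtimes G_l:=\{(x,g_1,\dots,g_l): t(x)=t(g_1),\ g_1\cdots g_l\text{ makes sense}\}$ via $\big((x,g_1),(x^{g_1},g_2),\dots,(x^{g_1\cdots g_{l-1}},g_l)\big)\leftrightarrow(x,g_1,\dots,g_l)$, and $N\rtimes G_0=N$. Singular cohomology of a simplicial manifold $M_\bullet$: $C_q(M_p,\mathbb{Z})$ is the free abelian group on smooth maps $\Delta^q\to M_p$, and $C^q(M_p,\mathbb{Z})=\mathrm{Hom}_{\mathbb{Z}}(C_q(M_p,\mathbb{Z}),\mathbb{Z})$. $H^\ast(M_\bullet,\mathbb{Z})$ is the cohomology of the total complex of the double complex $C^q(M_p,\mathbb{Z})$ with differential $D=(-1)^p\delta^*+\partial^*$, where $\delta^*$ is the dual of the singular boundary and $\partial^*$ is the dual of $\partial=\sum_{j}(-1)^j(\overline{\varepsilon}^j)_*$, with $\overline{\varepsilon}^j:M_p\to M_{p-1}$ the faces. The total degree is $p+q$. $H_\bullet(M_\bullet,\mathbb{Z})$ is defined dually. Definition of $\Phi$ (coefficients $\mathbb{Z}$). View the discrete group $\mathbb{Z}$ as a groupoid with one object,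 so $\mathbb{Z}_\bullet$ is its nerve and $H^i(\mathbb{Z}_\bullet)=\mathbb{Z}$ for $i=0,1$ and $0$ otherwise. $\Phi$ is the composition $$H^{\ast}(G_\bullet)\xrightarrow{\pi^*}H^\ast((N\rtimes G)_\bullet)\xrightarrow{\rho^*}H^\ast((\mathbb{Z}\times(N\rtimes G))_\bullet)\xrightarrow{\kappa}\bigoplus_{i+j=\ast}H^i(\mathbb{Z}_\bullet)\otimes H^j((N\rtimes G)_\bullet)\xrightarrow{\wedge\xi\otimes\mathrm{id}}H^{\ast-1}((N\rtimes G)_\bullet),$$ where: - $\pi:N\rtimes G\to G$, $\pi(x,g)=g$; - $\rho:\mathbb{Z}\times(N\rtimes G)\to N\rtimes G$ is the groupoid homomorphism $\rho(k,(x,g))=(x,\varphi(x^k)g)$, where $\mathbb{Z}\times(N\rtimes G)\rightrightarrows N$ is the product groupoid and $x^k$ is the $k$-th power of $x$ in the fibre group of $N$; - $\kappa$ is the isomorphism given by the Eilenberg–Zilber theorem and the Künneth formula, induced on cochains by the dual $\nabla^*$ of the Eilenberg–MacLane (shuffle) map $\nabla:\bigoplus_{k+l=p}C_q(\mathbb{Z}_k\times(N\rtimes G)_l)\to C_q((\mathbb{Z}\times(N\rtimes G))_p)$; - $\wedge\xi\otimes\mathrm{id}$ is the cap product in the first factor with the generator $[\xi]$ of $H_1(\mathbb{Z}_\bullet)\cong\mathbb{Z}$ represented by the point $1\in\mathbb{Z}_1=\mathbb{Z}$. On cochains it is nonzero only on the component $C^q(\mathbb{Z}_1\times(N\rtimes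 G)_{p-1})$, where it is the pullback along $\iota:(N\rtimes G)_{p-1}\to\mathbb{Z}_1\times(N\rtimes G)_{p-1}$, $\iota(y)=(1,y)$. Sign convention for the shuffle map: its $(1,p-1)$ component is $\nabla_{1,p-1}=\sum_{i=1}^p(-1)^i(\phi_i)_*$, where $\phi_i:\mathbb{Z}_1\times(N\rtimes G)_{p-1}\to(\mathbb{Z}\times(N\rtimes G))_p=\mathbb{Z}_p\times(N\rtimes G)_p$ sends $(k,(x,g_1,\dots,g_{p-1}))$ to the pair consisting of $(0,\dots,0,k,0,\dots,0)\in\mathbb{Z}_p$ with $k$ in position $i$ and $(x,g_1,\dots,g_{i-1},e,g_i,\dots,g_{p-1})$, where $e$ is the unit of $G$ at the base point of $x^{g_1\cdots g_{i-1}}$. *)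

theory Defs
  imports "HOL-Analysis.Analysis" "HOL-Homology.Homology"
begin

section \<open>Smooth manifolds\<close>

text \<open>
  \<open>\<real>\<^sup>n\<close> is \<^const>\<open>Euclidean_space\<close> \<open>n\<close>, the sequences vanishing from index \<open>n\<close> on.
  A function on an open set is \<open>C\<^sup>k\<close> if all its iterated partial derivatives up to order \<open>k\<close>
  exist and are continuous.
\<close>

definition partial_deriv :: "nat \<Rightarrow> ((nat \<Rightarrow> real) \<Rightarrow> real) \<Rightarrow> (nat \<Rightarrow> real) \<Rightarrow> real" where
  "partial_deriv i f x = deriv (\<lambda>t. f (x(i := t))) (x i)"

fun C_k_on :: "nat \<Rightarrow> nat \<Rightarrow> (nat \<Rightarrow> real) set \<Rightarrow> ((nat \<Rightarrow> real) \<Rightarrow> real) \<Rightarrow> bool" where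
  "C_k_on 0 n W f \<longleftrightarrow> continuous_map (subtopology (Euclidean_space n) W) euclideanreal f"
| "C_k_on (Suc k) n W f \<longleftrightarrow>
     continuous_map (subtopology (Euclidean_space n) W) euclideanreal f \<and>
     (\<forall>i<n. (\<forall>x\<in>W. (\<lambda>t. f (x(i := t))) differentiable (at (x i))) \<and>
            C_k_on k n W (partial_deriv i f))"

definition C_inf_on :: "nat \<Rightarrow> (nat \<Rightarrow> real) set \<Rightarrow> ((nat \<Rightarrow> real) \<Rightarrow> real) \<Rightarrow> bool" where
  "C_inf_on n W f \<longleftrightarrow> (\<forall>k. C_k_on k n W f)"

text \<open>A chart \<open>(n, U, \<phi>)\<close> is a homeomorphism \<open>\<phi>\<close> from the open set \<open>U\<close> onto an open subset of
  \<open>\<real>\<^sup>n\<close>; the dimension may depend on the component.\<close>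

type_synonym 'a chart = "nat \<times> 'a set \<times> ('a \<Rightarrow> nat \<Rightarrow> real)"

record 'a mfd =
  mtop :: "'a topology"
  charts :: "'a chart set"

abbreviation mcarrier :: "'a mfd \<Rightarrow> 'a set" where
  "mcarrier M \<equiv> topspace (mtop M)"

definition is_chart :: "'a topology \<Rightarrow> 'a chart \<Rightarrow> bool" where
  "is_chart T c \<longleftrightarrow> (case c of (n, U, \<phi>) \<Rightarrow>
     openin T U \<and> openin (Euclidean_space n) (\<phi> ` U) \<and>
     homeomorphic_map (subtopology T U) (subtopology (Euclidean_space n) (\<phi> ` U)) \<phi>)"

definition charts_compatible :: "'a chart \<Rightarrow> 'a chart \<Rightarrow> bool" where
  "charts_compatible c c' \<longleftrightarrow> (case c of (m, U, \<phi>) \<Rightarrow> case c' of (n, V, \<psi>) \<Rightarrow>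
     (\<forall>j<n. C_inf_on m (\<phi> ` (U \<inter> V)) (\<lambda>y. \<psi> (inv_into U \<phi> y) j)))"

definition smooth_manifold :: "'a mfd \<Rightarrow> bool" where
  "smooth_manifold M \<longleftrightarrow>
     Hausdorff_space (mtop M) \<and> second_countable (mtop M) \<and>
     (\<forall>c\<in>charts M. is_chart (mtop M) c) \<and>
     (\<Union>(n, U, \<phi>)\<in>charts M. U) = mcarrier M \<and>
     (\<forall>c\<in>charts M. \<forall>c'\<in>charts M. charts_compatible c c')"

text \<open>
  Smoothness of a map defined on an arbitrary subset \<open>S\<close> of a manifold: locally, in charts, it is the
  restriction of a smooth map defined on an open set. For \<open>S\<close> open, or \<open>S\<close> an embedded submanifold,
  this is the usual smoothness; for \<open>S = \<Delta>\<^sup>q \<subseteq> \<real>\<^sup>q\<^sup>+\<^sup>1\<close> it is the usual smoothness of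
  a singular simplex.
\<close>

definition smooth_on :: "'a set \<Rightarrow> 'a mfd \<Rightarrow> 'b mfd \<Rightarrow> ('a \<Rightarrow> 'b) \<Rightarrow> bool" where
  "smooth_on S M N f \<longleftrightarrow> S \<subseteq> mcarrier M \<and>
     (\<forall>x\<in>S. \<exists>m U \<phi> n V \<psi> W F.
        (m, U, \<phi>) \<in> charts M \<and> (n, V, \<psi>) \<in> charts N \<and> x \<in> U \<and> f x \<in> V \<and>
        openin (Euclidean_space m) W \<and> \<phi> x \<in> W \<and> W \<subseteq> \<phi> ` U \<and>
        (\<forall>j<n. C_inf_on m W (\<lambda>y. F y j)) \<and>
        (\<forall>y\<in>S \<inter> U. \<phi> y \<in> W \<longrightarrow> f y \<in> V \<and> (\<forall>j<n. \<psi> (f y) j = F (\<phi> y) j)))"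

abbreviation smooth_map :: "'a mfd \<Rightarrow> 'b mfd \<Rightarrow> ('a \<Rightarrow> 'b) \<Rightarrow> bool" where
  "smooth_map M N f \<equiv> smooth_on (mcarrier M) M N f"

definition submersion :: "'a mfd \<Rightarrow> 'b mfd \<Rightarrow> ('a \<Rightarrow> 'b) \<Rightarrow> bool" where
  "submersion M N f \<longleftrightarrow> smooth_map M N f \<and>
     (\<forall>m U \<phi> n V \<psi>. (m, U, \<phi>) \<in> charts M \<longrightarrow> (n, V, \<psi>) \<in> charts N \<longrightarrow>
        (\<forall>x\<in>U. f x \<in> V \<longrightarrow>
          (\<forall>w. \<exists>v. \<forall>j<n.
             (\<Sum>i<m. partial_deriv i (\<lambda>y. \<psi> (f (inv_into U \<phi> y)) j) (\<phi> x) * v i) = w j)))"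

definition euclidean_mfd :: "nat \<Rightarrow> (nat \<Rightarrow> real) mfd" where
  "euclidean_mfd n = \<lparr>mtop = Euclidean_space n,
                      charts = {(n, topspace (Euclidean_space n), \<lambda>x. x)}\<rparr>"

definition discrete_mfd :: "'a set \<Rightarrow> 'a mfd" where
  "discrete_mfd S = \<lparr>mtop = discrete_topology S, charts = (\<lambda>x. (0, {x}, \<lambda>_ _. 0)) ` S\<rparr>"

definition prod_mfd :: "'a mfd \<Rightarrow> 'b mfd \<Rightarrow> ('a \<times> 'b) mfd" where
  "prod_mfd M N = \<lparr>mtop = prod_topology (mtop M) (mtop N),
     charts = {(m + n, U \<times> V, \<lambda>(x, y) i. if i < m then \<phi> x i else \<psi> y (i - m)) | m U \<phi> n V \<psi>.
                 (m, U, \<phi>) \<in> charts M \<and> (n, V, \<psi>) \<in> charts N}\<rparr>"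

text \<open>Smooth maps from \<open>\<Delta>\<^sup>q\<close> to \<open>M\<close>; as in \<^const>\<open>singular_simplex\<close>, they are extensional.\<close>

definition smooth_simplex :: "nat \<Rightarrow> 'a mfd \<Rightarrow> ((nat \<Rightarrow> real) \<Rightarrow> 'a) \<Rightarrow> bool" where
  "smooth_simplex q M \<sigma> \<longleftrightarrow> \<sigma> \<in> extensional (standard_simplex q) \<and>
     smooth_on (standard_simplex q) (euclidean_mfd (Suc q)) M \<sigma>"


section \<open>Groupoids\<close>

text \<open>
  The objects and the arrows are subsets of ambient manifolds. For a Lie groupoid they are the whole
  manifolds. For a crossed product the arrows are a fibre product, an embedded submanifold of
  a product manifold: a map into it is smooth iff it is smooth as a map into the product.
\<close>

record ('o, 'a) grpd =
  objs :: "'o set"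
  arrs :: "'a set"
  obj_mfd :: "'o mfd"
  arr_mfd :: "'a mfd"
  gsrc :: "'a \<Rightarrow> 'o"
  gtgt :: "'a \<Rightarrow> 'o"
  gid :: "'o \<Rightarrow> 'a"
  gmul :: "'a \<Rightarrow> 'a \<Rightarrow> 'a"
  ginv :: "'a \<Rightarrow> 'a"

definition composable :: "('o, 'a) grpd \<Rightarrow> ('a \<times> 'a) set" where
  "composable K = {(g, h). g \<in> arrs K \<and> h \<in> arrs K \<and> gsrc K g = gtgt K h}"

definition groupoid :: "('o, 'a) grpd \<Rightarrow> bool" where
  "groupoid K \<longleftrightarrow>
     gsrc K \<in> arrs K \<rightarrow> objs K \<and> gtgt K \<in> arrs K \<rightarrow> objs K \<and>
     gid K \<in> objs K \<rightarrow> arrs K \<and> ginv K \<in> arrs K \<rightarrow> arrs K \<and>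
     (\<forall>(g, h)\<in>composable K. gmul K g h \<in> arrs K \<and>
        gsrc K (gmul K g h) = gsrc K h \<and> gtgt K (gmul K g h) = gtgt K g) \<and>
     (\<forall>g h k. (g, h) \<in> composable K \<longrightarrow> (h, k) \<in> composable K \<longrightarrow>
        gmul K (gmul K g h) k = gmul K g (gmul K h k)) \<and>
     (\<forall>x\<in>objs K. gsrc K (gid K x) = x \<and> gtgt K (gid K x) = x) \<and>
     (\<forall>g\<in>arrs K. gmul K (gid K (gtgt K g)) g = g \<and> gmul K g (gid K (gsrc K g)) = g) \<and>
     (\<forall>g\<in>arrs K. gsrc K (ginv K g) = gtgt K g \<and> gtgt K (ginv K g) = gsrc K g \<and>
        gmul K g (ginv K g) = gid K (gtgt K g) \<and> gmul K (ginv K g) g = gid K (gsrc K g))"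

definition lie_groupoid :: "('o, 'a) grpd \<Rightarrow> bool" where
  "lie_groupoid K \<longleftrightarrow> groupoid K \<and>
     smooth_manifold (obj_mfd K) \<and> mcarrier (obj_mfd K) = objs K \<and>
     smooth_manifold (arr_mfd K) \<and> mcarrier (arr_mfd K) = arrs K \<and>
     submersion (arr_mfd K) (obj_mfd K) (gsrc K) \<and> submersion (arr_mfd K) (obj_mfd K) (gtgt K) \<and>
     smooth_map (obj_mfd K) (arr_mfd K) (gid K) \<and>
     smooth_map (arr_mfd K) (arr_mfd K) (ginv K) \<and>
     smooth_on (composable K) (prod_mfd (arr_mfd K) (arr_mfd K)) (arr_mfd K) (\<lambda>(g, h). gmul K g h)"

definition gpow :: "('o, 'a) grpd \<Rightarrow> 'a \<Rightarrow> int \<Rightarrow> 'a" where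
  "gpow K x k = (if 0 \<le> k then (gmul K x ^^ nat k) (gid K (gtgt K x))
                 else (gmul K (ginv K x) ^^ nat (- k)) (gid K (gtgt K x)))"

definition gconj :: "('o, 'a) grpd \<Rightarrow> 'a \<Rightarrow> 'a \<Rightarrow> 'a" where
  "gconj K x g = gmul K (ginv K g) (gmul K x g)"

text \<open>Product of a composable string starting at the object \<open>x\<close> (the unit at \<open>x\<close> for the
  empty string).\<close>

fun gprod :: "('o, 'a) grpd \<Rightarrow> 'o \<Rightarrow> 'a list \<Rightarrow> 'a" where
  "gprod K x [] = gid K x"
| "gprod K x (g # gs) = gmul K g (gprod K (gsrc K g) gs)"

definition right_action ::
  "('o, 'g) grpd \<Rightarrow> 'x set \<Rightarrow> 'x mfd \<Rightarrow> ('x \<Rightarrow> 'o) \<Rightarrow> ('x \<Rightarrow> 'g \<Rightarrow> 'x) \<Rightarrow> bool" where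
  "right_action G X MX J act \<longleftrightarrow>
     J \<in> X \<rightarrow> objs G \<and> smooth_on X MX (obj_mfd G) J \<and>
     (\<forall>x\<in>X. \<forall>g\<in>arrs G. J x = gtgt G g \<longrightarrow> act x g \<in> X \<and> J (act x g) = gsrc G g) \<and>
     (\<forall>x\<in>X. \<forall>g h. J x = gtgt G g \<longrightarrow> (g, h) \<in> composable G \<longrightarrow>
        act x (gmul G g h) = act (act x g) h) \<and>
     (\<forall>x\<in>X. act x (gid G (J x)) = x) \<and>
     smooth_on {(x, g). x \<in> X \<and> g \<in> arrs G \<and> J x = gtgt G g} (prod_mfd MX (arr_mfd G)) MX
       (\<lambda>(x, g). act x g)"

text \<open>
  \<open>N\<close> is a bundle of groups over the objects of \<open>G\<close>, with projection \<open>gtgt N = gsrc N\<close>. The action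
  of \<open>G\<close> on the objects of \<open>N\<close> sends \<open>(gtgt G g, g)\<close> to \<open>gsrc G g\<close>; that source and target of \<open>N\<close>
  are equivariant is then the condition \<open>gtgt N (act x g) = gsrc G g\<close> contained in
  \<^const>\<open>right_action\<close>.
\<close>

definition crossed_module ::
  "('o, 'n) grpd \<Rightarrow> ('o, 'g) grpd \<Rightarrow> ('n \<Rightarrow> 'g) \<Rightarrow> ('n \<Rightarrow> 'g \<Rightarrow> 'n) \<Rightarrow> bool" where
  "crossed_module N G \<phi> act \<longleftrightarrow>
     lie_groupoid N \<and> lie_groupoid G \<and> objs N = objs G \<and> obj_mfd N = obj_mfd G \<and>
     (\<forall>x\<in>arrs N. gsrc N x = gtgt N x) \<and>
     \<phi> \<in> arrs N \<rightarrow> arrs G \<and> smooth_map (arr_mfd N) (arr_mfd G) \<phi> \<and>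
     (\<forall>x\<in>arrs N. gsrc G (\<phi> x) = gsrc N x \<and> gtgt G (\<phi> x) = gtgt N x) \<and>
     (\<forall>(x, y)\<in>composable N. \<phi> (gmul N x y) = gmul G (\<phi> x) (\<phi> y)) \<and>
     right_action G (objs N) (obj_mfd N) (\<lambda>x. x) (\<lambda>_ g. gsrc G g) \<and>
     right_action G (arrs N) (arr_mfd N) (gtgt N) act \<and>
     (\<forall>(x, y)\<in>composable N. \<forall>g\<in>arrs G. gtgt N x = gtgt G g \<longrightarrow>
        act (gmul N x y) g = gmul N (act x g) (act y g)) \<and>
     (\<forall>x\<in>arrs N. \<forall>g\<in>arrs G. gtgt N x = gtgt G g \<longrightarrow> \<phi> (act x g) = gconj G (\<phi> x) g) \<and>
     (\<forall>(x, y)\<in>composable N. act x (\<phi> y) = gconj N x y)"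

definition crossed_product ::
  "('o, 'n) grpd \<Rightarrow> ('o, 'g) grpd \<Rightarrow> ('n \<Rightarrow> 'g \<Rightarrow> 'n) \<Rightarrow> ('n, 'n \<times> 'g) grpd" where
  "crossed_product N G act =
     \<lparr>objs = arrs N, arrs = {(x, g). x \<in> arrs N \<and> g \<in> arrs G \<and> gtgt N x = gtgt G g},
      obj_mfd = arr_mfd N, arr_mfd = prod_mfd (arr_mfd N) (arr_mfd G),
      gsrc = (\<lambda>(x, g). act x g), gtgt = fst, gid = (\<lambda>x. (x, gid G (gtgt N x))),
      gmul = (\<lambda>(x, g) (y, h). (x, gmul G g h)), ginv = (\<lambda>(x, g). (act x g, ginv G g))\<rparr>"

definition prod_grpd :: "('o, 'a) grpd \<Rightarrow> ('p, 'b) grpd \<Rightarrow> ('o \<times> 'p, 'a \<times> 'b) grpd" where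
  "prod_grpd H K =
     \<lparr>objs = objs H \<times> objs K, arrs = arrs H \<times> arrs K,
      obj_mfd = prod_mfd (obj_mfd H) (obj_mfd K), arr_mfd = prod_mfd (arr_mfd H) (arr_mfd K),
      gsrc = map_prod (gsrc H) (gsrc K), gtgt = map_prod (gtgt H) (gtgt K),
      gid = map_prod (gid H) (gid K),
      gmul = (\<lambda>(a, b) (a', b'). (gmul H a a', gmul K b b')),
      ginv = map_prod (ginv H) (ginv K)\<rparr>"

definition int_grpd :: "(unit, int) grpd" where
  "int_grpd = \<lparr>objs = UNIV, arrs = UNIV, obj_mfd = discrete_mfd UNIV, arr_mfd = discrete_mfd UNIV,
     gsrc = (\<lambda>_. ()), gtgt = (\<lambda>_. ()), gid = (\<lambda>_. 0), gmul = (+), ginv = uminus\<rparr>"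


section \<open>Nerves\<close>

text \<open>
  A composable \<open>p\<close>-tuple \<open>(g\<^sub>1,\<dots>,g\<^sub>p)\<close> is stored together with its initial object, which is the
  target of \<open>g\<^sub>1\<close> if \<open>p > 0\<close>, so that the set of 0-simplices is the set of objects.
\<close>

fun path_from :: "('o, 'a) grpd \<Rightarrow> 'o \<Rightarrow> 'a list \<Rightarrow> bool" where
  "path_from K x [] \<longleftrightarrow> x \<in> objs K"
| "path_from K x (g # gs) \<longleftrightarrow> g \<in> arrs K \<and> gtgt K g = x \<and> path_from K (gsrc K g) gs"

definition nerve :: "('o, 'a) grpd \<Rightarrow> nat \<Rightarrow> ('o \<times> 'a list) set" where
  "nerve K p = {(x, gs). length gs = p \<and> path_from K x gs}"

text \<open>The nerve is an embedded submanifold of a product of copies of the arrow manifold (and of the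
  object manifold), so that a map into it is smooth iff all its components are. (For \<open>p > 0\<close>
  smoothness of the initial object follows from that of \<open>g\<^sub>1\<close>.)\<close>

definition nerve_simplices ::
  "('o, 'a) grpd \<Rightarrow> nat \<Rightarrow> nat \<Rightarrow> ((nat \<Rightarrow> real) \<Rightarrow> 'o \<times> 'a list) set" where
  "nerve_simplices K p q = {\<sigma> \<in> extensional (standard_simplex q).
     \<sigma> ` standard_simplex q \<subseteq> nerve K p \<and>
     smooth_simplex q (obj_mfd K) (simplex_map q fst \<sigma>) \<and>
     (\<forall>i<p. smooth_simplex q (arr_mfd K) (simplex_map q (\<lambda>z. snd z ! i) \<sigma>))}"

definition nerve_face :: "('o, 'a) grpd \<Rightarrow> nat \<Rightarrow> nat \<Rightarrow> 'o \<times> 'a list \<Rightarrow> 'o \<times> 'a list" where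
  "nerve_face K p i = (\<lambda>(x, gs).
     if i = 0 then (gsrc K (hd gs), tl gs)
     else if i = p then (x, butlast gs)
     else (x, take (i - 1) gs @ [gmul K (gs ! (i - 1)) (gs ! i)] @ drop (i + 1) gs))"

definition nerve_vertex :: "('o, 'a) grpd \<Rightarrow> 'o \<times> 'a list \<Rightarrow> nat \<Rightarrow> 'o" where
  "nerve_vertex K = (\<lambda>(x, gs) i. if i = 0 then x else gsrc K (gs ! (i - 1)))"

definition nerve_degen :: "('o, 'a) grpd \<Rightarrow> nat \<Rightarrow> 'o \<times> 'a list \<Rightarrow> 'o \<times> 'a list" where
  "nerve_degen K i z =
     (fst z, take i (snd z) @ [gid K (nerve_vertex K z i)] @ drop i (snd z))"

definition nerve_map :: "('o \<Rightarrow> 'p) \<Rightarrow> ('a \<Rightarrow> 'b) \<Rightarrow> 'o \<times> 'a list \<Rightarrow> 'p \<times> 'b list" where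
  "nerve_map f0 f = map_prod f0 (map f)"

text \<open>The degeneracy \<open>s\<^bsub>\<mu>\<^sub>k\<^esub> \<cdots> s\<^bsub>\<mu>\<^sub>1\<^esub>\<close> for \<open>I = {\<mu>\<^sub>1 < \<cdots> < \<mu>\<^sub>k}\<close>: it inserts
  units so that they occupy the positions \<open>I\<close> (counted from 0).\<close>

definition nerve_degens :: "('o, 'a) grpd \<Rightarrow> nat set \<Rightarrow> 'o \<times> 'a list \<Rightarrow> 'o \<times> 'a list" where
  "nerve_degens K I z = fold (nerve_degen K) (sorted_list_of_set I) z"

text \<open>\<open>H\<^sub>p \<times> K\<^sub>p \<cong> (H \<times> K)\<^sub>p\<close>\<close>

definition nerve_zip :: "('o \<times> 'a list) \<times> ('p \<times> 'b list) \<Rightarrow> ('o \<times> 'p) \<times> ('a \<times> 'b) list" where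
  "nerve_zip = (\<lambda>((x, gs), (y, hs)). ((x, y), zip gs hs))"

text \<open>Smooth simplices of \<open>H\<^sub>k \<times> K\<^sub>l\<close>\<close>

definition binerve_simplices ::
  "('o, 'a) grpd \<Rightarrow> ('p, 'b) grpd \<Rightarrow> nat \<Rightarrow> nat \<Rightarrow> nat \<Rightarrow>
     ((nat \<Rightarrow> real) \<Rightarrow> ('o \<times> 'a list) \<times> ('p \<times> 'b list)) set" where
  "binerve_simplices H K k l q = {\<sigma> \<in> extensional (standard_simplex q).
     simplex_map q fst \<sigma> \<in> nerve_simplices H k q \<and> simplex_map q snd \<sigma> \<in> nerve_simplices K l q}"


section \<open>Cochains and cohomology\<close>

text \<open>\<open>Hom(C, \<int>)\<close> for \<open>C\<close> the free abelian group on \<open>S\<close>\<close>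

definition cochain_group :: "'x set \<Rightarrow> (('x \<Rightarrow>\<^sub>0 int) \<Rightarrow> int) monoid" where
  "cochain_group S =
     \<lparr>carrier = hom (free_Abelian_group S) integer_group \<inter> extensional (carrier (free_Abelian_group S)),
      monoid.mult = (\<lambda>u v. \<lambda>c\<in>carrier (free_Abelian_group S). u c + v c),
      one = (\<lambda>c\<in>carrier (free_Abelian_group S). 0)\<rparr>"

record 'c cochain_complex =
  cgrp :: "nat \<Rightarrow> 'c monoid"
  cdiff :: "nat \<Rightarrow> 'c \<Rightarrow> 'c"

definition cocycles :: "'c cochain_complex \<Rightarrow> nat \<Rightarrow> 'c set" where
  "cocycles C n = {u \<in> carrier (cgrp C n). cdiff C n u = \<one>\<^bsub>cgrp C (Suc n)\<^esub>}"

definition coboundaries :: "'c cochain_complex \<Rightarrow> nat \<Rightarrow> 'c set" where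
  "coboundaries C n = (case n of 0 \<Rightarrow> {\<one>\<^bsub>cgrp C 0\<^esub>} | Suc m \<Rightarrow> cdiff C m ` carrier (cgrp C m))"

definition cohomology :: "'c cochain_complex \<Rightarrow> nat \<Rightarrow> 'c set monoid" where
  "cohomology C n = (cgrp C n)\<lparr>carrier := cocycles C n\<rparr> Mod coboundaries C n"

definition coclass :: "'c cochain_complex \<Rightarrow> nat \<Rightarrow> 'c \<Rightarrow> 'c set" where
  "coclass C n u = coboundaries C n #>\<^bsub>cgrp C n\<^esub> u"

text \<open>A map \<open>f\<close> of cochains from degree \<open>m\<close> of \<open>C\<close> to degree \<open>n\<close> of \<open>D\<close> passes to cohomology.\<close>

definition descends ::
  "'c cochain_complex \<Rightarrow> nat \<Rightarrow> 'd cochain_complex \<Rightarrow> nat \<Rightarrow> ('c \<Rightarrow> 'd) \<Rightarrow> bool" where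
  "descends C m D n f \<longleftrightarrow> f \<in> hom (cgrp C m) (cgrp D n) \<and>
     f ` cocycles C m \<subseteq> cocycles D n \<and> f ` coboundaries C m \<subseteq> coboundaries D n"

text \<open>The map induced on cohomology classes: if \<open>f\<close> descends, it sends the class of \<open>u\<close> to that of \<open>f u\<close>.\<close>

definition induced :: "'d cochain_complex \<Rightarrow> nat \<Rightarrow> ('c \<Rightarrow> 'd) \<Rightarrow> 'c set \<Rightarrow> 'd set" where
  "induced D n f A = coboundaries D n <#>\<^bsub>cgrp D n\<^esub> (f ` A)"

text \<open>The free group \<open>C\<^sub>q(K\<^sub>p)\<close> of smooth singular chains of the nerve, and \<open>C\<^sub>q(H\<^sub>k \<times> K\<^sub>l)\<close>\<close>

abbreviation nerve_chains :: "('o, 'a) grpd \<Rightarrow> nat \<Rightarrow> nat \<Rightarrow> ('o \<times> 'a list) chain set" where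
  "nerve_chains K p q \<equiv> carrier (free_Abelian_group (nerve_simplices K p q))"

abbreviation binerve_chains ::
  "('o, 'a) grpd \<Rightarrow> ('p, 'b) grpd \<Rightarrow> nat \<Rightarrow> nat \<Rightarrow> nat \<Rightarrow>
     (('o \<times> 'a list) \<times> ('p \<times> 'b list)) chain set" where
  "binerve_chains H K k l q \<equiv> carrier (free_Abelian_group (binerve_simplices H K k l q))"

text \<open>\<open>\<Sum>\<^sub>j\<^sub>\<le>\<^sub>p (-1)\<^sup>j (\<epsilon>\<^sub>j)\<^sub>*\<close> on \<open>q\<close>-chains\<close>

definition alt_push :: "nat \<Rightarrow> nat \<Rightarrow> (nat \<Rightarrow> 'x \<Rightarrow> 'y) \<Rightarrow> 'x chain \<Rightarrow> 'y chain" where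
  "alt_push q p \<epsilon> c = (\<Sum>j\<le>p. frag_cmul ((-1) ^ j) (chain_map q (\<epsilon> j) c))"

text \<open>
  Total complex of \<open>C\<^sup>q(K\<^sub>p)\<close>: a cochain of degree \<open>n\<close> is a family \<open>u\<close> with
  \<open>u p \<in> C\<^sup>n\<^sup>-\<^sup>p(K\<^sub>p)\<close> for \<open>p \<le> n\<close>. The differential is \<open>D = (-1)\<^sup>p \<delta>\<^sup>* + \<partial>\<^sup>*\<close>.
\<close>

type_synonym ('o, 'a) tot_cochain = "nat \<Rightarrow> ('o \<times> 'a list) chain \<Rightarrow> int"

definition tot_complex :: "('o, 'a) grpd \<Rightarrow> ('o, 'a) tot_cochain cochain_complex" where
  "tot_complex K =
     \<lparr>cgrp = (\<lambda>n. product_group {..n} (\<lambda>p. cochain_group (nerve_simplices K p (n - p)))),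
      cdiff = (\<lambda>n u. \<lambda>p\<in>{..Suc n}. \<lambda>c\<in>nerve_chains K p (Suc n - p).
        (if p \<le> n then (-1) ^ p * u p (chain_boundary (Suc n - p) c) else 0) +
        (if 1 \<le> p then u (p - 1) (alt_push (Suc n - p) p (nerve_face K p) c) else 0))\<rparr>"

text \<open>
  Total complex of \<open>C\<^sup>q(H\<^sub>k \<times> K\<^sub>l)\<close>: a cochain of degree \<open>n\<close> is a family indexed by \<open>(k, l)\<close>
  with \<open>q = n - k - l\<close>. The differential is
  \<open>(-1)\<^sup>k\<^sup>+\<^sup>l \<delta>\<^sup>* + \<partial>\<^sub>H\<^sup>* + (-1)\<^sup>k \<partial>\<^sub>K\<^sup>*\<close>. For \<open>H = \<int>\<close> the Kuenneth formula
  identifies its cohomology, through the exterior product below, with the sum of the groups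
  \<open>H\<^sup>i(\<int>\<^sub>\<bullet>) \<otimes> H\<^sup>j(K\<^sub>\<bullet>)\<close>, \<open>i + j = n\<close>.
\<close>

type_synonym ('o, 'a, 'p, 'b) bi_cochain =
  "nat \<times> nat \<Rightarrow> (('o \<times> 'a list) \<times> ('p \<times> 'b list)) chain \<Rightarrow> int"

definition bi_complex ::
  "('o, 'a) grpd \<Rightarrow> ('p, 'b) grpd \<Rightarrow> ('o, 'a, 'p, 'b) bi_cochain cochain_complex" where
  "bi_complex H K =
     \<lparr>cgrp = (\<lambda>n. product_group {(k, l). k + l \<le> n}
                    (\<lambda>(k, l). cochain_group (binerve_simplices H K k l (n - k - l)))),
      cdiff = (\<lambda>n w. \<lambda>(k, l)\<in>{(k, l). k + l \<le> Suc n}.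
        \<lambda>c\<in>binerve_chains H K k l (Suc n - k - l).
        (if k + l \<le> n then (-1) ^ (k + l) * w (k, l) (chain_boundary (Suc n - k - l) c) else 0) +
        (if 1 \<le> k then w (k - 1, l)
           (alt_push (Suc n - k - l) k (\<lambda>j. map_prod (nerve_face H k j) id) c) else 0) +
        (if 1 \<le> l then (-1) ^ k * w (k, l - 1)
           (alt_push (Suc n - k - l) l (\<lambda>j. map_prod id (nerve_face K l j)) c) else 0))\<rparr>"

text \<open>
  Exterior product of cochains of degrees \<open>i\<close> and \<open>j\<close>, formed with the front \<open>(i-k)\<close>-face in \<open>H\<^sub>k\<close> and
  the back \<open>(j-l)\<close>-face in \<open>K\<^sub>l\<close>. The sign makes it compatible with the total differentials.
\<close>

definition front_simplex :: "nat \<Rightarrow> ((nat \<Rightarrow> real) \<Rightarrow> 'x) \<Rightarrow> (nat \<Rightarrow> real) \<Rightarrow> 'x" where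
  "front_simplex r \<sigma> = restrict \<sigma> (standard_simplex r)"

definition back_simplex :: "nat \<Rightarrow> nat \<Rightarrow> ((nat \<Rightarrow> real) \<Rightarrow> 'x) \<Rightarrow> (nat \<Rightarrow> real) \<Rightarrow> 'x" where
  "back_simplex r s \<sigma> = (\<lambda>x\<in>standard_simplex s. \<sigma> (\<lambda>i. if i < r then 0 else x (i - r)))"

definition exterior_product ::
  "('o, 'a) grpd \<Rightarrow> ('p, 'b) grpd \<Rightarrow> nat \<Rightarrow> nat \<Rightarrow>
     ('o, 'a) tot_cochain \<Rightarrow> ('p, 'b) tot_cochain \<Rightarrow> ('o, 'a, 'p, 'b) bi_cochain" where
  "exterior_product H K i j a b =
     (\<lambda>(k, l)\<in>{(k, l). k + l \<le> i + j}. \<lambda>c\<in>binerve_chains H K k l (i + j - k - l).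
        if k \<le> i \<and> l \<le> j
        then (-1) ^ ((i - k) * l) *
          (\<Sum>\<sigma>\<in>Poly_Mapping.keys c. Poly_Mapping.lookup c \<sigma> *
             a k (frag_of (front_simplex (i - k) (simplex_map (i + j - k - l) fst \<sigma>))) *
             b l (frag_of (back_simplex (i - k) (j - l) (simplex_map (i + j - k - l) snd \<sigma>))))
        else 0)"

text \<open>Pullback of cochains of degree \<open>n\<close> along the simplicial map \<open>f\<close> from the nerve of \<open>K\<close>\<close>

definition pullback ::
  "('o, 'a) grpd \<Rightarrow> nat \<Rightarrow> ('o \<times> 'a list \<Rightarrow> 'p \<times> 'b list) \<Rightarrow>
     ('p, 'b) tot_cochain \<Rightarrow> ('o, 'a) tot_cochain" where
  "pullback K n f u = (\<lambda>p\<in>{..n}. \<lambda>c\<in>nerve_chains K p (n - p). u p (chain_map (n - p) f c))"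


section \<open>The transgression map\<close>

text \<open>
  The shuffle \<open>I\<close> puts the \<open>k\<close> entries from \<open>H\<close> in the positions \<open>I \<subseteq> {0,\<dots>,k+l-1}\<close> and units of \<open>K\<close>
  there, and the entries from \<open>K\<close> and units of \<open>H\<close> in the other positions. Its sign is that of the
  permutation. The overall minus sign of \<open>shuffle_chain\<close> makes the component \<open>k = 1\<close> equal to
  \<open>\<Sum>\<^sub>i\<^sub>=\<^sub>1\<^sup>p (-1)\<^sup>i (\<phi>\<^sub>i)\<^sub>*\<close>, where \<open>\<phi>\<^sub>i\<close> belongs to \<open>I = {i - 1}\<close>.
\<close>

definition shuffle_sign :: "nat \<Rightarrow> nat set \<Rightarrow> int" where
  "shuffle_sign p I = (-1) ^ card {(a, b). a \<in> I \<and> b \<in> {..<p} - I \<and> b < a}"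

definition shuffle_map ::
  "('o, 'a) grpd \<Rightarrow> ('p, 'b) grpd \<Rightarrow> nat \<Rightarrow> nat set \<Rightarrow>
     ('o \<times> 'a list) \<times> ('p \<times> 'b list) \<Rightarrow> ('o \<times> 'p) \<times> ('a \<times> 'b) list" where
  "shuffle_map H K p I = (\<lambda>(z, y). nerve_zip (nerve_degens H ({..<p} - I) z, nerve_degens K I y))"

definition shuffle_chain ::
  "('o, 'a) grpd \<Rightarrow> ('p, 'b) grpd \<Rightarrow> nat \<Rightarrow> nat \<Rightarrow> nat \<Rightarrow>
     (('o \<times> 'a list) \<times> ('p \<times> 'b list)) chain \<Rightarrow> (('o \<times> 'p) \<times> ('a \<times> 'b) list) chain" where
  "shuffle_chain H K q k l c =
     - (\<Sum>I\<in>{I. I \<subseteq> {..<k + l} \<and> card I = k}.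
          frag_cmul (shuffle_sign (k + l) I) (chain_map q (shuffle_map H K (k + l) I) c))"

definition shuffle_pullback ::
  "('o, 'a) grpd \<Rightarrow> ('p, 'b) grpd \<Rightarrow> nat \<Rightarrow>
     ('o \<times> 'p, 'a \<times> 'b) tot_cochain \<Rightarrow> ('o, 'a, 'p, 'b) bi_cochain" where
  "shuffle_pullback H K n u =
     (\<lambda>(k, l)\<in>{(k, l). k + l \<le> n}. \<lambda>c\<in>binerve_chains H K k l (n - k - l).
        u (k + l) (shuffle_chain H K (n - k - l) k l c))"

text \<open>Cap product of the first factor with the point \<open>1 \<in> \<int>\<^sub>1\<close>: pullback along \<open>y \<mapsto> (1, y)\<close>\<close>

definition cap_xi ::
  "('o, 'a) grpd \<Rightarrow> nat \<Rightarrow> (unit, int, 'o, 'a) bi_cochain \<Rightarrow> ('o, 'a) tot_cochain" where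
  "cap_xi K n w = (\<lambda>l\<in>{..n}. \<lambda>c\<in>nerve_chains K l (n - l).
     w (1, l) (chain_map (n - l) (\<lambda>y. (((), [1]), y)) c))"

text \<open>On the Kuenneth components \<open>H\<^sup>i(\<int>\<^sub>\<bullet>) \<otimes> H\<^sup>j(K\<^sub>\<bullet>)\<close>, \<open>i = 0, 1\<close> (the other groups
  \<open>H\<^sup>i(\<int>\<^sub>\<bullet>)\<close> vanish), \<^const>\<open>cap_xi\<close> is \<open>\<alpha> \<otimes> \<beta> \<mapsto> \<langle>\<alpha>, \<xi>\<rangle> \<beta>\<close>.\<close>

lemma lookup_sum_keys_add:
  fixes f :: "'x \<Rightarrow> int" and c d :: "'x \<Rightarrow>\<^sub>0 int"
  shows "(\<Sum>\<sigma>\<in>Poly_Mapping.keys (c + d). Poly_Mapping.lookup (c + d) \<sigma> * f \<sigma>)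
       = (\<Sum>\<sigma>\<in>Poly_Mapping.keys c. Poly_Mapping.lookup c \<sigma> * f \<sigma>)
         + (\<Sum>\<sigma>\<in>Poly_Mapping.keys d. Poly_Mapping.lookup d \<sigma> * f \<sigma>)"
proof -
  let ?S = "Poly_Mapping.keys c \<union> Poly_Mapping.keys d"
  have *: "(\<Sum>\<sigma>\<in>Poly_Mapping.keys e. Poly_Mapping.lookup e \<sigma> * f \<sigma>)
         = (\<Sum>\<sigma>\<in>?S. Poly_Mapping.lookup e \<sigma> * f \<sigma>)"
    if "Poly_Mapping.keys e \<subseteq> ?S" for e :: "'x \<Rightarrow>\<^sub>0 int"
    by (rule sum.mono_neutral_left) (use that in \<open>auto simp: in_keys_iff\<close>)
  have "(\<Sum>\<sigma>\<in>?S. Poly_Mapping.lookup (c + d) \<sigma> * f \<sigma>)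
      = (\<Sum>\<sigma>\<in>?S. Poly_Mapping.lookup c \<sigma> * f \<sigma>) + (\<Sum>\<sigma>\<in>?S. Poly_Mapping.lookup d \<sigma> * f \<sigma>)"
    by (simp add: lookup_add algebra_simps sum.distrib)
  then show ?thesis
    using *[OF keys_add] *[of c] *[of d] by simp
qed

lemma lookup_sum_keys_diff:
  fixes f :: "'x \<Rightarrow> int" and c d :: "'x \<Rightarrow>\<^sub>0 int"
  shows "(\<Sum>\<sigma>\<in>Poly_Mapping.keys (c - d). Poly_Mapping.lookup (c - d) \<sigma> * f \<sigma>)
       = (\<Sum>\<sigma>\<in>Poly_Mapping.keys c. Poly_Mapping.lookup c \<sigma> * f \<sigma>)
         - (\<Sum>\<sigma>\<in>Poly_Mapping.keys d. Poly_Mapping.lookup d \<sigma> * f \<sigma>)"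
  using lookup_sum_keys_add[of "c - d" d f] by simp

lemma const_smooth_simplex:
  "smooth_simplex q (discrete_mfd UNIV) (\<lambda>t\<in>standard_simplex q. z)"
proof -
  let ?E = "topspace (Euclidean_space (Suc q))"
  have E: "standard_simplex q \<subseteq> ?E"
    by (auto simp: standard_simplex_def topspace_Euclidean_space)
  have "smooth_on (standard_simplex q) (euclidean_mfd (Suc q)) (discrete_mfd UNIV)
          (\<lambda>t\<in>standard_simplex q. z)"
    unfolding smooth_on_def
  proof (intro conjI ballI)
    show "standard_simplex q \<subseteq> mcarrier (euclidean_mfd (Suc q))"
      using E by (simp add: euclidean_mfd_def)
    fix x assume x: "x \<in> standard_simplex q"
    show "\<exists>m U \<phi> n V \<psi> W F.
      (m, U, \<phi>) \<in> charts (euclidean_mfd (Suc q)) \<and> (n, V, \<psi>) \<in> charts (discrete_mfd UNIV) \<and>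
      x \<in> U \<and> (\<lambda>t\<in>standard_simplex q. z) x \<in> V \<and>
      openin (Euclidean_space m) W \<and> \<phi> x \<in> W \<and> W \<subseteq> \<phi> ` U \<and>
      (\<forall>j<n. C_inf_on m W (\<lambda>y. F y j)) \<and>
      (\<forall>y\<in>standard_simplex q \<inter> U. \<phi> y \<in> W \<longrightarrow>
        (\<lambda>t\<in>standard_simplex q. z) y \<in> V \<and>
        (\<forall>j<n. \<psi> ((\<lambda>t\<in>standard_simplex q. z) y) j = F (\<phi> y) j))"
      by (rule exI[of _ "Suc q"], rule exI[of _ ?E], rule exI[of _ "\<lambda>x. x"], rule exI[of _ 0],
          rule exI[of _ "{z}"], rule exI[of _ "\<lambda>_ _. 0"], rule exI[of _ ?E],
          rule exI[of _ "\<lambda>x. x"])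
         (use x E in \<open>auto simp: euclidean_mfd_def discrete_mfd_def\<close>)
  qed
  then show ?thesis
    by (simp add: smooth_simplex_def)
qed

lemma simplex_map_const:
  "simplex_map q f (\<lambda>t\<in>standard_simplex q. z) = (\<lambda>t\<in>standard_simplex q. f z)"
  by (auto simp: simplex_map_def)

lemma const_nerve_simplex_int:
  "(\<lambda>t\<in>standard_simplex q. ((), [m])) \<in> nerve_simplices int_grpd 1 q"
  by (simp add: nerve_simplices_def nerve_def int_grpd_def image_subset_iff
                simplex_map_const const_smooth_simplex)

lemma const_pair_binerve:
  assumes "\<sigma> \<in> nerve_simplices K l q"
  shows "simplex_map q (\<lambda>y. (((), [m]), y)) \<sigma> \<in> binerve_simplices int_grpd K 1 l q"
    and "simplex_map q fst (simplex_map q (\<lambda>y. (((), [m]), y)) \<sigma>) = (\<lambda>t\<in>standard_simplex q. ((), [m]))"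
    and "simplex_map q snd (simplex_map q (\<lambda>y. (((), [m]), y)) \<sigma>) = \<sigma>"
proof -
  have e: "\<sigma> \<in> extensional (standard_simplex q)"
    using assms by (simp add: nerve_simplices_def)
  show 1: "simplex_map q fst (simplex_map q (\<lambda>y. (((), [m]), y)) \<sigma>) = (\<lambda>t\<in>standard_simplex q. ((), [m]))"
    by (auto simp: simplex_map_def)
  show 2: "simplex_map q snd (simplex_map q (\<lambda>y. (((), [m]), y)) \<sigma>) = \<sigma>"
    using e by (auto simp: simplex_map_def extensional_def)
  show "simplex_map q (\<lambda>y. (((), [m]), y)) \<sigma> \<in> binerve_simplices int_grpd K 1 l q"
    unfolding binerve_simplices_def mem_Collect_eq 1 2
    using assms const_nerve_simplex_int by (simp add: simplex_map_def)
qed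

lemma chain_map_binerve:
  assumes "c \<in> nerve_chains K l q"
  shows "chain_map q (\<lambda>y. (((), [m]), y)) c \<in> binerve_chains int_grpd K 1 l q"
proof -
  have "Poly_Mapping.keys c \<subseteq> nerve_simplices K l q"
    using assms by simp
  moreover have "Poly_Mapping.keys (chain_map q (\<lambda>y. (((), [m]), y)) c)
      \<subseteq> simplex_map q (\<lambda>y. (((), [m]), y)) ` Poly_Mapping.keys c"
    using keys_frag_extend[of "frag_of \<circ> simplex_map q (\<lambda>y. (((), [m]), y))" c]
    by (auto simp: chain_map_def)
  ultimately show ?thesis
    using const_pair_binerve(1) by fastforce
qed

lemma cap_xi_exterior_product_1:
  assumes b: "b \<in> carrier (cgrp (tot_complex K) n)"
  shows "cap_xi K n (exterior_product int_grpd K 1 n a b) =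
     (\<lambda>l\<in>{..n}. \<lambda>c\<in>nerve_chains K l (n - l).
        a 1 (frag_of (\<lambda>t\<in>standard_simplex 0. ((), [1]))) * b l c)"
proof -
  let ?\<iota> = "\<lambda>y. (((), [1::int]), y)"
  have "exterior_product int_grpd K 1 n a b (1, l) (chain_map (n - l) ?\<iota> c)
        = a 1 (frag_of (\<lambda>t\<in>standard_simplex 0. ((), [1]))) * b l c"
    if l: "l \<le> n" and c: "c \<in> nerve_chains K l (n - l)" for l c
  proof -
    let ?q = "n - l"
    let ?x = "a 1 (frag_of (\<lambda>t\<in>standard_simplex 0. ((), [1])))"
    let ?f = "\<lambda>\<sigma>. a 1 (frag_of (front_simplex 0 (simplex_map ?q fst \<sigma>))) *
                  b l (frag_of (back_simplex 0 ?q (simplex_map ?q snd \<sigma>)))"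
    have "b \<in> (\<Pi>\<^sub>E p\<in>{..n}. carrier (cochain_group (nerve_simplices K p (n - p))))"
      using b by (simp add: tot_complex_def)
    then have "b l \<in> carrier (cochain_group (nerve_simplices K l ?q))"
      using l by (auto dest: PiE_mem)
    then have bl: "b l \<in> hom (free_Abelian_group (nerve_simplices K l ?q)) integer_group"
      by (simp add: cochain_group_def)
    have b_diff: "b l (d - e) = b l d - b l e"
      if "Poly_Mapping.keys d \<subseteq> nerve_simplices K l ?q" "Poly_Mapping.keys e \<subseteq> nerve_simplices K l ?q" for d e
    proof -
      have "b l (x + y) = b l x + b l y"
        if "Poly_Mapping.keys x \<subseteq> nerve_simplices K l ?q" "Poly_Mapping.keys y \<subseteq> nerve_simplices K l ?q" for x y
        using hom_mult[OF bl, of x y] that by (simp add: integer_group_def)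
      from this[of "d - e" e] that keys_diff[of d e] have "b l (d - e + e) = b l (d - e) + b l e"
        by blast
      then show ?thesis
        by simp
    qed
    have b_0: "b l 0 = 0"
      using b_diff[of 0 0] by simp
    have "Poly_Mapping.keys c \<subseteq> nerve_simplices K l ?q"
      using c by simp
    then have "(\<Sum>\<sigma>\<in>Poly_Mapping.keys (chain_map ?q ?\<iota> c).
                  Poly_Mapping.lookup (chain_map ?q ?\<iota> c) \<sigma> * ?f \<sigma>) = ?x * b l c
               \<and> Poly_Mapping.keys c \<subseteq> nerve_simplices K l ?q"
    proof (induction c rule: frag_induction)
      case zero
      show ?case by (simp add: b_0)
    next
      case (one \<sigma>)
      have v: "standard_simplex 0 \<subseteq> standard_simplex ?q"
        using standard_simplex_mono[of 0 ?q] by simp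
      have 1: "front_simplex 0 (\<lambda>t\<in>standard_simplex ?q. ((), [1::int])) = (\<lambda>t\<in>standard_simplex 0. ((), [1]))"
        using v by (auto simp: front_simplex_def Int_absorb1)
      have 2: "back_simplex 0 ?q \<sigma> = \<sigma>"
        using one by (auto simp: back_simplex_def nerve_simplices_def extensional_def)
      have 3: "(\<Sum>\<sigma>'\<in>Poly_Mapping.keys (frag_of \<tau>). Poly_Mapping.lookup (frag_of \<tau>) \<sigma>' * h \<sigma>') = h \<tau>"
        for \<tau> :: "(nat \<Rightarrow> real) \<Rightarrow> (unit \<times> int list) \<times> 'a \<times> 'b list" and h
        by simp
      show ?case
        unfolding chain_map_of 3 const_pair_binerve(2,3)[OF one] 1 2 using one by (simp del: restrict_apply)
    next
      case (diff d e)
      then have "Poly_Mapping.keys (d - e) \<subseteq> nerve_simplices K l ?q"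
        using keys_diff[of d e] by blast
      with diff show ?case
        by (simp add: chain_map_diff lookup_sum_keys_diff b_diff right_diff_distrib)
    qed
    then show ?thesis
      using l chain_map_binerve[OF c, of 1]
      by (simp add: exterior_product_def mult.assoc)
  qed
  then show ?thesis
    by (auto simp: cap_xi_def fun_eq_iff)
qed

lemma cap_xi_exterior_product_0:
  "cap_xi K n (exterior_product int_grpd K 0 (Suc n) a b) = \<one>\<^bsub>cgrp (tot_complex K) n\<^esub>"
proof -
  have "exterior_product int_grpd K 0 (Suc n) a b (1, l) (chain_map (n - l) (\<lambda>y. (((), [1]), y)) c) = 0"
    if "l \<le> n" "c \<in> nerve_chains K l (n - l)" for l c
    using that chain_map_binerve[OF that(2), of 1] by (simp add: exterior_product_def)
  then show ?thesis
    unfolding cap_xi_def by (simp add: tot_complex_def cochain_group_def product_group_def cong: restrict_cong)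
qed

definition pi_map :: "('o, 'n) grpd \<Rightarrow> 'n \<times> ('n \<times> 'g) list \<Rightarrow> 'o \<times> 'g list" where
  "pi_map N = nerve_map (gtgt N) snd"

definition rho_map ::
  "('o, 'n) grpd \<Rightarrow> ('o, 'g) grpd \<Rightarrow> ('n \<Rightarrow> 'g) \<Rightarrow>
     (unit \<times> 'n) \<times> (int \<times> ('n \<times> 'g)) list \<Rightarrow> 'n \<times> ('n \<times> 'g) list" where
  "rho_map N G \<phi> = nerve_map snd (\<lambda>(k, (x, g)). (x, gmul G (\<phi> (gpow N x k)) g))"

text \<open>
  \<open>\<Phi> : H\<^sup>n\<^sup>+\<^sup>1(G\<^sub>\<bullet>) \<rightarrow> H\<^sup>n((N \<rtimes> G)\<^sub>\<bullet>)\<close>, composed of the maps \<open>\<pi>\<^sup>*\<close>, \<open>\<rho>\<^sup>*\<close>, \<open>\<kappa>\<close> and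
  \<open>\<and>\<xi> \<otimes> id\<close> on cohomology. (On \<open>H\<^sup>0(G\<^sub>\<bullet>)\<close> the target \<open>H\<^sup>-\<^sup>1\<close> is trivial.)
\<close>

definition Phi ::
  "('o, 'n) grpd \<Rightarrow> ('o, 'g) grpd \<Rightarrow> ('n \<Rightarrow> 'g) \<Rightarrow> ('n \<Rightarrow> 'g \<Rightarrow> 'n) \<Rightarrow> nat \<Rightarrow>
     ('o, 'g) tot_cochain set \<Rightarrow> ('n, 'n \<times> 'g) tot_cochain set" where
  "Phi N G \<phi> act n =
     (let K = crossed_product N G act; ZK = prod_grpd int_grpd K in
        induced (tot_complex K) n (cap_xi K n)
      \<circ> induced (bi_complex int_grpd K) (Suc n) (shuffle_pullback int_grpd K (Suc n))
      \<circ> induced (tot_complex ZK) (Suc n) (pullback ZK (Suc n) (rho_map N G \<phi>))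
      \<circ> induced (tot_complex K) (Suc n) (pullback K (Suc n) (pi_map N)))"

text \<open>\<open>(N \<rtimes> G)\<^sub>l \<cong> N \<rtimes> G\<^sub>l\<close>\<close>

definition crossed_nerve_iso :: "'n \<times> ('n \<times> 'g) list \<Rightarrow> 'n \<times> 'g list" where
  "crossed_nerve_iso = (\<lambda>(x, as). (x, map snd as))"

text \<open>The maps \<open>f\<^sub>i\<close> (\<open>1 \<le> i \<le> p\<close>) and \<open>f\<^sub>i\<^sup>~\<close> (\<open>0 \<le> i < p\<close>) from \<open>N \<rtimes> G\<^sub>p\<^sub>-\<^sub>1\<close> to \<open>G\<^sub>p\<close>\<close>

definition f_map ::
  "('o, 'n) grpd \<Rightarrow> ('o, 'g) grpd \<Rightarrow> ('n \<Rightarrow> 'g) \<Rightarrow> nat \<Rightarrow> 'n \<times> 'g list \<Rightarrow> 'o \<times> 'g list" where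
  "f_map N G \<phi> i = (\<lambda>(x, gs).
     (gtgt N x,
      take (i - 1) gs @ [gconj G (\<phi> x) (gprod G (gtgt N x) (take (i - 1) gs))] @ drop (i - 1) gs))"

definition f_tilde ::
  "('o, 'n) grpd \<Rightarrow> ('o, 'g) grpd \<Rightarrow> ('n \<Rightarrow> 'g) \<Rightarrow> nat \<Rightarrow> 'n \<times> 'g list \<Rightarrow> 'o \<times> 'g list" where
  "f_tilde N G \<phi> i = (\<lambda>(x, gs).
     (gtgt N x, take i gs @ [gconj G (\<phi> x) (gprod G (gtgt N x) (take i gs))] @ drop i gs))"

text \<open>\<open>\<Sum>\<^sub>i\<^sub>=\<^sub>1\<^sup>p (-1)\<^sup>i f\<^sub>i\<^sup>*\<close> and \<open>\<Sum>\<^sub>i\<^sub>=\<^sub>0\<^sup>p\<^sup>-\<^sup>1 (-1)\<^sup>i f\<^sub>i\<^sup>~\<^sup>*\<close> in degree \<open>n + 1\<close>, with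
  \<open>p = l + 1\<close> and \<open>q = n - l\<close>; both vanish on \<open>C\<^sup>n\<^sup>+\<^sup>1(G\<^sub>0)\<close>.\<close>

definition f_cochain ::
  "('o, 'n) grpd \<Rightarrow> ('o, 'g) grpd \<Rightarrow> ('n \<Rightarrow> 'g) \<Rightarrow> ('n \<Rightarrow> 'g \<Rightarrow> 'n) \<Rightarrow> nat \<Rightarrow>
     ('o, 'g) tot_cochain \<Rightarrow> ('n, 'n \<times> 'g) tot_cochain" where
  "f_cochain N G \<phi> act n u =
     (\<lambda>l\<in>{..n}. \<lambda>c\<in>nerve_chains (crossed_product N G act) l (n - l).
        \<Sum>i=1..Suc l. (-1) ^ i * u (Suc l) (chain_map (n - l) (f_map N G \<phi> i \<circ> crossed_nerve_iso) c))"

definition T1_cochain ::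
  "('o, 'n) grpd \<Rightarrow> ('o, 'g) grpd \<Rightarrow> ('n \<Rightarrow> 'g) \<Rightarrow> ('n \<Rightarrow> 'g \<Rightarrow> 'n) \<Rightarrow> nat \<Rightarrow>
     ('o, 'g) tot_cochain \<Rightarrow> ('n, 'n \<times> 'g) tot_cochain" where
  "T1_cochain N G \<phi> act n u =
     (\<lambda>l\<in>{..n}. \<lambda>c\<in>nerve_chains (crossed_product N G act) l (n - l).
        \<Sum>i=0..l. (-1) ^ i * u (Suc l) (chain_map (n - l) (f_tilde N G \<phi> i \<circ> crossed_nerve_iso) c))"

definition T1 ::
  "('o, 'n) grpd \<Rightarrow> ('o, 'g) grpd \<Rightarrow> ('n \<Rightarrow> 'g) \<Rightarrow> ('n \<Rightarrow> 'g \<Rightarrow> 'n) \<Rightarrow> nat \<Rightarrow>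
     ('o, 'g) tot_cochain set \<Rightarrow> ('n, 'n \<times> 'g) tot_cochain set" where
  "T1 N G \<phi> act n = induced (tot_complex (crossed_product N G act)) n (T1_cochain N G \<phi> act n)"

end

theory Submission
  imports Defs
begin

text \<open>
  Each map in the composition defining \<open>\<Phi>\<close> is induced by a cochain map, so \<open>\<Phi>\<close> is induced by the
  composite. The last step only sees the component \<open>\<int>\<^sub>1 \<times> (N \<rtimes> G)\<^sub>p\<^sub>-\<^sub>1\<close>, so of all shuffles only the
  \<open>(1, p - 1)\<close>-shuffles matter: they insert the generator \<open>1 \<in> \<int>\<close>, paired with a unit, in one position of a
  string. These insertions form a simplicial homotopy from the embedding \<open>K \<rightarrow> \<int> \<times> K\<close> to itself; hence
  their alternating sum anticommutes with the differentials, and the general Eilenberg--Zilber theorem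
  is not needed. The functor \<open>\<rho>\<close> turns the inserted pair at the object \<open>v = x\<^bsup>g\<^sub>1\<cdots>g\<^sub>i\<^esup>\<close> into the arrow
  \<open>\<phi>(v) = \<phi>(x)\<^bsup>g\<^sub>1\<cdots>g\<^sub>i\<^esup>\<close>, which is the entry inserted by \<open>f\<^sub>i\<^sub>+\<^sub>1\<close>.

  A smooth singular simplex of a nerve is a tuple of plots, that is, of smooth maps on \<open>\<Delta>\<^sup>q\<close>; that the
  structure maps preserve such tuples rests on the chain rule and on the compatibility of charts.
\<close>

text \<open>An operator that keeps q and lowers p by one reverses the sign (-1)^p of the vertical
  differential, so the face part has to change sign as well. Cohomology does not notice this sign,
  because cocycles and coboundaries are closed under inverses. \<open>Phi\<close> applies
  \<open>induced\<close> step by step, through \<open>bi_complex\<close>. The last two steps are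
  merged: \<open>induced\<close> composes as soon as the outer map \<open>cap_xi\<close> is additive
  and preserves coboundaries, and the latter rests on the point 1 being a cycle in the nerve of the
  integers. That rho is a functor uses both axioms of a crossed module: x commutes with its powers,
  so by the Peiffer identity phi(x^k) fixes x and sources are preserved; equivariance gives phi(x^k)
  g = g phi((x^g)^k), hence multiplicativity. The arrows of the crossed product form a fibre product
  inside a product manifold, and no atlas is put on it or on nerves. This is why smoothness is
  expressed through plots, which only have to pass through the structure maps.\<close>

section \<open>Calculus in coordinates\<close>

lemma tendsto_coordinatewise:
  fixes z :: "'t \<Rightarrow> nat \<Rightarrow> real"
  shows "(z \<longlongrightarrow> a) F \<longleftrightarrow> (\<forall>i. ((\<lambda>t. z t i) \<longlongrightarrow> a i) F)"
  using limitin_componentwise[of "\<lambda>_. euclideanreal" UNIV z a F]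
  by (simp add: euclidean_product_topology extensional_def)

section \<open>Open subsets of coordinate spaces inside the space of sequences\<close>

lemma openin_Euclidean_space_iff:
  "openin (Euclidean_space n) W \<longleftrightarrow> (\<exists>U. open U \<and> W = U \<inter> {x. \<forall>i\<ge>n. x i = 0})"
  by (auto simp: Euclidean_space_def openin_subtopology euclidean_product_topology)

lemma openin_Euclidean_space_vanish:
  "openin (Euclidean_space n) W \<Longrightarrow> y \<in> W \<Longrightarrow> n \<le> i \<Longrightarrow> y i = 0"
  by (auto simp: openin_Euclidean_space_iff)

text \<open>The coordinates from index \<open>n\<close> on are constantly 0, so convergence of the
  first \<open>n\<close> coordinates is already convergence of sequences.\<close>

lemma eventually_in_openin_Euclidean_space:
  assumes W: "openin (Euclidean_space n) W" and a: "a \<in> W"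
    and z: "\<And>i. i < n \<Longrightarrow> ((\<lambda>t. z t i) \<longlongrightarrow> a i) F" "\<And>t i. n \<le> i \<Longrightarrow> z t i = 0"
  shows "\<forall>\<^sub>F t in F. z t \<in> W" "(z \<longlongrightarrow> a) F"
proof -
  obtain U where U: "open U" "W = U \<inter> {x. \<forall>i\<ge>n. x i = 0}"
    using W by (auto simp: openin_Euclidean_space_iff)
  have "((\<lambda>t. z t i) \<longlongrightarrow> a i) F" for i
  proof (cases "i < n")
    case False
    then have "a i = 0" "z t i = 0" for t
      using a U z(2) by auto
    then show ?thesis by simp
  qed (use z in auto)
  then show t: "(z \<longlongrightarrow> a) F"
    by (simp add: tendsto_coordinatewise)
  have "\<forall>\<^sub>F t in F. z t \<in> U"
    using t U a by (intro topological_tendstoD) auto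
  then show "\<forall>\<^sub>F t in F. z t \<in> W"
    by eventually_elim (use U z in auto)
qed

lemma openin_Euclidean_space_box:
  assumes W: "openin (Euclidean_space n) W" and a: "a \<in> W"
  obtains e where "e > 0"
    "\<And>y. (\<And>i. i < n \<Longrightarrow> \<bar>y i - a i\<bar> < e) \<Longrightarrow> (\<And>i. n \<le> i \<Longrightarrow> y i = 0) \<Longrightarrow> y \<in> W"
proof -
  have "\<exists>e>0. \<forall>y. (\<forall>i<n. \<bar>y i - a i\<bar> < e) \<longrightarrow> (\<forall>i\<ge>n. y i = 0) \<longrightarrow> y \<in> W"
  proof (rule ccontr)
    assume *: "\<not> ?thesis"
    \<comment> \<open>If every box of radius 1/(k+1) leaves \<open>W\<close>, points chosen outside
      \<open>W\<close> converge to \<open>a\<close> coordinatewise and must eventually lie in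
      \<open>W\<close>.\<close>
    have "\<exists>y. (\<forall>i<n. \<bar>y i - a i\<bar> < inverse (real (Suc k))) \<and> (\<forall>i\<ge>n. y i = 0) \<and> y \<notin> W" for k
      using *[unfolded not_ex, rule_format, of "inverse (real (Suc k))"] by auto
    then obtain y where y: "\<And>k i. i < n \<Longrightarrow> \<bar>y k i - a i\<bar> < inverse (real (Suc k))"
        "\<And>k i. n \<le> i \<Longrightarrow> y k i = 0" "\<And>k. y k \<notin> W"
      by metis
    have "(\<lambda>k. y k i) \<longlonglongrightarrow> a i" if "i < n" for i
    proof -
      have "(\<lambda>k. y k i - a i) \<longlonglongrightarrow> 0"
        by (rule Lim_null_comparison[OF _ LIMSEQ_inverse_real_of_nat])
           (use y(1)[OF that] in \<open>auto intro!: always_eventually less_imp_le\<close>)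
      then show ?thesis
        by (simp add: LIM_zero_iff)
    qed
    from eventually_in_openin_Euclidean_space(1)[OF W a this y(2)] y(3)
    show False by auto
  qed
  then show thesis
    using that by blast
qed

lemma eventually_fun_upd_in_openin:
  "openin (Euclidean_space n) W \<Longrightarrow> x \<in> W \<Longrightarrow> i < n \<Longrightarrow> \<forall>\<^sub>F t in nhds (x i). x(i := t) \<in> W"
proof -
  assume *: "openin (Euclidean_space n) W" "x \<in> W" "i < n"
  have "((\<lambda>t. (x(i := t)) j) \<longlongrightarrow> x j) (nhds (x i))" for j
    by (cases "j = i") (auto simp: filterlim_ident)
  from eventually_in_openin_Euclidean_space(1)[OF *(1,2) this] show ?thesis
    using * openin_Euclidean_space_vanish[OF *(1,2)] by (auto simp: fun_upd_def)
qed

lemma continuous_map_Euclidean_subspace: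
  assumes "openin (Euclidean_space n) W"
  shows "continuous_map (subtopology (Euclidean_space n) W) euclideanreal f \<longleftrightarrow> continuous_on W f"
proof -
  have "{x. \<forall>i\<ge>n. x i = 0} \<inter> W = W"
    using assms by (auto simp: openin_Euclidean_space_iff)
  then have "subtopology (Euclidean_space n) W = top_of_set W"
    by (simp add: Euclidean_space_def subtopology_subtopology euclidean_product_topology)
  then show ?thesis
    by simp
qed

section \<open>Rules for functions of class C^k\<close>

lemma C_k_on_Suc:
  assumes "openin (Euclidean_space n) W"
  shows "C_k_on (Suc k) n W f \<longleftrightarrow> continuous_on W f \<and>
     (\<forall>i<n. (\<forall>x\<in>W. (\<lambda>t. f (x(i := t))) differentiable (at (x i))) \<and>
            C_k_on k n W (partial_deriv i f))"
  using continuous_map_Euclidean_subspace[OF assms] by simp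

lemma C_k_on_0:
  "openin (Euclidean_space n) W \<Longrightarrow> C_k_on 0 n W f \<longleftrightarrow> continuous_on W f"
  by (simp add: continuous_map_Euclidean_subspace)

declare C_k_on.simps[simp del]

lemma C_k_on_imp_continuous:
  "openin (Euclidean_space n) W \<Longrightarrow> C_k_on k n W f \<Longrightarrow> continuous_on W f"
  by (cases k) (auto simp: C_k_on_0 C_k_on_Suc)

lemma C_k_on_SucD:
  "openin (Euclidean_space n) W \<Longrightarrow> C_k_on (Suc k) n W f \<Longrightarrow> C_k_on k n W f"
  by (induction k arbitrary: f) (auto simp: C_k_on_0 C_k_on_Suc)

lemma C_k_on_has_partial_deriv:
  assumes "openin (Euclidean_space n) W" "C_k_on (Suc k) n W f" "x \<in> W" "i < n"
  shows "((\<lambda>t. f (x(i := t))) has_real_derivative partial_deriv i f x) (at (x i))"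
  using assms unfolding partial_deriv_def
  by (auto simp: C_k_on_Suc DERIV_deriv_iff_real_differentiable)

lemma partial_deriv_eqI:
  "((\<lambda>t. f (x(i := t))) has_real_derivative d) (at (x i)) \<Longrightarrow> partial_deriv i f x = d"
  unfolding partial_deriv_def by (rule DERIV_imp_deriv)

lemma C_k_on_subset:
  assumes "openin (Euclidean_space n) W" "openin (Euclidean_space n) W'" "W' \<subseteq> W"
  shows "C_k_on k n W f \<Longrightarrow> C_k_on k n W' f"
proof (induction k arbitrary: f)
  case 0
  then show ?case using assms by (auto simp: C_k_on_0 intro: continuous_on_subset)
next
  case (Suc k)
  then show ?case using assms by (auto simp: C_k_on_Suc intro: continuous_on_subset)
qed

text \<open>A partial derivative at \<open>x\<close> sees only the values at
  \<open>x(i := t)\<close> with \<open>t\<close> near \<open>x i\<close>, and for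
  \<open>i < n\<close> these points stay in the open set \<open>W\<close>.\<close>

lemma C_k_on_cong:
  assumes W: "openin (Euclidean_space n) W" and eq: "\<And>x. x \<in> W \<Longrightarrow> f x = g x"
  shows "C_k_on k n W f \<Longrightarrow> C_k_on k n W g"
  using eq
proof (induction k arbitrary: f g)
  case 0
  then show ?case using W by (auto simp: C_k_on_0 intro: continuous_on_eq)
next
  case (Suc k)
  note d = C_k_on_has_partial_deriv[OF W Suc.prems(1)]
  have d': "((\<lambda>t. g (x(i := t))) has_real_derivative partial_deriv i f x) (at (x i))"
    if "x \<in> W" "i < n" for x i
  proof -
    have "\<forall>\<^sub>F t in nhds (x i). f (x(i := t)) = g (x(i := t))"
      using eventually_fun_upd_in_openin[OF W that] by eventually_elim (use Suc.prems in auto)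
    then show ?thesis
      using d[OF that] DERIV_cong_ev[of "x i" "x i" "\<lambda>t. f (x(i := t))" "\<lambda>t. g (x(i := t))"]
      by blast
  qed
  have "C_k_on k n W (partial_deriv i g)" if "i < n" for i
    by (rule Suc.IH[of "partial_deriv i f"])
       (use that Suc.prems W partial_deriv_eqI[of g, OF d'] in \<open>auto simp: C_k_on_Suc\<close>)
  moreover have "(\<lambda>t. g (x(i := t))) differentiable (at (x i))" if "x \<in> W" "i < n" for x i
    using d'[OF that] unfolding real_differentiable_def by blast
  moreover have "continuous_on W g"
    using Suc.prems W by (auto simp: C_k_on_Suc intro: continuous_on_eq)
  ultimately show ?case
    using W C_k_on_Suc by blast
qed

text \<open>Explicit candidates \<open>f'\<close> replace \<open>partial_deriv\<close>, which is
  known only through \<open>deriv\<close>. The sum, product and chain rules supply them.\<close>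

lemma C_k_on_SucI:
  assumes W: "openin (Euclidean_space n) W" and "continuous_on W f"
    and d: "\<And>x i. x \<in> W \<Longrightarrow> i < n \<Longrightarrow>
              ((\<lambda>t. f (x(i := t))) has_real_derivative f' i x) (at (x i))"
    and "\<And>i. i < n \<Longrightarrow> C_k_on k n W (f' i)"
  shows "C_k_on (Suc k) n W f"
proof -
  have "C_k_on k n W (partial_deriv i f)" if "i < n" for i
    using C_k_on_cong[OF W, of "f' i" "partial_deriv i f" k] assms(4)[OF that] that
      d partial_deriv_eqI by metis
  then show ?thesis
    using assms(2) d by (auto simp: C_k_on_Suc[OF W] real_differentiable_def)
qed

lemma C_k_on_const: "openin (Euclidean_space n) W \<Longrightarrow> C_k_on k n W (\<lambda>_. a)"
proof (induction k arbitrary: a)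
  case (Suc k)
  then show ?case by (auto intro!: C_k_on_SucI[where f' = "\<lambda>_ _. 0"])
qed (simp add: C_k_on_0)

lemma C_k_on_coord: "openin (Euclidean_space n) W \<Longrightarrow> C_k_on k n W (\<lambda>x. x j)"
proof (cases k)
  case (Suc k)
  assume W: "openin (Euclidean_space n) W"
  have "((\<lambda>t. (x(i := t)) j) has_real_derivative of_bool (i = j)) (at (x i))" for x i
    by (cases "i = j") auto
  then show ?thesis
    unfolding Suc
    by (intro C_k_on_SucI[where f' = "\<lambda>i _. of_bool (i = j)"] W C_k_on_const)
       (auto intro: continuous_on_subset[OF continuous_on_product_coordinates])
qed (auto simp: C_k_on_0 intro: continuous_on_subset[OF continuous_on_product_coordinates])

lemma C_k_on_add:
  assumes W: "openin (Euclidean_space n) W"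
  shows "C_k_on k n W f \<Longrightarrow> C_k_on k n W g \<Longrightarrow> C_k_on k n W (\<lambda>x. f x + g x)"
proof (induction k arbitrary: f g)
  case (Suc k)
  note d = C_k_on_has_partial_deriv[OF W Suc.prems(1)] C_k_on_has_partial_deriv[OF W Suc.prems(2)]
  show ?case
    by (rule C_k_on_SucI[OF W _ DERIV_add[OF d]])
       (use Suc W in \<open>auto simp: C_k_on_Suc intro: continuous_intros\<close>)
qed (use W in \<open>auto simp: C_k_on_0 intro: continuous_intros\<close>)

lemma C_k_on_mult:
  assumes W: "openin (Euclidean_space n) W"
  shows "C_k_on k n W f \<Longrightarrow> C_k_on k n W g \<Longrightarrow> C_k_on k n W (\<lambda>x. f x * g x)"
proof (induction k arbitrary: f g)
  case (Suc k)
  note d = C_k_on_has_partial_deriv[OF W Suc.prems(1)] C_k_on_has_partial_deriv[OF W Suc.prems(2)]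
  show ?case
  proof (rule C_k_on_SucI[OF W])
    show "((\<lambda>t. f (x(i := t)) * g (x(i := t))) has_real_derivative
            partial_deriv i f x * g x + f x * partial_deriv i g x) (at (x i))"
      if "x \<in> W" "i < n" for x i
      using DERIV_mult[OF d(1)[OF that] d(2)[OF that]] by (simp add: algebra_simps fun_upd_def)
    show "C_k_on k n W (\<lambda>x. partial_deriv i f x * g x + f x * partial_deriv i g x)" if "i < n" for i
      using Suc that W C_k_on_SucD[OF W Suc.prems(1)] C_k_on_SucD[OF W Suc.prems(2)]
      by (auto intro!: C_k_on_add simp: C_k_on_Suc)
  qed (use Suc W in \<open>auto simp: C_k_on_Suc intro: continuous_intros\<close>)
qed (use W in \<open>auto simp: C_k_on_0 intro: continuous_intros\<close>)

lemma C_k_on_sum: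
  "openin (Euclidean_space n) W \<Longrightarrow> (\<And>j. j \<in> J \<Longrightarrow> C_k_on k n W (f j)) \<Longrightarrow>
     C_k_on k n W (\<lambda>x. \<Sum>j\<in>J. f j x)"
  by (induction J rule: infinite_finite_induct) (auto intro: C_k_on_const C_k_on_add)

text \<open>Class C^1 means continuous partial derivatives, so the classical argument applies: the
  coordinates move from \<open>c t0\<close> to \<open>c t\<close> one after the other, the mean
  value theorem treats each move, and continuity of the partial derivative gives the limit.\<close>

lemma chain_rule_partial_deriv:
  assumes W: "openin (Euclidean_space n) W" and g: "C_k_on (Suc 0) n W g"
    and c0: "\<And>t i. n \<le> i \<Longrightarrow> c t i = 0" and a: "c t0 \<in> W"
    and c: "\<And>i. i < n \<Longrightarrow> ((\<lambda>t. c t i) has_real_derivative d i) (at t0)"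
  shows "((\<lambda>t. g (c t)) has_real_derivative (\<Sum>i<n. partial_deriv i g (c t0) * d i)) (at t0)"
proof -
  let ?a = "c t0"
  \<comment> \<open>\<open>z k t\<close> has the first \<open>k\<close> coordinates of
    \<open>c t\<close> and the remaining ones of \<open>c t0\<close>; the induction on
    \<open>k\<close> ends with \<open>z n = c\<close>.\<close>
  define z where "z k t = (\<lambda>i. if i < k then c t i else ?a i)" for k t
  obtain e where e: "e > 0" and box:
      "\<And>y. (\<And>i. i < n \<Longrightarrow> \<bar>y i - ?a i\<bar> < e) \<Longrightarrow> (\<And>i. n \<le> i \<Longrightarrow> y i = 0) \<Longrightarrow> y \<in> W"
    using openin_Euclidean_space_box[OF W a] by metis
  have lim: "((\<lambda>t. c t i) \<longlongrightarrow> ?a i) (at t0)" if "i < n" for i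
    using DERIV_isCont[OF c[OF that]] by (simp add: isCont_def)
  have near: "\<forall>\<^sub>F t in at t0. \<forall>i\<in>{..<n}. \<bar>c t i - ?a i\<bar> < e"
    by (rule eventually_ball_finite) (use lim tendstoD[OF lim e] in \<open>auto simp: dist_real_def\<close>)
  have "((\<lambda>t. g (z k t)) has_real_derivative (\<Sum>i<k. partial_deriv i g ?a * d i)) (at t0)"
    if "k \<le> n" for k
    using that
  proof (induction k)
    case 0
    then show ?case by (simp add: z_def)
  next
    case (Suc k)
    then have k: "k < n" by simp
    have z_Suc: "z (Suc k) t = (z k t)(k := c t k)" for t
      by (auto simp: z_def)
    have z_k: "(z k t)(k := ?a k) = z k t" for t
      by (auto simp: z_def)
    have inW: "(z k t)(k := s) \<in> W" if t: "\<forall>i\<in>{..<n}. \<bar>c t i - ?a i\<bar> < e"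
      and s: "\<bar>s - ?a k\<bar> \<le> \<bar>c t k - ?a k\<bar>" for t s
    proof (rule box)
      fix i
      show "i < n \<Longrightarrow> \<bar>((z k t)(k := s)) i - ?a i\<bar> < e"
        using s t e le_less_trans by (fastforce simp: z_def)
      show "n \<le> i \<Longrightarrow> ((z k t)(k := s)) i = 0"
        using k c0 by (auto simp: z_def)
    qed
    \<comment> \<open>Mean value theorem along coordinate \<open>k\<close>. The bound on
      \<open>s\<close> is not strict, so that \<open>s = ?a k\<close> serves when the coordinate
      does not move.\<close>
    have "\<exists>s. \<bar>s - ?a k\<bar> \<le> \<bar>c t k - ?a k\<bar> \<and>
        g (z (Suc k) t) - g (z k t) = (c t k - ?a k) * partial_deriv k g ((z k t)(k := s))"
      if t: "\<forall>i\<in>{..<n}. \<bar>c t i - ?a i\<bar> < e" for t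
    proof -
      have D: "((\<lambda>s. g ((z k t)(k := s))) has_real_derivative
          partial_deriv k g ((z k t)(k := s))) (at s)" if "\<bar>s - ?a k\<bar> \<le> \<bar>c t k - ?a k\<bar>" for s
        using C_k_on_has_partial_deriv[OF W g inW[OF t that] k] by simp
      consider "?a k < c t k" | "c t k < ?a k" | "c t k = ?a k"
        by linarith
      then show ?thesis
      proof cases
        case 1
        then obtain s where "s > ?a k" "s < c t k" "g ((z k t)(k := c t k)) - g ((z k t)(k := ?a k))
            = (c t k - ?a k) * partial_deriv k g ((z k t)(k := s))"
          using MVT2[of "?a k" "c t k" "\<lambda>s. g ((z k t)(k := s))"
              "\<lambda>s. partial_deriv k g ((z k t)(k := s))"] D by auto
        then show ?thesis
          by (intro exI[of _ s]) (auto simp: z_Suc z_k)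
      next
        case 2
        then obtain s where "s < ?a k" "s > c t k" "g ((z k t)(k := ?a k)) - g ((z k t)(k := c t k))
            = (?a k - c t k) * partial_deriv k g ((z k t)(k := s))"
          using MVT2[of "c t k" "?a k" "\<lambda>s. g ((z k t)(k := s))"
              "\<lambda>s. partial_deriv k g ((z k t)(k := s))"] D by auto
        then show ?thesis
          by (intro exI[of _ s]) (auto simp: z_Suc z_k algebra_simps)
      next
        case 3
        then show ?thesis
          by (intro exI[of _ "?a k"]) (use z_k[of t] z_Suc[of t] in auto)
      qed
    qed
    then obtain s where s: "\<bar>s t - ?a k\<bar> \<le> \<bar>c t k - ?a k\<bar>"
        "g (z (Suc k) t) - g (z k t) = (c t k - ?a k) * partial_deriv k g ((z k t)(k := s t))"
      if "\<forall>i\<in>{..<n}. \<bar>c t i - ?a i\<bar> < e" for t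
      by metis
    \<comment> \<open>Outside the box \<open>y\<close> takes the value \<open>?a\<close>. Hence in
      each coordinate its distance from \<open>?a\<close> is at most that of \<open>c t\<close>, for
      every \<open>t\<close>, and \<open>y\<close> tends to \<open>?a\<close>.\<close>
    define y where "y t = (if \<forall>i\<in>{..<n}. \<bar>c t i - ?a i\<bar> < e then (z k t)(k := s t) else ?a)" for t
    have "(y \<longlongrightarrow> ?a) (at t0)" and yW: "\<forall>\<^sub>F t in at t0. y t \<in> W"
    proof -
      have "((\<lambda>t. y t i) \<longlongrightarrow> ?a i) (at t0)" if i: "i < n" for i
      proof -
        have "((\<lambda>t. y t i - ?a i) \<longlongrightarrow> 0) (at t0)"
          by (rule tendsto_0_le[where K = 1 and f = "\<lambda>t. c t i - ?a i"])
             (use lim[OF i] s(1) in \<open>auto simp: y_def z_def LIM_zero_iff\<close>)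
        then show ?thesis
          by (simp add: LIM_zero_iff)
      qed
      moreover have "y t i = 0" if "n \<le> i" for t i
        using that k c0 by (auto simp: y_def z_def)
      ultimately show "(y \<longlongrightarrow> ?a) (at t0)" "\<forall>\<^sub>F t in at t0. y t \<in> W"
        using eventually_in_openin_Euclidean_space[OF W a, of y "at t0"] by blast+
    qed
    moreover have "continuous_on W (partial_deriv k g)"
      using g k W by (auto simp: C_k_on_Suc C_k_on_0)
    ultimately have "((\<lambda>t. partial_deriv k g (y t)) \<longlongrightarrow> partial_deriv k g ?a) (at t0)"
      using a continuous_on_tendsto_compose by blast
    moreover have "((\<lambda>t. (c t k - ?a k) / (t - t0)) \<longlongrightarrow> d k) (at t0)"
      using c[OF k] by (simp add: has_field_derivative_iff)
    ultimately have "((\<lambda>t. partial_deriv k g (y t) * ((c t k - ?a k) / (t - t0)))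
        \<longlongrightarrow> partial_deriv k g ?a * d k) (at t0)"
      by (rule tendsto_mult)
    moreover have "\<forall>\<^sub>F t in at t0. partial_deriv k g (y t) * ((c t k - ?a k) / (t - t0))
        = ((g (z (Suc k) t) - g (z k t)) - (g (z (Suc k) t0) - g (z k t0))) / (t - t0)"
      using near
    proof eventually_elim
      case (elim t)
      \<comment> \<open>Both intermediate points equal \<open>c t0\<close> at \<open>t0\<close>, so
        the quotient above is a genuine difference quotient.\<close>
      have "g (z (Suc k) t0) - g (z k t0) = 0"
        by (simp add: z_def if_distrib)
      then show ?case
        using s(2)[OF elim] elim by (simp add: y_def)
    qed
    ultimately have "((\<lambda>t. g (z (Suc k) t) - g (z k t)) has_real_derivative
        partial_deriv k g ?a * d k) (at t0)"
      unfolding has_field_derivative_iff by (rule Lim_transform_eventually)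
    from DERIV_add[OF Suc.IH this] Suc.prems show ?case
      by (simp add: algebra_simps)
  qed
  from this[of n] have "((\<lambda>t. g (z n t)) has_real_derivative (\<Sum>i<n. partial_deriv i g ?a * d i)) (at t0)"
    by simp
  moreover have "z n t = c t" for t
    using c0 by (auto simp: z_def)
  ultimately show ?thesis
    by simp
qed

text \<open>Induction on \<open>k\<close> with \<open>g\<close> varying: by the chain rule the
  partial derivatives of the composite are sums of products of functions of one order less. The
  condition on the coordinates from \<open>n\<close> on makes \<open>F\<close> continuous as a map
  into sequences.\<close>

lemma C_k_on_compose:
  assumes W: "openin (Euclidean_space m) W" and V: "openin (Euclidean_space n) V"
    and F: "\<And>x. x \<in> W \<Longrightarrow> F x \<in> V" and F0: "\<And>x i. n \<le> i \<Longrightarrow> F x i = 0"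
  shows "C_k_on k n V g \<Longrightarrow> (\<And>i. i < n \<Longrightarrow> C_k_on k m W (\<lambda>x. F x i)) \<Longrightarrow> C_k_on k m W (\<lambda>x. g (F x))"
proof (induction k arbitrary: g)
  case 0
  have "continuous_on W (\<lambda>x. F x i)" for i
    using 0 W F0 by (cases "i < n") (auto simp: C_k_on_0)
  then have "continuous_on W F"
    by (intro continuous_on_coordinatewise_then_product) auto
  then show ?case
    using 0 W V F continuous_on_compose2[of V g W F] by (auto simp: C_k_on_0 image_subset_iff)
next
  case (Suc k)
  have F': "C_k_on k m W (\<lambda>x. F x i)" if "i < n" for i
    using C_k_on_SucD[OF W] Suc.prems that by blast
  have cF: "continuous_on W (\<lambda>x. F x i)" for i
    using Suc.prems(2) W F0 by (cases "i < n") (auto simp: C_k_on_Suc)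
  then have "continuous_on W F"
    by (intro continuous_on_coordinatewise_then_product) auto
  then have cont: "continuous_on W (\<lambda>x. g (F x))"
    using Suc.prems V F continuous_on_compose2[of V g W F] by (auto simp: C_k_on_Suc image_subset_iff)
  have g1: "C_k_on (Suc 0) n V g"
    using Suc.prems(1) V
    by (auto simp: C_k_on_Suc C_k_on_0 intro: C_k_on_imp_continuous)
  show ?case
  proof (rule C_k_on_SucI[OF W cont])
    fix x i assume x: "x \<in> W" and i: "i < m"
    show "((\<lambda>t. g (F (x(i := t)))) has_real_derivative
        (\<Sum>j<n. partial_deriv j g (F x) * partial_deriv i (\<lambda>y. F y j) x)) (at (x i))"
      using chain_rule_partial_deriv[OF V g1, of "\<lambda>t. F (x(i := t))" "x i"
          "\<lambda>j. partial_deriv i (\<lambda>y. F y j) x"] F0 F[OF x]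
          C_k_on_has_partial_deriv[OF W Suc.prems(2) x i] by simp
  next
    fix i assume i: "i < m"
    show "C_k_on k m W (\<lambda>x. \<Sum>j<n. partial_deriv j g (F x) * partial_deriv i (\<lambda>y. F y j) x)"
    proof (intro C_k_on_sum C_k_on_mult W)
      fix j assume j: "j \<in> {..<n}"
      show "C_k_on k m W (\<lambda>x. partial_deriv j g (F x))"
        by (rule Suc.IH) (use j Suc.prems(1) V F' in \<open>auto simp: C_k_on_Suc\<close>)
      show "C_k_on k m W (partial_deriv i (\<lambda>y. F y j))"
        using j i Suc.prems(2)[of j] W by (auto simp: C_k_on_Suc)
    qed
  qed
qed

lemma C_inf_on_compose:
  assumes "openin (Euclidean_space m) W" "openin (Euclidean_space n) V"
    and "\<And>x. x \<in> W \<Longrightarrow> F x \<in> V" "\<And>x i. n \<le> i \<Longrightarrow> F x i = 0"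
    and "C_inf_on n V g" "\<And>i. i < n \<Longrightarrow> C_inf_on m W (\<lambda>x. F x i)"
  shows "C_inf_on m W (\<lambda>x. g (F x))"
  using assms(5,6) C_k_on_compose[of m W n V F _ g, OF assms(1-4)] by (simp add: C_inf_on_def)

lemma C_inf_on_subset:
  "openin (Euclidean_space n) W \<Longrightarrow> openin (Euclidean_space n) W' \<Longrightarrow> W' \<subseteq> W \<Longrightarrow>
     C_inf_on n W f \<Longrightarrow> C_inf_on n W' f"
  using C_k_on_subset by (auto simp: C_inf_on_def)

lemma openin_preimage_C_inf:
  assumes W: "openin (Euclidean_space m) W" and V: "openin (Euclidean_space n) V"
    and F0: "\<And>x i. n \<le> i \<Longrightarrow> F x i = 0" and F: "\<And>i. i < n \<Longrightarrow> C_inf_on m W (\<lambda>x. F x i)"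
  shows "openin (Euclidean_space m) {x \<in> W. F x \<in> V}"
proof -
  have "continuous_on W (\<lambda>x. F x i)" for i
    using F[unfolded C_inf_on_def] C_k_on_imp_continuous[OF W] F0 by (cases "i < n") auto
  then have c: "continuous_on W F"
    by (intro continuous_on_coordinatewise_then_product) auto
  obtain V' where V': "open V'" "V = V' \<inter> {x. \<forall>i\<ge>n. x i = 0}"
    using V by (auto simp: openin_Euclidean_space_iff)
  obtain A where A: "open A" "A \<inter> W = F -` V' \<inter> W"
    using c V'(1) by (auto simp: continuous_on_open_invariant)
  obtain W' where W': "open W'" "W = W' \<inter> {x. \<forall>i\<ge>m. x i = 0}"
    using W by (auto simp: openin_Euclidean_space_iff)
  have "{x \<in> W. F x \<in> V} = (A \<inter> W') \<inter> {x. \<forall>i\<ge>m. x i = 0}"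
    using A(2) V'(2) W'(2) F0 by auto
  then show ?thesis
    using A W' by (auto simp: openin_Euclidean_space_iff intro!: exI[of _ "A \<inter> W'"])
qed

section \<open>Plots: smooth maps on simplices\<close>

abbreviation plot :: "nat \<Rightarrow> 'a mfd \<Rightarrow> ((nat \<Rightarrow> real) \<Rightarrow> 'a) \<Rightarrow> bool" where
  "plot q M s \<equiv> smooth_on (standard_simplex q) (euclidean_mfd (Suc q)) M s"

text \<open>The target chart is fixed, and the local representative \<open>F\<close> vanishes from
  index \<open>n\<close> on, which is the form that \<open>C_inf_on_compose\<close> and
  \<open>openin_preimage_C_inf\<close> ask for. \<open>plot_atI\<close> achieves it by
  truncation.\<close>

definition plot_at :: "nat \<Rightarrow> 'a chart \<Rightarrow> ((nat \<Rightarrow> real) \<Rightarrow> 'a) \<Rightarrow> (nat \<Rightarrow> real) \<Rightarrow> bool" where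
  "plot_at q c s x \<longleftrightarrow> (case c of (n, V, \<psi>) \<Rightarrow>
     \<exists>W F. openin (Euclidean_space (Suc q)) W \<and> x \<in> W \<and>
       (\<forall>j<n. C_inf_on (Suc q) W (\<lambda>y. F y j)) \<and> (\<forall>y. \<forall>j\<ge>n. F y j = 0) \<and>
       (\<forall>y\<in>standard_simplex q \<inter> W. s y \<in> V \<and> (\<forall>j<n. \<psi> (s y) j = F y j)))"

lemma plot_atI:
  assumes "openin (Euclidean_space (Suc q)) W" "x \<in> W"
    and F: "\<And>j. j < n \<Longrightarrow> C_inf_on (Suc q) W (\<lambda>y. F y j)"
    and s: "\<And>y. y \<in> standard_simplex q \<Longrightarrow> y \<in> W \<Longrightarrow> s y \<in> V \<and> (\<forall>j<n. \<psi> (s y) j = F y j)"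
  shows "plot_at q (n, V, \<psi>) s x"
proof -
  have "C_inf_on (Suc q) W (\<lambda>y. if j < n then F y j else 0)" if "j < n" for j
    using F[OF that] that by simp
  then show ?thesis
    unfolding plot_at_def prod.case
    by (intro exI[of _ W] exI[of _ "\<lambda>y j. if j < n then F y j else 0"]) (use assms in auto)
qed

lemma plot_atE:
  assumes "plot_at q (n, V, \<psi>) s x"
  obtains W F where "openin (Euclidean_space (Suc q)) W" "x \<in> W"
    "\<And>j. j < n \<Longrightarrow> C_inf_on (Suc q) W (\<lambda>y. F y j)" "\<And>y j. n \<le> j \<Longrightarrow> F y j = 0"
    "\<And>y. y \<in> standard_simplex q \<Longrightarrow> y \<in> W \<Longrightarrow> s y \<in> V"
    "\<And>y j. y \<in> standard_simplex q \<Longrightarrow> y \<in> W \<Longrightarrow> j < n \<Longrightarrow> \<psi> (s y) j = F y j"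
proof -
  from assms obtain W F where "openin (Euclidean_space (Suc q)) W" "x \<in> W"
    "\<forall>j<n. C_inf_on (Suc q) W (\<lambda>y. F y j)" "\<forall>y. \<forall>j\<ge>n. F y j = 0"
    "\<forall>y\<in>standard_simplex q \<inter> W. s y \<in> V \<and> (\<forall>j<n. \<psi> (s y) j = F y j)"
    unfolding plot_at_def prod.case by (elim exE conjE)
  then show thesis
    by (intro that[of W F]) simp_all
qed

lemma standard_simplex_subset_Euclidean_space:
  "standard_simplex q \<subseteq> topspace (Euclidean_space (Suc q))"
  by (auto simp: standard_simplex_def topspace_Euclidean_space)

text \<open>The only chart of \<open>euclidean_mfd\<close> is the identity, so the charts quantified
  in \<open>smooth_on\<close> reduce to the choice of a target chart.\<close>

lemma plot_iff_plot_at: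
  "plot q M s \<longleftrightarrow> (\<forall>x\<in>standard_simplex q. \<exists>c\<in>charts M. plot_at q c s x)" (is "?L \<longleftrightarrow> ?R")
proof
  assume L: ?L
  show ?R
  proof
    fix x assume x: "x \<in> standard_simplex q"
    with L obtain m U \<phi> n V \<psi> W F where
      "(m, U, \<phi>) \<in> charts (euclidean_mfd (Suc q))" "(n, V, \<psi>) \<in> charts M"
      "openin (Euclidean_space m) W" "\<phi> x \<in> W"
      "\<forall>j<n. C_inf_on m W (\<lambda>y. F y j)"
      "\<forall>y\<in>standard_simplex q \<inter> U. \<phi> y \<in> W \<longrightarrow> s y \<in> V \<and> (\<forall>j<n. \<psi> (s y) j = F (\<phi> y) j)"
      unfolding smooth_on_def by blast
    then have "(n, V, \<psi>) \<in> charts M" "openin (Euclidean_space (Suc q)) W" "x \<in> W"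
      "\<forall>j<n. C_inf_on (Suc q) W (\<lambda>y. F y j)"
      "\<forall>y\<in>standard_simplex q \<inter> topspace (Euclidean_space (Suc q)). y \<in> W \<longrightarrow>
         s y \<in> V \<and> (\<forall>j<n. \<psi> (s y) j = F y j)"
      by (simp_all add: euclidean_mfd_def)
    then show "\<exists>c\<in>charts M. plot_at q c s x"
      using standard_simplex_subset_Euclidean_space
      by (intro bexI[of _ "(n, V, \<psi>)"] plot_atI[of q W x n F]) blast+
  qed
next
  assume R: ?R
  have *: "\<exists>m U \<phi> n V \<psi> W F.
        (m, U, \<phi>) \<in> charts (euclidean_mfd (Suc q)) \<and> (n, V, \<psi>) \<in> charts M \<and> x \<in> U \<and> s x \<in> V \<and>
        openin (Euclidean_space m) W \<and> \<phi> x \<in> W \<and> W \<subseteq> \<phi> ` U \<and>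
        (\<forall>j<n. C_inf_on m W (\<lambda>y. F y j)) \<and>
        (\<forall>y\<in>standard_simplex q \<inter> U. \<phi> y \<in> W \<longrightarrow> s y \<in> V \<and> (\<forall>j<n. \<psi> (s y) j = F (\<phi> y) j))"
    if x: "x \<in> standard_simplex q" for x
  proof -
    obtain n V \<psi> where c: "(n, V, \<psi>) \<in> charts M" "plot_at q (n, V, \<psi>) s x"
      using R x by fast
    from c(2) obtain W F where W: "openin (Euclidean_space (Suc q)) W" "x \<in> W"
      "\<And>j. j < n \<Longrightarrow> C_inf_on (Suc q) W (\<lambda>y. F y j)"
      "\<And>y. y \<in> standard_simplex q \<Longrightarrow> y \<in> W \<Longrightarrow> s y \<in> V"
      "\<And>y j. y \<in> standard_simplex q \<Longrightarrow> y \<in> W \<Longrightarrow> j < n \<Longrightarrow> \<psi> (s y) j = F y j"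
      by (rule plot_atE) (rule that)
    show ?thesis
      by (rule exI[of _ "Suc q"], rule exI[of _ "topspace (Euclidean_space (Suc q))"],
          rule exI[of _ "\<lambda>x. x"], rule exI[of _ n], rule exI[of _ V], rule exI[of _ \<psi>],
          rule exI[of _ W], rule exI[of _ F])
         (use c W x openin_subset[OF W(1)] in \<open>auto simp: euclidean_mfd_def\<close>)
  qed
  have "standard_simplex q \<subseteq> mcarrier (euclidean_mfd (Suc q))"
    using standard_simplex_subset_Euclidean_space by (simp add: euclidean_mfd_def)
  then show ?L
    unfolding smooth_on_def by (intro conjI ballI *)
qed

lemma plot_at_cong:
  assumes "openin (Euclidean_space (Suc q)) W" "x \<in> W"
    and "\<And>y. y \<in> standard_simplex q \<Longrightarrow> y \<in> W \<Longrightarrow> s y = t y" and "plot_at q c t x"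
  shows "plot_at q c s x"
proof -
  obtain n V \<psi> where c: "c = (n, V, \<psi>)"
    by (cases c)
  from assms(4)[unfolded c] show ?thesis
  proof (rule plot_atE)
    fix W' F
    assume *: "openin (Euclidean_space (Suc q)) W'" "x \<in> W'"
      "\<And>j. j < n \<Longrightarrow> C_inf_on (Suc q) W' (\<lambda>y. F y j)" "\<And>y j. n \<le> j \<Longrightarrow> F y j = 0"
      "\<And>y. y \<in> standard_simplex q \<Longrightarrow> y \<in> W' \<Longrightarrow> t y \<in> V"
      "\<And>y j. y \<in> standard_simplex q \<Longrightarrow> y \<in> W' \<Longrightarrow> j < n \<Longrightarrow> \<psi> (t y) j = F y j"
    show ?thesis
      unfolding c
    proof (rule plot_atI[where W = "W \<inter> W'" and F = F])
      show "C_inf_on (Suc q) (W \<inter> W') (\<lambda>y. F y j)" if "j < n" for j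
        using C_inf_on_subset[OF *(1) openin_Int[OF assms(1) *(1)] _ *(3)[OF that]] by simp
      show "openin (Euclidean_space (Suc q)) (W \<inter> W')"
        by (rule openin_Int[OF assms(1) *(1)])
      show "x \<in> W \<inter> W'"
        using *(2) assms(2) by blast
      show "s y \<in> V \<and> (\<forall>j<n. \<psi> (s y) j = F y j)" if "y \<in> standard_simplex q" "y \<in> W \<inter> W'" for y
        using assms(3)[of y] *(5)[of y] *(6)[of y] that by simp
    qed
  qed
qed

text \<open>Serves for maps that have a known form only locally: locally constant maps, and powers
  with a locally constant exponent.\<close>

lemma plot_local:
  assumes "\<And>x. x \<in> standard_simplex q \<Longrightarrow>
    \<exists>W t. openin (Euclidean_space (Suc q)) W \<and> x \<in> W \<and> plot q M t \<and>
          (\<forall>y\<in>standard_simplex q \<inter> W. s y = t y)"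
  shows "plot q M s"
  unfolding plot_iff_plot_at
proof
  fix x assume x: "x \<in> standard_simplex q"
  from assms[OF x] obtain W t where W: "openin (Euclidean_space (Suc q)) W" "x \<in> W" "plot q M t"
      and st: "\<forall>y\<in>standard_simplex q \<inter> W. s y = t y"
    by (elim exE conjE)
  obtain c where "c \<in> charts M" "plot_at q c t x"
    using W(3) x unfolding plot_iff_plot_at by blast
  then show "\<exists>c\<in>charts M. plot_at q c s x"
    using plot_at_cong[OF W(1,2), of s t] st by fastforce
qed

lemma openin_topspace_Euclidean_space: "openin (Euclidean_space n) (topspace (Euclidean_space n))"
  by simp

lemma plot_cong:
  assumes "\<And>y. y \<in> standard_simplex q \<Longrightarrow> s y = t y" "plot q M t"
  shows "plot q M s"
  using standard_simplex_subset_Euclidean_space assms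
  by (intro plot_local exI[of _ "topspace (Euclidean_space (Suc q))"] exI[of _ t]) auto

lemma smooth_simplex_restrict:
  "smooth_simplex q M (restrict s (standard_simplex q)) \<longleftrightarrow> plot q M s"
proof -
  have "plot q M (restrict s (standard_simplex q)) \<longleftrightarrow> plot q M s"
    using plot_cong[of q s "restrict s (standard_simplex q)"] plot_cong[of q "restrict s (standard_simplex q)" s]
    by auto
  then show ?thesis
    by (simp add: smooth_simplex_def)
qed

section \<open>Constant and locally constant plots\<close>

lemma plot_const:
  assumes "(n, V, \<psi>) \<in> charts M" "a \<in> V"
  shows "plot q M (\<lambda>_. a)"
  unfolding plot_iff_plot_at
proof
  fix x assume "x \<in> standard_simplex q"
  then have "plot_at q (n, V, \<psi>) (\<lambda>_. a) x"
    using standard_simplex_subset_Euclidean_space assms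
    by (intro plot_atI[where W = "topspace (Euclidean_space (Suc q))" and F = "\<lambda>_. \<psi> a"])
       (auto simp: C_inf_on_def intro: C_k_on_const)
  then show "\<exists>c\<in>charts M. plot_at q c (\<lambda>_. a) x"
    using assms by blast
qed

text \<open>The charts of \<open>discrete_mfd\<close> are single points of dimension 0, so staying
  in a chart means being constant near the given point.\<close>

lemma plot_discrete_iff:
  "plot q (discrete_mfd UNIV) s \<longleftrightarrow>
     (\<forall>x\<in>standard_simplex q. \<exists>W. openin (Euclidean_space (Suc q)) W \<and> x \<in> W \<and>
        (\<forall>y\<in>standard_simplex q \<inter> W. s y = s x))" (is "?L \<longleftrightarrow> ?R")
proof
  assume L: ?L
  show ?R
  proof
    fix x assume x: "x \<in> standard_simplex q"
    with L obtain z where "plot_at q (0, {z}, \<lambda>_ _. 0) s x"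
      unfolding plot_iff_plot_at by (auto simp: discrete_mfd_def)
    then obtain W where "openin (Euclidean_space (Suc q)) W" "x \<in> W"
        "\<And>y. y \<in> standard_simplex q \<Longrightarrow> y \<in> W \<Longrightarrow> s y \<in> {z}"
      by (rule plot_atE) (rule that)
    then show "\<exists>W. openin (Euclidean_space (Suc q)) W \<and> x \<in> W \<and>
        (\<forall>y\<in>standard_simplex q \<inter> W. s y = s x)"
      using x by auto
  qed
next
  assume R: ?R
  have const: "plot q (discrete_mfd UNIV) (\<lambda>_. z)" for z :: 'a
    by (rule plot_const[of 0 "{z}" "\<lambda>_ _. 0"]) (auto simp: discrete_mfd_def)
  show ?L
    by (rule plot_local) (use R const in blast)
qed

lemma plot_discrete_op:
  assumes "plot q (discrete_mfd UNIV) s" "plot q (discrete_mfd UNIV) t"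
  shows "plot q (discrete_mfd UNIV) (\<lambda>y. h (s y) (t y))"
  unfolding plot_discrete_iff
proof
  fix x assume x: "x \<in> standard_simplex q"
  obtain W W' where "openin (Euclidean_space (Suc q)) W" "x \<in> W"
      "\<forall>y\<in>standard_simplex q \<inter> W. s y = s x"
      "openin (Euclidean_space (Suc q)) W'" "x \<in> W'" "\<forall>y\<in>standard_simplex q \<inter> W'. t y = t x"
    using assms x unfolding plot_discrete_iff by meson
  then show "\<exists>W. openin (Euclidean_space (Suc q)) W \<and> x \<in> W \<and>
        (\<forall>y\<in>standard_simplex q \<inter> W. h (s y) (t y) = h (s x) (t x))"
    by (intro exI[of _ "W \<inter> W'"]) (auto simp: openin_Int)
qed

section \<open>Plots in products, and independence of the chart\<close>

lemma plot_at_prod: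
  "plot_at q (m + n, U \<times> V, \<lambda>(x, y) i. if i < m then \<phi> x i else \<psi> y (i - m)) s x \<longleftrightarrow>
     plot_at q (m, U, \<phi>) (fst \<circ> s) x \<and> plot_at q (n, V, \<psi>) (snd \<circ> s) x" (is "?L \<longleftrightarrow> ?R")
proof
  assume ?L
  then show ?R
  proof (rule plot_atE)
    fix W F
    assume *: "openin (Euclidean_space (Suc q)) W" "x \<in> W"
      "\<And>j. j < m + n \<Longrightarrow> C_inf_on (Suc q) W (\<lambda>y. F y j)"
      "\<And>y. y \<in> standard_simplex q \<Longrightarrow> y \<in> W \<Longrightarrow> s y \<in> U \<times> V"
      "\<And>y j. y \<in> standard_simplex q \<Longrightarrow> y \<in> W \<Longrightarrow> j < m + n \<Longrightarrow>
         (case s y of (x, y) \<Rightarrow> \<lambda>i. if i < m then \<phi> x i else \<psi> y (i - m)) j = F y j"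
    have "\<phi> (fst (s y)) j = F y j" if "y \<in> standard_simplex q" "y \<in> W" "j < m" for y j
      using *(5)[of y j] that by (simp add: case_prod_beta)
    moreover have "\<psi> (snd (s y)) j = F y (j + m)" if "y \<in> standard_simplex q" "y \<in> W" "j < n" for y j
      using *(5)[of y "j + m"] that by (simp add: case_prod_beta)
    ultimately show ?R
      using plot_atI[OF *(1,2), of m F "fst \<circ> s" U \<phi>]
        plot_atI[OF *(1,2), of n "\<lambda>y j. F y (j + m)" "snd \<circ> s" V \<psi>] *(3,4) by (auto simp: mem_Times_iff)
  qed
next
  assume R: ?R
  from conjunct1[OF R] obtain W F where *: "openin (Euclidean_space (Suc q)) W" "x \<in> W"
      "\<And>j. j < m \<Longrightarrow> C_inf_on (Suc q) W (\<lambda>y. F y j)"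
      "\<And>y. y \<in> standard_simplex q \<Longrightarrow> y \<in> W \<Longrightarrow> (fst \<circ> s) y \<in> U"
      "\<And>y j. y \<in> standard_simplex q \<Longrightarrow> y \<in> W \<Longrightarrow> j < m \<Longrightarrow> \<phi> ((fst \<circ> s) y) j = F y j"
    by (rule plot_atE) (rule that)
  from conjunct2[OF R] obtain W' F' where **: "openin (Euclidean_space (Suc q)) W'" "x \<in> W'"
      "\<And>j. j < n \<Longrightarrow> C_inf_on (Suc q) W' (\<lambda>y. F' y j)"
      "\<And>y. y \<in> standard_simplex q \<Longrightarrow> y \<in> W' \<Longrightarrow> (snd \<circ> s) y \<in> V"
      "\<And>y j. y \<in> standard_simplex q \<Longrightarrow> y \<in> W' \<Longrightarrow> j < n \<Longrightarrow> \<psi> ((snd \<circ> s) y) j = F' y j"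
    by (rule plot_atE) (rule that)
  have C: "C_inf_on (Suc q) (W \<inter> W') (\<lambda>y. if j < m then F y j else F' y (j - m))" if "j < m + n" for j
    using that C_inf_on_subset[OF *(1) openin_Int[OF *(1) **(1)] _ *(3)]
      C_inf_on_subset[OF **(1) openin_Int[OF *(1) **(1)] _ **(3)] by (cases "j < m") auto
  have v: "\<phi> (fst (s y)) j = F y j" if "y \<in> standard_simplex q" "y \<in> W" "j < m" for y j
    using *(5)[OF that] by simp
  have v': "\<psi> (snd (s y)) j = F' y j" if "y \<in> standard_simplex q" "y \<in> W'" "j < n" for y j
    using **(5)[OF that] by simp
  show ?L
  proof (rule plot_atI[where W = "W \<inter> W'" and F = "\<lambda>y j. if j < m then F y j else F' y (j - m)"])
    show "openin (Euclidean_space (Suc q)) (W \<inter> W')" "x \<in> W \<inter> W'"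
      using * ** by (simp_all add: openin_Int)
    show "s y \<in> U \<times> V \<and> (\<forall>j<m + n. (case s y of (x, y) \<Rightarrow> \<lambda>i. if i < m then \<phi> x i else \<psi> y (i - m)) j
        = (if j < m then F y j else F' y (j - m)))" if y: "y \<in> standard_simplex q" "y \<in> W \<inter> W'" for y
      using *(4)[OF y(1)] **(4)[OF y(1)] v[OF y(1)] v'[OF y(1)] y(2)
      by (simp add: case_prod_beta mem_Times_iff)
  qed (rule C)
qed

lemma charts_prod_mfd:
  "charts (prod_mfd M N) = {(m + n, U \<times> V, \<lambda>(x, y) i. if i < m then \<phi> x i else \<psi> y (i - m)) | m U \<phi> n V \<psi>.
                 (m, U, \<phi>) \<in> charts M \<and> (n, V, \<psi>) \<in> charts N}"
  by (simp add: prod_mfd_def)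

lemma plot_prod_iff:
  "plot q (prod_mfd M N) s \<longleftrightarrow> plot q M (fst \<circ> s) \<and> plot q N (snd \<circ> s)"
proof -
  have "(\<exists>c\<in>charts (prod_mfd M N). plot_at q c s x) \<longleftrightarrow>
      (\<exists>c\<in>charts M. plot_at q c (fst \<circ> s) x) \<and> (\<exists>c\<in>charts N. plot_at q c (snd \<circ> s) x)"
    (is "?L \<longleftrightarrow> ?R") for x
  proof
    assume ?L
    then obtain m U \<phi> n V \<psi> where "(m, U, \<phi>) \<in> charts M" "(n, V, \<psi>) \<in> charts N"
      "plot_at q (m + n, U \<times> V, \<lambda>(x, y) i. if i < m then \<phi> x i else \<psi> y (i - m)) s x"
      unfolding charts_prod_mfd mem_Collect_eq by (elim bexE exE conjE CollectE) simp
    then show ?R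
      unfolding plot_at_prod by blast
  next
    assume ?R
    then obtain m U \<phi> n V \<psi> where c: "(m, U, \<phi>) \<in> charts M" "(n, V, \<psi>) \<in> charts N"
      "plot_at q (m, U, \<phi>) (fst \<circ> s) x" "plot_at q (n, V, \<psi>) (snd \<circ> s) x"
      by (metis prod_cases3)
    then have "(m + n, U \<times> V, \<lambda>(x, y) i. if i < m then \<phi> x i else \<psi> y (i - m)) \<in> charts (prod_mfd M N)"
      unfolding charts_prod_mfd by blast
    then show ?L
      by (rule bexI[rotated]) (simp only: plot_at_prod c)
  qed
  then show ?thesis
    unfolding plot_iff_plot_at by blast
qed

text \<open>In a coherent atlas smoothness of a plot may be tested in any chart; this is what compatibility
  of the charts amounts to, and it is all that the composition of smooth maps needs.\<close>

definition coherent_atlas :: "'a mfd \<Rightarrow> bool" where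
  "coherent_atlas M \<longleftrightarrow>
    (\<forall>m U \<phi> x i. (m, U, \<phi>) \<in> charts M \<longrightarrow> x \<in> U \<longrightarrow> m \<le> i \<longrightarrow> \<phi> x i = 0) \<and>
    (\<forall>q s x c c'. x \<in> standard_simplex q \<longrightarrow> c \<in> charts M \<longrightarrow> c' \<in> charts M \<longrightarrow>
     s x \<in> fst (snd c') \<longrightarrow> plot_at q c s x \<longrightarrow> plot_at q c' s x)"

text \<open>A plot in a product chart is a pair of plots in the factors, so coherence passes to
  products factor by factor. In this way the multiplication and the action, defined on subsets of
  \<open>prod_mfd\<close>, can be composed with plots.\<close>

lemma coherent_atlas_prod:
  assumes "coherent_atlas M" "coherent_atlas N"
  shows "coherent_atlas (prod_mfd M N)"
  unfolding coherent_atlas_def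
proof (intro conjI allI impI)
  fix m U \<phi> x i
  assume "(m, U, \<phi>) \<in> charts (prod_mfd M N)" "x \<in> U" "m \<le> i"
  then show "\<phi> x i = 0"
    using assms unfolding coherent_atlas_def by (fastforce simp: charts_prod_mfd)
next
  fix q s x c c'
  assume x: "x \<in> standard_simplex q" and "c \<in> charts (prod_mfd M N)" "c' \<in> charts (prod_mfd M N)"
    "s x \<in> fst (snd c')" "plot_at q c s x"
  moreover obtain m U \<phi> n V \<psi> where c: "(m, U, \<phi>) \<in> charts M" "(n, V, \<psi>) \<in> charts N"
      "c = (m + n, U \<times> V, \<lambda>(x, y) i. if i < m then \<phi> x i else \<psi> y (i - m))"
    using calculation by (auto simp: charts_prod_mfd)
  moreover obtain m' U' \<phi>' n' V' \<psi>' where c': "(m', U', \<phi>') \<in> charts M" "(n', V', \<psi>') \<in> charts N"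
      "c' = (m' + n', U' \<times> V', \<lambda>(x, y) i. if i < m' then \<phi>' x i else \<psi>' y (i - m'))"
    using calculation by (auto simp: charts_prod_mfd)
  ultimately have "plot_at q (m, U, \<phi>) (fst \<circ> s) x" "(fst \<circ> s) x \<in> fst (snd (m', U', \<phi>'))"
      "plot_at q (n, V, \<psi>) (snd \<circ> s) x" "(snd \<circ> s) x \<in> fst (snd (n', V', \<psi>'))"
    by (auto simp: plot_at_prod mem_Times_iff)
  then have "plot_at q (m', U', \<phi>') (fst \<circ> s) x" "plot_at q (n', V', \<psi>') (snd \<circ> s) x"
    using assms x c c' unfolding coherent_atlas_def by blast+
  then show "plot_at q c' s x"
    by (simp add: c' plot_at_prod)
qed

text \<open>If \<open>F\<close> represents \<open>s\<close> in the chart \<phi>, then the transition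
  map after \<open>F\<close> represents \<open>s\<close> in \<psi>. It is smooth where
  \<open>F\<close> takes values in the \<phi>-image of the overlap, and that image is open, hence so
  is its preimage under \<open>F\<close>.\<close>

lemma coherent_atlas_smooth_manifold:
  assumes M: "smooth_manifold M"
  shows "coherent_atlas M"
  unfolding coherent_atlas_def
proof (intro conjI allI impI)
  fix m U \<phi> x i
  assume c: "(m, U, \<phi>) \<in> charts M" and "x \<in> U" "m \<le> i"
  have "is_chart (mtop M) (m, U, \<phi>)"
    using M c unfolding smooth_manifold_def by blast
  then show "\<phi> x i = 0"
    using openin_Euclidean_space_vanish[of m "\<phi> ` U"] \<open>x \<in> U\<close> \<open>m \<le> i\<close> by (auto simp: is_chart_def)
next
  fix q s x c c'
  assume x: "x \<in> standard_simplex q" and cc: "c \<in> charts M" "c' \<in> charts M"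
    and sx: "s x \<in> fst (snd c')" and p: "plot_at q c s x"
  obtain m U \<phi> n V \<psi> where c: "c = (m, U, \<phi>)" and c': "c' = (n, V, \<psi>)"
    by (metis prod_cases3)
  have ch: "is_chart (mtop M) c" "is_chart (mtop M) c'" "charts_compatible c c'"
    using M cc unfolding smooth_manifold_def by blast+
  have U: "openin (mtop M) U" "openin (Euclidean_space m) (\<phi> ` U)"
      "homeomorphic_map (subtopology (mtop M) U) (subtopology (Euclidean_space m) (\<phi> ` U)) \<phi>"
    and V: "openin (mtop M) V"
    using ch by (auto simp: is_chart_def c c')
  have inj: "inj_on \<phi> U"
    using homeomorphic_imp_injective_map[OF U(3)] openin_subset[OF U(1)]
    by (simp add: Int_absorb1)
  have "openin (subtopology (mtop M) U) (U \<inter> V)"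
    using V by (auto simp: openin_subtopology)
  then have "openin (subtopology (Euclidean_space m) (\<phi> ` U)) (\<phi> ` (U \<inter> V))"
    using homeomorphic_imp_open_map[OF U(3)] by (auto simp: open_map_def)
  then have O: "openin (Euclidean_space m) (\<phi> ` (U \<inter> V))"
    using U(2) openin_trans_full by blast
  from p[unfolded c] obtain W F where W: "openin (Euclidean_space (Suc q)) W" "x \<in> W"
      "\<And>j. j < m \<Longrightarrow> C_inf_on (Suc q) W (\<lambda>y. F y j)" "\<And>y j. m \<le> j \<Longrightarrow> F y j = 0"
      "\<And>y. y \<in> standard_simplex q \<Longrightarrow> y \<in> W \<Longrightarrow> s y \<in> U"
      "\<And>y j. y \<in> standard_simplex q \<Longrightarrow> y \<in> W \<Longrightarrow> j < m \<Longrightarrow> \<phi> (s y) j = F y j"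
    by (rule plot_atE) (rule that)
  \<comment> \<open>Equality of whole sequences: from index \<open>m\<close> on, the chart values
    vanish because they lie in an open subset of the coordinate space, and \<open>F\<close> vanishes
    by the choice made in \<open>plot_at\<close>.\<close>
  have \<phi>: "\<phi> (s y) = F y" if "y \<in> standard_simplex q" "y \<in> W" for y
  proof
    fix j
    have "\<phi> (s y) \<in> \<phi> ` U"
      using W(5)[OF that] by blast
    then show "\<phi> (s y) j = F y j"
      using W(6)[OF that, of j] W(4)[of j y] openin_Euclidean_space_vanish[OF U(2), of _ j]
      by (cases "j < m") auto
  qed
  let ?W = "{y \<in> W. F y \<in> \<phi> ` (U \<inter> V)}"
  have W': "openin (Euclidean_space (Suc q)) ?W"
    by (rule openin_preimage_C_inf[OF W(1) O W(4,3)])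
  show "plot_at q c' s x"
    unfolding c'
  proof (rule plot_atI[OF W', where F = "\<lambda>y. \<psi> (inv_into U \<phi> (F y))"])
    show "x \<in> ?W"
      using W(2) W(5)[OF x W(2)] sx imageI[of "s x" "U \<inter> V" \<phi>] by (simp add: c' \<phi>[OF x W(2)])
    show "C_inf_on (Suc q) ?W (\<lambda>y. \<psi> (inv_into U \<phi> (F y)) j)" if "j < n" for j
      using C_inf_on_compose[OF W' O, of F "\<lambda>y. \<psi> (inv_into U \<phi> y) j"] W(4) that ch(3)
        C_inf_on_subset[OF W(1) W' _ W(3)] by (auto simp: charts_compatible_def c c')
    show "s y \<in> V \<and> (\<forall>j<n. \<psi> (s y) j = \<psi> (inv_into U \<phi> (F y)) j)"
      if y: "y \<in> standard_simplex q" "y \<in> ?W" for y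
    proof -
      have "F y = \<phi> (s y)" "s y \<in> U"
        using W(5) \<phi> y by auto
      moreover then have "s y \<in> V"
        using y inj by (auto dest: inj_onD)
      ultimately show ?thesis
        using inj by simp
    qed
  qed
qed

text \<open>Smoothness of \<open>f\<close> at \<open>s x\<close> comes with its own chart around
  \<open>s x\<close>, perhaps not the one in which \<open>s\<close> is known to be smooth. Coherence
  moves \<open>s\<close> to that chart, and then the local representatives compose.\<close>

lemma plot_compose:
  assumes M: "coherent_atlas M" and s: "plot q M s" and f: "smooth_on S M N f"
    and S: "\<And>y. y \<in> standard_simplex q \<Longrightarrow> s y \<in> S"
  shows "plot q N (\<lambda>y. f (s y))"
  unfolding plot_iff_plot_at
proof
  fix x assume x: "x \<in> standard_simplex q"
  from f S[OF x] obtain m U \<phi> n V \<psi> W F where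
    c: "(m, U, \<phi>) \<in> charts M" "(n, V, \<psi>) \<in> charts N" "s x \<in> U" "f (s x) \<in> V" and
    W: "openin (Euclidean_space m) W" "\<phi> (s x) \<in> W" "W \<subseteq> \<phi> ` U"
    and F: "\<forall>j<n. C_inf_on m W (\<lambda>y. F y j)"
      "\<forall>y\<in>S \<inter> U. \<phi> y \<in> W \<longrightarrow> f y \<in> V \<and> (\<forall>j<n. \<psi> (f y) j = F (\<phi> y) j)"
    unfolding smooth_on_def by blast
  have "plot_at q (m, U, \<phi>) s x"
    using s x M c unfolding plot_iff_plot_at coherent_atlas_def by fastforce
  then obtain W1 F1 where W1: "openin (Euclidean_space (Suc q)) W1" "x \<in> W1"
      "\<And>j. j < m \<Longrightarrow> C_inf_on (Suc q) W1 (\<lambda>y. F1 y j)" "\<And>y j. m \<le> j \<Longrightarrow> F1 y j = 0"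
      "\<And>y. y \<in> standard_simplex q \<Longrightarrow> y \<in> W1 \<Longrightarrow> s y \<in> U"
      "\<And>y j. y \<in> standard_simplex q \<Longrightarrow> y \<in> W1 \<Longrightarrow> j < m \<Longrightarrow> \<phi> (s y) j = F1 y j"
    by (rule plot_atE) (rule that)
  let ?W = "{y \<in> W1. F1 y \<in> W}"
  have W': "openin (Euclidean_space (Suc q)) ?W"
    by (rule openin_preimage_C_inf[OF W1(1) W(1) W1(4,3)])
  have sW: "\<phi> (s y) = F1 y" if "y \<in> standard_simplex q" "y \<in> W1" for y
  proof
    fix j
    show "\<phi> (s y) j = F1 y j"
      using W1(4)[of j y] W1(5)[OF that] W1(6)[OF that, of j] M c(1)
      unfolding coherent_atlas_def by (cases "j < m") auto
  qed
  have "plot_at q (n, V, \<psi>) (\<lambda>y. f (s y)) x"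
  proof (rule plot_atI[OF W', where F = "\<lambda>y. F (F1 y)"])
    show "x \<in> ?W"
      using W1(2) W(2) sW[OF x W1(2)] by simp
    show "C_inf_on (Suc q) ?W (\<lambda>y. F (F1 y) j)" if "j < n" for j
      using C_inf_on_compose[OF W' W(1), of F1 "\<lambda>y. F y j"] W1(4) that F(1)
        C_inf_on_subset[OF W1(1) W' _ W1(3)] by auto
    show "f (s y) \<in> V \<and> (\<forall>j<n. \<psi> (f (s y)) j = F (F1 y) j)"
      if y: "y \<in> standard_simplex q" "y \<in> ?W" for y
      using F(2) S[OF y(1)] W1(5)[OF y(1)] sW[OF y(1)] y(2) by auto
  qed
  then show "\<exists>c\<in>charts N. plot_at q c (\<lambda>y. f (s y)) x"
    using c by blast
qed

lemma plot_simplical_face: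
  assumes s: "plot (Suc q) M s" and k: "k \<le> Suc q"
  shows "plot q M (\<lambda>y. s (simplical_face k y))"
  unfolding plot_iff_plot_at
proof
  fix x assume x: "x \<in> standard_simplex q"
  have face: "simplical_face k y \<in> standard_simplex (Suc q)" if "y \<in> standard_simplex q" for y
    using simplical_face_in_standard_simplex[of "Suc q" k y] k that by simp
  let ?E = "topspace (Euclidean_space (Suc q))"
  obtain n V \<psi> where c: "(n, V, \<psi>) \<in> charts M" "plot_at (Suc q) (n, V, \<psi>) s (simplical_face k x)"
    using s face[OF x] unfolding plot_iff_plot_at by fast
  from c(2) obtain W F where W: "openin (Euclidean_space (Suc (Suc q))) W" "simplical_face k x \<in> W"
      "\<And>j. j < n \<Longrightarrow> C_inf_on (Suc (Suc q)) W (\<lambda>y. F y j)"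
      "\<And>y. y \<in> standard_simplex (Suc q) \<Longrightarrow> y \<in> W \<Longrightarrow> s y \<in> V"
      "\<And>y j. y \<in> standard_simplex (Suc q) \<Longrightarrow> y \<in> W \<Longrightarrow> j < n \<Longrightarrow> \<psi> (s y) j = F y j"
    by (rule plot_atE) (rule that)
  \<comment> \<open>For \<open>y\<close> outside the coordinate space,
    \<open>simplical_face k y\<close> may be nonzero from index q + 2 on. Truncation repairs this
    without changing the values on the simplex.\<close>
  define f :: "(nat \<Rightarrow> real) \<Rightarrow> nat \<Rightarrow> real"
    where "f y i = (if i < Suc (Suc q) then simplical_face k y i else 0)" for y i
  have f: "f y = simplical_face k y" if "y \<in> ?E" for y
    using that k by (auto simp: f_def simplical_face_def topspace_Euclidean_space)
  have f_C: "C_inf_on (Suc q) ?E (\<lambda>y. f y i)" if "i < Suc (Suc q)" for i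
    by (cases i k rule: linorder_cases)
       (use that in \<open>auto simp: C_inf_on_def f_def simplical_face_def intro: C_k_on_coord C_k_on_const\<close>)
  have f0: "f y i = 0" if "Suc (Suc q) \<le> i" for y i
    using that by (simp add: f_def)
  let ?W = "{y \<in> ?E. f y \<in> W}"
  have W': "openin (Euclidean_space (Suc q)) ?W"
    by (rule openin_preimage_C_inf[OF openin_topspace_Euclidean_space W(1) f0 f_C])
  have "plot_at q (n, V, \<psi>) (\<lambda>y. s (simplical_face k y)) x"
  proof (rule plot_atI[OF W', where F = "\<lambda>y. F (f y)"])
    show "x \<in> ?W"
      using W(2) x standard_simplex_subset_Euclidean_space f by fastforce
    show "C_inf_on (Suc q) ?W (\<lambda>y. F (f y) j)" if "j < n" for j
      using C_inf_on_compose[OF W' W(1), of f "\<lambda>y. F y j"] f0 W(3)[OF that]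
        C_inf_on_subset[OF openin_topspace_Euclidean_space W' _ f_C] by auto
    show "s (simplical_face k y) \<in> V \<and> (\<forall>j<n. \<psi> (s (simplical_face k y)) j = F (f y) j)"
      if y: "y \<in> standard_simplex q" "y \<in> ?W" for y
      using y f[of y] W(4,5)[OF face[OF y(1)]] by auto
  qed
  then show "\<exists>c\<in>charts M. plot_at q c (\<lambda>y. s (simplical_face k y)) x"
    using c by blast
qed

section \<open>Nerves of groupoids with smooth structure\<close>

lemma nerve_vertex_Cons: "gsrc K ((g # gs) ! m) = nerve_vertex K (gsrc K g, gs) m"
  by (cases m) (auto simp: nerve_vertex_def)

lemma nerve_vertex_0 [simp]: "nerve_vertex K z 0 = fst z"
  by (simp add: nerve_vertex_def case_prod_beta)

lemma nerve_vertex_Suc [simp]: "nerve_vertex K z (Suc m) = gsrc K (snd z ! m)"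
  by (simp add: nerve_vertex_def case_prod_beta)

text \<open>Collects the smoothness that faces and insertions of units use, tested on plots with
  values in the groupoid. The crossed product qualifies although its arrows need not fill their
  ambient manifold, as they would have to in \<open>lie_groupoid\<close>.\<close>

locale plot_groupoid =
  fixes K :: "('o, 'a) grpd"
  assumes groupoid: "groupoid K"
    and plot_src: "\<And>q s. plot q (arr_mfd K) s \<Longrightarrow> (\<And>y. y \<in> standard_simplex q \<Longrightarrow> s y \<in> arrs K) \<Longrightarrow>
          plot q (obj_mfd K) (\<lambda>y. gsrc K (s y))"
    and plot_id: "\<And>q s. plot q (obj_mfd K) s \<Longrightarrow> (\<And>y. y \<in> standard_simplex q \<Longrightarrow> s y \<in> objs K) \<Longrightarrow>
          plot q (arr_mfd K) (\<lambda>y. gid K (s y))"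
    and plot_mul: "\<And>q s t. plot q (arr_mfd K) s \<Longrightarrow> plot q (arr_mfd K) t \<Longrightarrow>
          (\<And>y. y \<in> standard_simplex q \<Longrightarrow> (s y, t y) \<in> composable K) \<Longrightarrow>
          plot q (arr_mfd K) (\<lambda>y. gmul K (s y) (t y))"
begin

lemma src_closed: "g \<in> arrs K \<Longrightarrow> gsrc K g \<in> objs K"
  and tgt_closed: "g \<in> arrs K \<Longrightarrow> gtgt K g \<in> objs K"
  and id_closed: "x \<in> objs K \<Longrightarrow> gid K x \<in> arrs K"
  and src_id: "x \<in> objs K \<Longrightarrow> gsrc K (gid K x) = x"
  and tgt_id: "x \<in> objs K \<Longrightarrow> gtgt K (gid K x) = x"
  and id_mul: "g \<in> arrs K \<Longrightarrow> gmul K (gid K (gtgt K g)) g = g"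
  and mul_id: "g \<in> arrs K \<Longrightarrow> gmul K g (gid K (gsrc K g)) = g"
  using groupoid by (auto simp: groupoid_def)

lemma mul_closed:
  assumes "g \<in> arrs K" "h \<in> arrs K" "gsrc K g = gtgt K h"
  shows "gmul K g h \<in> arrs K" "gsrc K (gmul K g h) = gsrc K h" "gtgt K (gmul K g h) = gtgt K g"
  using groupoid assms by (auto simp: groupoid_def composable_def)

text \<open>Trades the recursion along the string for a condition at each index, which fits the
  index formulas for faces and insertions.\<close>

lemma path_from_iff:
  "path_from K x gs \<longleftrightarrow> x \<in> objs K \<and>
     (\<forall>m<length gs. gs ! m \<in> arrs K \<and> gtgt K (gs ! m) = nerve_vertex K (x, gs) m)"
proof (induction gs arbitrary: x)
  case (Cons g gs)
  show ?case
    unfolding path_from.simps Cons.IH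
    by (auto simp: All_less_Suc2 nerve_vertex_Cons src_closed tgt_closed)
qed simp

lemma nerve_iff:
  "z \<in> nerve K p \<longleftrightarrow> length (snd z) = p \<and> fst z \<in> objs K \<and>
     (\<forall>m<p. snd z ! m \<in> arrs K \<and> gtgt K (snd z ! m) = nerve_vertex K z m)"
  by (auto simp: nerve_def path_from_iff)

lemma nerve_vertex_in_objs: "z \<in> nerve K p \<Longrightarrow> m \<le> p \<Longrightarrow> nerve_vertex K z m \<in> objs K"
  by (cases m) (auto simp: nerve_iff src_closed)

end

section \<open>Faces of composable strings\<close>

lemma length_nerve_face:
  "length (snd z) = Suc p \<Longrightarrow> j \<le> Suc p \<Longrightarrow> length (snd (nerve_face K (Suc p) j z)) = p"
  by (auto simp: nerve_face_def case_prod_beta)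

lemma fst_nerve_face:
  "length (snd z) = Suc p \<Longrightarrow>
    fst (nerve_face K (Suc p) j z) = (if j = 0 then gsrc K (snd z ! 0) else fst z)"
  by (cases "snd z") (auto simp: nerve_face_def case_prod_beta)

text \<open>One formula covers inner and outer faces: for \<open>j = 0\<close> only the last case
  occurs, for \<open>j = Suc p\<close> only the first.\<close>

lemma nth_nerve_face:
  assumes "length (snd z) = Suc p" "j \<le> Suc p" "m < p"
  shows "snd (nerve_face K (Suc p) j z) ! m =
    (if Suc m < j then snd z ! m
     else if Suc m = j then gmul K (snd z ! m) (snd z ! Suc m) else snd z ! Suc m)"
  using assms by (auto simp: nerve_face_def case_prod_beta nth_tl nth_butlast nth_append nth_Cons' min_def)

text \<open>The j-th face omits the j-th object of the string; a merged arrow keeps the source of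
  its second factor.\<close>

lemma nerve_vertex_face:
  assumes "plot_groupoid K" "z \<in> nerve K (Suc p)" "j \<le> Suc p" "m \<le> p"
  shows "nerve_vertex K (nerve_face K (Suc p) j z) m = nerve_vertex K z (if m < j then m else Suc m)"
proof -
  interpret plot_groupoid K by fact
  show ?thesis
    using assms(2-4) mul_closed(2)[of "snd z ! (m - 1)" "snd z ! m"]
    by (cases m) (auto simp: nerve_iff fst_nerve_face nth_nerve_face)
qed

lemma (in plot_groupoid) nerve_face_in_nerve:
  assumes z: "z \<in> nerve K (Suc p)" and j: "j \<le> Suc p"
  shows "nerve_face K (Suc p) j z \<in> nerve K p"
  unfolding nerve_iff
proof (intro conjI allI impI)
  have v: "nerve_vertex K (nerve_face K (Suc p) j z) m = nerve_vertex K z (if m < j then m else Suc m)"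
    if "m \<le> p" for m
    using nerve_vertex_face[OF plot_groupoid_axioms z j that] .
  show "length (snd (nerve_face K (Suc p) j z)) = p" "fst (nerve_face K (Suc p) j z) \<in> objs K"
    using z j by (auto simp: nerve_iff length_nerve_face fst_nerve_face src_closed)
  fix m assume m: "m < p"
  show "snd (nerve_face K (Suc p) j z) ! m \<in> arrs K"
    using z j m mul_closed(1)[of "snd z ! m" "snd z ! Suc m"] by (auto simp: nerve_iff nth_nerve_face)
  show "gtgt K (snd (nerve_face K (Suc p) j z) ! m) = nerve_vertex K (nerve_face K (Suc p) j z) m"
    using z j m mul_closed(3)[of "snd z ! m" "snd z ! Suc m"] v[of m]
    by (auto simp: nerve_iff nth_nerve_face)
qed

text \<open>\<open>nerve_simplices\<close> stripped of extensionality, so that maps can be composed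
  without restricting them to the simplex each time.\<close>

definition nerve_plot ::
  "('o, 'a) grpd \<Rightarrow> nat \<Rightarrow> nat \<Rightarrow> ((nat \<Rightarrow> real) \<Rightarrow> 'o \<times> 'a list) \<Rightarrow> bool" where
  "nerve_plot K p q s \<longleftrightarrow> (\<forall>y\<in>standard_simplex q. s y \<in> nerve K p) \<and>
     plot q (obj_mfd K) (\<lambda>y. fst (s y)) \<and> (\<forall>i<p. plot q (arr_mfd K) (\<lambda>y. snd (s y) ! i))"

text \<open>The substitute for smoothness of a map between spaces of strings: it is tested on all
  plots, in all dimensions \<open>q\<close>.\<close>

definition nerve_plot_map ::
  "('o, 'a) grpd \<Rightarrow> nat \<Rightarrow> ('p, 'b) grpd \<Rightarrow> nat \<Rightarrow> ('o \<times> 'a list \<Rightarrow> 'p \<times> 'b list) \<Rightarrow> bool" where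
  "nerve_plot_map K r L p f \<longleftrightarrow> (\<forall>q s. nerve_plot K r q s \<longrightarrow> nerve_plot L p q (\<lambda>y. f (s y)))"

lemma nerve_simplices_iff:
  "\<sigma> \<in> nerve_simplices K p q \<longleftrightarrow> \<sigma> \<in> extensional (standard_simplex q) \<and> nerve_plot K p q \<sigma>"
  by (auto simp: nerve_simplices_def nerve_plot_def simplex_map_def smooth_simplex_restrict o_def)

lemma nerve_plot_cong:
  assumes "\<And>y. y \<in> standard_simplex q \<Longrightarrow> s y = t y" "nerve_plot K p q t"
  shows "nerve_plot K p q s"
  using assms plot_cong[of q "\<lambda>y. fst (s y)" "\<lambda>y. fst (t y)"]
    plot_cong[of q "\<lambda>y. snd (s y) ! i" "\<lambda>y. snd (t y) ! i" for i]
  by (auto simp: nerve_plot_def)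

lemma simplex_map_in_nerve_simplices:
  assumes f: "nerve_plot_map K r L p f" and \<sigma>: "\<sigma> \<in> nerve_simplices K r q"
  shows "simplex_map q f \<sigma> \<in> nerve_simplices L p q"
proof -
  have "nerve_plot L p q (\<lambda>y. f (\<sigma> y))"
    using f \<sigma> by (simp add: nerve_plot_map_def nerve_simplices_iff)
  then have "nerve_plot L p q (restrict (f \<circ> \<sigma>) (standard_simplex q))"
    by (rule nerve_plot_cong[rotated]) simp
  then show ?thesis
    by (simp add: nerve_simplices_iff simplex_map_def)
qed

lemma (in plot_groupoid) nerve_plot_map_face:
  assumes "j \<le> Suc p"
  shows "nerve_plot_map K (Suc p) K p (nerve_face K (Suc p) j)"
  unfolding nerve_plot_map_def
proof (intro allI impI)
  fix q s assume s: "nerve_plot K (Suc p) q s"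
  have n: "s y \<in> nerve K (Suc p)" if "y \<in> standard_simplex q" for y
    using s that by (auto simp: nerve_plot_def)
  have l: "length (snd (s y)) = Suc p" if "y \<in> standard_simplex q" for y
    using n[OF that] by (simp add: nerve_iff)
  have a: "plot q (arr_mfd K) (\<lambda>y. snd (s y) ! i)" if "i < Suc p" for i
    using s that by (auto simp: nerve_plot_def)
  show "nerve_plot K p q (\<lambda>y. nerve_face K (Suc p) j (s y))"
    unfolding nerve_plot_def
  proof (intro conjI ballI allI impI)
    show "nerve_face K (Suc p) j (s y) \<in> nerve K p" if "y \<in> standard_simplex q" for y
      using nerve_face_in_nerve n that assms by blast
    show "plot q (obj_mfd K) (\<lambda>y. fst (nerve_face K (Suc p) j (s y)))"
    proof (rule plot_cong)
      show "fst (nerve_face K (Suc p) j (s y)) = (if j = 0 then gsrc K (snd (s y) ! 0) else fst (s y))"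
        if "y \<in> standard_simplex q" for y
        using l[OF that] by (simp add: fst_nerve_face)
      show "plot q (obj_mfd K) (\<lambda>y. if j = 0 then gsrc K (snd (s y) ! 0) else fst (s y))"
        using plot_src[OF a[of 0]] s n by (cases "j = 0") (auto simp: nerve_iff nerve_plot_def)
    qed
    fix i assume i: "i < p"
    show "plot q (arr_mfd K) (\<lambda>y. snd (nerve_face K (Suc p) j (s y)) ! i)"
    proof (rule plot_cong)
      show "snd (nerve_face K (Suc p) j (s y)) ! i = (if Suc i < j then snd (s y) ! i
         else if Suc i = j then gmul K (snd (s y) ! i) (snd (s y) ! Suc i) else snd (s y) ! Suc i)"
        if "y \<in> standard_simplex q" for y
        using l[OF that] i assms by (simp add: nth_nerve_face)
      show "plot q (arr_mfd K) (\<lambda>y. if Suc i < j then snd (s y) ! i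
         else if Suc i = j then gmul K (snd (s y) ! i) (snd (s y) ! Suc i) else snd (s y) ! Suc i)"
        using a i plot_mul[OF a[of i] a[of "Suc i"]] n
        by (cases "Suc i < j"; cases "Suc i = j") (auto simp: nerve_iff composable_def)
    qed
  qed
qed

lemma singular_face_in_nerve_simplices:
  assumes "\<sigma> \<in> nerve_simplices K p (Suc q)" "k \<le> Suc q"
  shows "singular_face (Suc q) k \<sigma> \<in> nerve_simplices K p q"
proof -
  have "simplical_face k y \<in> standard_simplex (Suc q)" if "y \<in> standard_simplex q" for y
    using simplical_face_in_standard_simplex[of "Suc q" k y] assms(2) that by simp
  then have "nerve_plot K p q (\<lambda>y. \<sigma> (simplical_face k y))"
    using assms plot_simplical_face[of q _ "\<lambda>y. fst (\<sigma> y)" k]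
      plot_simplical_face[of q _ "\<lambda>y. snd (\<sigma> y) ! i" k for i]
    by (auto simp: nerve_simplices_iff nerve_plot_def)
  then have "nerve_plot K p q (singular_face (Suc q) k \<sigma>)"
    by (rule nerve_plot_cong[rotated]) (simp add: singular_face_def)
  then show ?thesis
    by (simp add: nerve_simplices_iff singular_face_def)
qed

section \<open>Chains of the nerve and their supports\<close>

lemma keys_add_subset: "Poly_Mapping.keys c \<subseteq> S \<Longrightarrow> Poly_Mapping.keys d \<subseteq> S \<Longrightarrow>
    Poly_Mapping.keys (c + d) \<subseteq> S" for c d :: "'x \<Rightarrow>\<^sub>0 int"
  using keys_add[of c d] by blast

lemma keys_sum_subset: "(\<And>i. i \<in> I \<Longrightarrow> Poly_Mapping.keys (f i) \<subseteq> S) \<Longrightarrow>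
    Poly_Mapping.keys (\<Sum>i\<in>I. f i) \<subseteq> S" for f :: "'i \<Rightarrow> 'x \<Rightarrow>\<^sub>0 int"
  using keys_sum[of f I] by blast

lemma keys_frag_cmul_subset: "Poly_Mapping.keys c \<subseteq> S \<Longrightarrow> Poly_Mapping.keys (frag_cmul k c) \<subseteq> S"
  using keys_cmul[of k c] by blast

lemma keys_frag_extend_subset:
  "(\<And>x. x \<in> Poly_Mapping.keys c \<Longrightarrow> Poly_Mapping.keys (f x) \<subseteq> S) \<Longrightarrow>
     Poly_Mapping.keys (frag_extend f c) \<subseteq> S"
  using keys_frag_extend[of f c] by blast

lemma keys_chain_map:
  assumes "nerve_plot_map K r L p f" "Poly_Mapping.keys c \<subseteq> nerve_simplices K r q"
  shows "Poly_Mapping.keys (chain_map q f c) \<subseteq> nerve_simplices L p q"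
  unfolding chain_map_def
  using assms simplex_map_in_nerve_simplices[OF assms(1)] by (intro keys_frag_extend_subset) auto

lemma chain_map_cong:
  assumes "Poly_Mapping.keys c \<subseteq> nerve_simplices K r q" "\<And>z. z \<in> nerve K r \<Longrightarrow> f z = g z"
  shows "chain_map q f c = chain_map q g c"
  unfolding chain_map_def
proof (rule frag_extend_eq)
  fix \<sigma> assume "\<sigma> \<in> Poly_Mapping.keys c"
  then have "\<forall>y\<in>standard_simplex q. \<sigma> y \<in> nerve K r"
    using assms(1) by (auto simp: nerve_simplices_iff nerve_plot_def)
  then have "simplex_map q f \<sigma> = simplex_map q g \<sigma>"
    using assms(2) unfolding simplex_map_def by (intro restrict_ext) simp
  then show "(frag_of \<circ> simplex_map q f) \<sigma> = (frag_of \<circ> simplex_map q g) \<sigma>"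
    by simp
qed

lemma keys_chain_boundary:
  assumes "Poly_Mapping.keys c \<subseteq> nerve_simplices K p (Suc q)"
  shows "Poly_Mapping.keys (chain_boundary (Suc q) c) \<subseteq> nerve_simplices K p q"
proof -
  have "Poly_Mapping.keys (\<Sum>k\<le>Suc q. frag_cmul ((- 1) ^ k) (frag_of (singular_face (Suc q) k \<sigma>)))
      \<subseteq> nerve_simplices K p q" if "\<sigma> \<in> nerve_simplices K p (Suc q)" for \<sigma>
    by (intro keys_sum_subset keys_frag_cmul_subset) (use singular_face_in_nerve_simplices that in auto)
  then show ?thesis
    using assms unfolding chain_boundary_def by (auto intro!: keys_frag_extend_subset)
qed

text \<open>Valid for an arbitrary \<open>f\<close>: a singular face composes on the right and
  \<open>f\<close> on the left. The restrictions agree because faces map the simplex into the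
  simplex.\<close>

lemma chain_boundary_Suc_chain_map:
  "chain_boundary (Suc q) (chain_map (Suc q) f c) = chain_map q f (chain_boundary (Suc q) c)"
  using subset_UNIV
proof (induction c rule: frag_induction)
  case (one \<sigma>)
  have "singular_face (Suc q) k (simplex_map (Suc q) f \<sigma>) = simplex_map q f (singular_face (Suc q) k \<sigma>)"
    if "k \<le> Suc q" for k
    using that simplical_face_in_standard_simplex[of "Suc q" k]
    by (auto simp: singular_face_def simplex_map_def)
  then show ?case
    by (simp add: chain_boundary_of chain_map_sum del: sum.atMost_Suc)
qed (simp_all add: chain_boundary_diff chain_map_diff)

section \<open>Cochains and pullbacks\<close>

lemma cochain_add:
  assumes "u \<in> carrier (cochain_group S)" "Poly_Mapping.keys c \<subseteq> S" "Poly_Mapping.keys d \<subseteq> S"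
  shows "u (c + d) = u c + u d"
  using assms hom_mult[of u "free_Abelian_group S" integer_group c d]
  by (simp add: cochain_group_def integer_group_def)

lemma cochain_0: "u \<in> carrier (cochain_group S) \<Longrightarrow> u 0 = 0"
  using cochain_add[of u S 0 0] by simp

lemma cochain_minus:
  assumes "u \<in> carrier (cochain_group S)" "Poly_Mapping.keys c \<subseteq> S"
  shows "u (- c) = - u c"
  using cochain_add[OF assms(1), of c "- c"] assms cochain_0[OF assms(1)] by simp

lemma cochain_sum:
  assumes "u \<in> carrier (cochain_group S)" "\<And>i. i \<in> I \<Longrightarrow> Poly_Mapping.keys (c i) \<subseteq> S"
  shows "u (\<Sum>i\<in>I. c i) = (\<Sum>i\<in>I. u (c i))"
  using assms(2)
proof (induction I rule: infinite_finite_induct)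
  case (insert i I)
  then show ?case
    using keys_sum_subset[of I c S] by (simp add: cochain_add[OF assms(1)])
qed (simp_all add: cochain_0[OF assms(1)])

lemma cochain_sign:
  assumes "u \<in> carrier (cochain_group S)" "Poly_Mapping.keys c \<subseteq> S"
  shows "u (frag_cmul ((- 1) ^ k) c) = (- 1) ^ k * u c"
  using cochain_minus[OF assms] by (cases "even k") auto

lemma cochain_groupI:
  assumes "\<And>c d. Poly_Mapping.keys c \<subseteq> S \<Longrightarrow> Poly_Mapping.keys d \<subseteq> S \<Longrightarrow> u (c + d) = u c + u d"
  shows "(\<lambda>c\<in>carrier (free_Abelian_group S). u c) \<in> carrier (cochain_group S)"
  using assms keys_add_subset[of _ S]
  by (auto simp: cochain_group_def integer_group_def hom_def)

lemma cochain_pullback: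
  assumes "u \<in> carrier (cochain_group S)"
    and "\<And>c d. h (c + d) = h c + h d"
    and "\<And>c. Poly_Mapping.keys c \<subseteq> T \<Longrightarrow> Poly_Mapping.keys (h c) \<subseteq> S"
  shows "(\<lambda>c\<in>carrier (free_Abelian_group T). u (h c)) \<in> carrier (cochain_group T)"
  using assms by (intro cochain_groupI) (simp add: cochain_add)

lemma comm_group_cochain_group: "comm_group (cochain_group S)"
proof -
  let ?F = "carrier (free_Abelian_group S)"
  have ext: "u = v" if "u \<in> carrier (cochain_group S)" "v \<in> carrier (cochain_group S)"
    "\<And>c. Poly_Mapping.keys c \<subseteq> S \<Longrightarrow> u c = v c" for u v
    using that by (intro extensionalityI[of u ?F v]) (auto simp: cochain_group_def)
  have c: "(\<lambda>c\<in>?F. u c + v c) \<in> carrier (cochain_group S)" "(\<lambda>c\<in>?F. - u c) \<in> carrier (cochain_group S)"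
    if "u \<in> carrier (cochain_group S)" "v \<in> carrier (cochain_group S)" for u v
    using that by (auto intro!: cochain_groupI simp: cochain_add simp del: restrict_apply)
  have "(\<lambda>c\<in>?F. 0) \<in> carrier (cochain_group S)"
    by (rule cochain_groupI) simp
  then have one: "\<one>\<^bsub>cochain_group S\<^esub> = (\<lambda>c\<in>?F. 0)" "(\<lambda>c\<in>?F. 0) \<in> carrier (cochain_group S)"
    by (simp_all add: cochain_group_def)
  have mult: "u \<otimes>\<^bsub>cochain_group S\<^esub> v = (\<lambda>c\<in>?F. u c + v c)" for u v
    by (simp add: cochain_group_def)
  show ?thesis
  proof (rule comm_groupI)
    fix u v w
    assume u: "u \<in> carrier (cochain_group S)"
    then show "\<exists>v\<in>carrier (cochain_group S). v \<otimes>\<^bsub>cochain_group S\<^esub> u = \<one>\<^bsub>cochain_group S\<^esub>"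
      using c(2)[of u] by (intro bexI[of _ "\<lambda>c\<in>?F. - u c"]) (auto simp: mult one)
    show "\<one>\<^bsub>cochain_group S\<^esub> \<otimes>\<^bsub>cochain_group S\<^esub> u = u"
    proof (rule ext)
      show "\<one>\<^bsub>cochain_group S\<^esub> \<otimes>\<^bsub>cochain_group S\<^esub> u \<in> carrier (cochain_group S)"
        using c(1)[OF one(2) u] by (simp only: mult one(1))
    qed (use u in \<open>auto simp: mult one(1)\<close>)
    assume v: "v \<in> carrier (cochain_group S)"
    show "u \<otimes>\<^bsub>cochain_group S\<^esub> v \<in> carrier (cochain_group S)"
      using c u v by (simp add: mult)
    show "u \<otimes>\<^bsub>cochain_group S\<^esub> v = v \<otimes>\<^bsub>cochain_group S\<^esub> u"
      by (simp add: mult add.commute)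
    show "u \<otimes>\<^bsub>cochain_group S\<^esub> v \<otimes>\<^bsub>cochain_group S\<^esub> w = u \<otimes>\<^bsub>cochain_group S\<^esub> (v \<otimes>\<^bsub>cochain_group S\<^esub> w)"
      by (auto simp: mult add.assoc)
  qed (use one in auto)
qed

lemma inv_cochain_group:
  assumes "u \<in> carrier (cochain_group S)"
  shows "inv\<^bsub>cochain_group S\<^esub> u = (\<lambda>c\<in>carrier (free_Abelian_group S). - u c)"
proof -
  interpret comm_group "cochain_group S"
    by (rule comm_group_cochain_group)
  have "(\<lambda>c\<in>carrier (free_Abelian_group S). - u c) \<in> carrier (cochain_group S)"
    using assms by (intro cochain_groupI) (simp add: cochain_add)
  moreover have "(\<lambda>c\<in>carrier (free_Abelian_group S). - u c) \<otimes>\<^bsub>cochain_group S\<^esub> u = \<one>\<^bsub>cochain_group S\<^esub>"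
    by (auto simp: cochain_group_def)
  ultimately show ?thesis
    using assms inv_equality by blast
qed

lemma comm_group_product_group:
  assumes "\<And>i. i \<in> I \<Longrightarrow> comm_group (G i)"
  shows "comm_group (product_group I G)"
proof (rule group.group_comm_groupI)
  show "group (product_group I G)"
    using assms by (simp add: comm_group.axioms)
  show "x \<otimes>\<^bsub>product_group I G\<^esub> y = y \<otimes>\<^bsub>product_group I G\<^esub> x"
    if "x \<in> carrier (product_group I G)" "y \<in> carrier (product_group I G)" for x y
    using that assms by (auto intro!: restrict_ext comm_groupE(4) dest: PiE_mem)
qed

section \<open>The groups and the differential of the total complex\<close>

lemma comm_group_tot_complex: "comm_group (cgrp (tot_complex K) n)"
  by (simp add: tot_complex_def comm_group_product_group comm_group_cochain_group)

lemma tot_carrier_iff: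
  "u \<in> carrier (cgrp (tot_complex K) n) \<longleftrightarrow>
     u \<in> extensional {..n} \<and> (\<forall>p\<le>n. u p \<in> carrier (cochain_group (nerve_simplices K p (n - p))))"
  by (auto simp: tot_complex_def PiE_iff)

lemma tot_eqI:
  assumes "u \<in> carrier (cgrp (tot_complex K) n)" "v \<in> carrier (cgrp (tot_complex K) n)"
    and "\<And>p c. p \<le> n \<Longrightarrow> Poly_Mapping.keys c \<subseteq> nerve_simplices K p (n - p) \<Longrightarrow> u p c = v p c"
  shows "u = v"
proof (rule extensionalityI[of _ "{..n}"])
  fix p assume p: "p \<in> {..n}"
  show "u p = v p"
    by (rule extensionalityI[of _ "nerve_chains K p (n - p)"])
       (use assms p in \<open>auto simp: tot_carrier_iff cochain_group_def\<close>)
qed (use assms in \<open>auto simp: tot_carrier_iff\<close>)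

lemma tot_mult:
  "(u \<otimes>\<^bsub>cgrp (tot_complex K) n\<^esub> v) =
     (\<lambda>p\<in>{..n}. \<lambda>c\<in>nerve_chains K p (n - p). u p c + v p c)"
  by (auto simp: tot_complex_def cochain_group_def)

lemma tot_one: "\<one>\<^bsub>cgrp (tot_complex K) n\<^esub> = (\<lambda>p\<in>{..n}. \<lambda>c\<in>nerve_chains K p (n - p). 0)"
  by (auto simp: tot_complex_def cochain_group_def)

lemma tot_inv:
  assumes "u \<in> carrier (cgrp (tot_complex K) n)"
  shows "inv\<^bsub>cgrp (tot_complex K) n\<^esub> u = (\<lambda>p\<in>{..n}. \<lambda>c\<in>nerve_chains K p (n - p). - u p c)"
  using assms
  by (auto simp: tot_complex_def inv_cochain_group comm_group.axioms(2)[OF comm_group_cochain_group]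
      PiE_iff intro!: restrict_ext)

lemma tot_diff:
  assumes "p \<le> Suc n" "Poly_Mapping.keys c \<subseteq> nerve_simplices K p (Suc n - p)"
  shows "cdiff (tot_complex K) n u p c =
    (if p \<le> n then (-1) ^ p * u p (chain_boundary (Suc n - p) c) else 0) +
    (if 1 \<le> p then u (p - 1) (alt_push (Suc n - p) p (nerve_face K p) c) else 0)"
  using assms by (simp add: tot_complex_def)

text \<open>The differential, the pullbacks and \<open>loop_transgression\<close> all have this
  shape of a restricted family; what remains for each of them is additivity in the chain and in the
  cochain.\<close>

lemma tot_homI:
  assumes "\<And>u p. u \<in> carrier (cgrp (tot_complex L) m) \<Longrightarrow> p \<le> n \<Longrightarrow>
      (\<lambda>c\<in>nerve_chains K p (n - p). f u p c) \<in> carrier (cochain_group (nerve_simplices K p (n - p)))"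
    and "\<And>u v p c. u \<in> carrier (cgrp (tot_complex L) m) \<Longrightarrow> v \<in> carrier (cgrp (tot_complex L) m) \<Longrightarrow>
      p \<le> n \<Longrightarrow> Poly_Mapping.keys c \<subseteq> nerve_simplices K p (n - p) \<Longrightarrow>
      f (u \<otimes>\<^bsub>cgrp (tot_complex L) m\<^esub> v) p c = f u p c + f v p c"
  shows "(\<lambda>u. \<lambda>p\<in>{..n}. \<lambda>c\<in>nerve_chains K p (n - p). f u p c)
     \<in> hom (cgrp (tot_complex L) m) (cgrp (tot_complex K) n)"
proof (rule homI)
  fix u v assume uv: "u \<in> carrier (cgrp (tot_complex L) m)" "v \<in> carrier (cgrp (tot_complex L) m)"
  show "(\<lambda>p\<in>{..n}. \<lambda>c\<in>nerve_chains K p (n - p). f u p c) \<in> carrier (cgrp (tot_complex K) n)"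
    unfolding tot_carrier_iff using uv assms(1) by (auto simp del: carrier_free_Abelian_group_iff)
  show "(\<lambda>p\<in>{..n}. \<lambda>c\<in>nerve_chains K p (n - p). f (u \<otimes>\<^bsub>cgrp (tot_complex L) m\<^esub> v) p c) =
     (\<lambda>p\<in>{..n}. \<lambda>c\<in>nerve_chains K p (n - p). f u p c) \<otimes>\<^bsub>cgrp (tot_complex K) n\<^esub>
     (\<lambda>p\<in>{..n}. \<lambda>c\<in>nerve_chains K p (n - p). f v p c)"
    unfolding tot_mult[of K] using assms(2)[OF uv] by (auto intro!: restrict_ext)
qed

lemma keys_alt_push:
  assumes "\<And>j. j \<le> p \<Longrightarrow> nerve_plot_map K r L r' (\<epsilon> j)" "Poly_Mapping.keys c \<subseteq> nerve_simplices K r q"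
  shows "Poly_Mapping.keys (alt_push q p \<epsilon> c) \<subseteq> nerve_simplices L r' q"
  unfolding alt_push_def using assms by (intro keys_sum_subset keys_frag_cmul_subset keys_chain_map) auto

lemma alt_push_add: "alt_push q p \<epsilon> (c + d) = alt_push q p \<epsilon> c + alt_push q p \<epsilon> d"
  by (simp add: alt_push_def chain_map_add frag_cmul_distrib2 sum.distrib)

lemma cochain_alt_push:
  assumes "u \<in> carrier (cochain_group (nerve_simplices L r' q))"
    and "\<And>j. j \<le> p \<Longrightarrow> nerve_plot_map K r L r' (\<epsilon> j)" "Poly_Mapping.keys c \<subseteq> nerve_simplices K r q"
  shows "u (alt_push q p \<epsilon> c) = (\<Sum>j\<le>p. (-1) ^ j * u (chain_map q (\<epsilon> j) c))"
proof -
  have k: "Poly_Mapping.keys (chain_map q (\<epsilon> j) c) \<subseteq> nerve_simplices L r' q" if "j \<le> p" for j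
    using keys_chain_map assms(2,3) that by blast
  show ?thesis
    unfolding alt_push_def using k
    by (subst cochain_sum[OF assms(1)])
       (auto intro!: keys_frag_cmul_subset sum.cong simp: cochain_sign[OF assms(1)])
qed

context plot_groupoid
begin

lemma keys_alt_push_face:
  "1 \<le> p \<Longrightarrow> Poly_Mapping.keys c \<subseteq> nerve_simplices K p q \<Longrightarrow>
     Poly_Mapping.keys (alt_push q p (nerve_face K p) c) \<subseteq> nerve_simplices K (p - 1) q"
  using nerve_plot_map_face[of _ "p - 1"] by (intro keys_alt_push[of p K p K "p - 1"]) auto

lemma tot_diff_hom: "cdiff (tot_complex K) n \<in> hom (cgrp (tot_complex K) n) (cgrp (tot_complex K) (Suc n))"
proof -
  define d where "d u p c = (if p \<le> n then (-1) ^ p * u p (chain_boundary (Suc n - p) c) else 0) +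
    (if 1 \<le> p then u (p - 1) (alt_push (Suc n - p) p (nerve_face K p) c) else 0)"
    for u :: "('o, 'a) tot_cochain" and p c
  have kb: "Poly_Mapping.keys (chain_boundary (Suc n - p) c) \<subseteq> nerve_simplices K p (n - p)"
    if "p \<le> n" "Poly_Mapping.keys c \<subseteq> nerve_simplices K p (Suc n - p)" for p and c :: "('o \<times> 'a list) chain"
    using keys_chain_boundary[of c K p "n - p"] that by (simp add: Suc_diff_le)
  \<comment> \<open>A face lowers \<open>p\<close> and keeps the singular degree:
    \<open>n - (p - 1) = Suc n - p\<close> for \<open>1 \<le> p\<close>.\<close>
  have ka: "Poly_Mapping.keys (alt_push (Suc n - p) p (nerve_face K p) c) \<subseteq> nerve_simplices K (p - 1) (n - (p - 1))"
    if "1 \<le> p" "p \<le> Suc n" "Poly_Mapping.keys c \<subseteq> nerve_simplices K p (Suc n - p)" for p and c :: "('o \<times> 'a list) chain"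
    using keys_alt_push_face[OF that(1,3)] that by (cases p) auto
  have "cdiff (tot_complex K) n = (\<lambda>u. \<lambda>p\<in>{..Suc n}. \<lambda>c\<in>nerve_chains K p (Suc n - p). d u p c)"
    by (simp add: tot_complex_def d_def)
  also have "\<dots> \<in> hom (cgrp (tot_complex K) n) (cgrp (tot_complex K) (Suc n))"
  proof (rule tot_homI)
    fix u p assume u: "u \<in> carrier (cgrp (tot_complex K) n)" and p: "p \<le> Suc n"
    show "(\<lambda>c\<in>nerve_chains K p (Suc n - p). d u p c) \<in> carrier (cochain_group (nerve_simplices K p (Suc n - p)))"
    proof (rule cochain_groupI)
      fix c e :: "('o \<times> 'a list) chain"
      assume c: "Poly_Mapping.keys c \<subseteq> nerve_simplices K p (Suc n - p)"
        "Poly_Mapping.keys e \<subseteq> nerve_simplices K p (Suc n - p)"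
      have "u p (chain_boundary (Suc n - p) (c + e)) =
          u p (chain_boundary (Suc n - p) c) + u p (chain_boundary (Suc n - p) e)" if "p \<le> n"
        unfolding chain_boundary_add
        by (rule cochain_add[of _ "nerve_simplices K p (n - p)"]) (use u c that kb in \<open>auto simp: tot_carrier_iff\<close>)
      moreover have "u (p - 1) (alt_push (Suc n - p) p (nerve_face K p) (c + e)) =
          u (p - 1) (alt_push (Suc n - p) p (nerve_face K p) c) +
          u (p - 1) (alt_push (Suc n - p) p (nerve_face K p) e)" if "1 \<le> p"
      proof -
        have "p - 1 \<le> n"
          using p by simp
        then have "u (p - 1) \<in> carrier (cochain_group (nerve_simplices K (p - 1) (n - (p - 1))))"
          using u unfolding tot_carrier_iff by blast
        then show ?thesis
          unfolding alt_push_add using ka[OF that p] c by (intro cochain_add) blast+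
      qed
      ultimately show "d u p (c + e) = d u p c + d u p e"
        by (simp add: d_def algebra_simps del: diff_is_0_eq')
    qed
  next
    fix u v p and c :: "('o \<times> 'a list) chain"
    assume "u \<in> carrier (cgrp (tot_complex K) n)" "v \<in> carrier (cgrp (tot_complex K) n)" "p \<le> Suc n"
      "Poly_Mapping.keys c \<subseteq> nerve_simplices K p (Suc n - p)"
    then show "d (u \<otimes>\<^bsub>cgrp (tot_complex K) n\<^esub> v) p c = d u p c + d v p c"
      using kb[of p c] ka[of p c] by (auto simp: d_def tot_mult algebra_simps simp del: diff_is_0_eq')
  qed
  finally show ?thesis .
qed

end

section \<open>Pullback of cochains along simplicial maps\<close>

lemma pullback_hom:
  fixes K :: "('a, 'b) grpd"
  assumes "\<And>p. p \<le> n \<Longrightarrow> nerve_plot_map K p L p f"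
  shows "pullback K n f \<in> hom (cgrp (tot_complex L) n) (cgrp (tot_complex K) n)"
proof -
  have "(\<lambda>u. \<lambda>p\<in>{..n}. \<lambda>c\<in>nerve_chains K p (n - p). u p (chain_map (n - p) f c))
      \<in> hom (cgrp (tot_complex L) n) (cgrp (tot_complex K) n)"
  proof (rule tot_homI)
    fix u p assume "u \<in> carrier (cgrp (tot_complex L) n)" "p \<le> n"
    then show "(\<lambda>c\<in>nerve_chains K p (n - p). u p (chain_map (n - p) f c))
        \<in> carrier (cochain_group (nerve_simplices K p (n - p)))"
      using keys_chain_map[OF assms] 
      by (intro cochain_pullback[of _ "nerve_simplices L p (n - p)"])
         (auto simp: tot_carrier_iff chain_map_add)
  next
    fix u v p and c :: "('a \<times> 'b list) chain"
    assume "p \<le> n" "Poly_Mapping.keys c \<subseteq> nerve_simplices K p (n - p)"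
    then show "(u \<otimes>\<^bsub>cgrp (tot_complex L) n\<^esub> v) p (chain_map (n - p) f c) =
        u p (chain_map (n - p) f c) + v p (chain_map (n - p) f c)"
      using keys_chain_map[OF assms] by (auto simp: tot_mult)
  qed
  then show ?thesis
    by (simp add: pullback_def[abs_def])
qed

lemma chain_map_comp: "chain_map q f (chain_map q g c) = chain_map q (\<lambda>z. f (g z)) c"
  using chain_map_compose[of q f g] by (simp add: o_def fun_eq_iff)

text \<open>The two parts of the differential are treated separately: chain maps commute with the
  singular boundary, and \<open>f\<close> commutes with the faces. The latter holds only on strings
  of the nerve, hence the appeal to \<open>chain_map_cong\<close>.\<close>

lemma pullback_diff:
  fixes K :: "('a, 'b) grpd"
  assumes K: "plot_groupoid K" and L: "plot_groupoid L"
    and f: "\<And>p. nerve_plot_map K p L p f"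
    and face: "\<And>p j z. j \<le> Suc p \<Longrightarrow> z \<in> nerve K (Suc p) \<Longrightarrow>
      f (nerve_face K (Suc p) j z) = nerve_face L (Suc p) j (f z)"
    and u: "u \<in> carrier (cgrp (tot_complex L) n)"
  shows "pullback K (Suc n) f (cdiff (tot_complex L) n u) = cdiff (tot_complex K) n (pullback K n f u)"
proof (rule tot_eqI)
  interpret K: plot_groupoid K by fact
  interpret L: plot_groupoid L by fact
  show "pullback K (Suc n) f (cdiff (tot_complex L) n u) \<in> carrier (cgrp (tot_complex K) (Suc n))"
    "cdiff (tot_complex K) n (pullback K n f u) \<in> carrier (cgrp (tot_complex K) (Suc n))"
    using hom_in_carrier[OF pullback_hom[OF f] hom_in_carrier[OF L.tot_diff_hom u]]
      hom_in_carrier[OF K.tot_diff_hom hom_in_carrier[OF pullback_hom[OF f] u]] by auto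
  fix p and c :: "('a \<times> 'b list) chain"
  assume p: "p \<le> Suc n" and c: "Poly_Mapping.keys c \<subseteq> nerve_simplices K p (Suc n - p)"
  have fc: "Poly_Mapping.keys (chain_map (Suc n - p) f c) \<subseteq> nerve_simplices L p (Suc n - p)"
    using keys_chain_map[OF f c] .
  have b: "u p (chain_boundary (Suc n - p) (chain_map (Suc n - p) f c)) =
      pullback K n f u p (chain_boundary (Suc n - p) c)" if "p \<le> n"
    using that c keys_chain_boundary[of c K p "n - p"]
    by (simp add: pullback_def Suc_diff_le chain_boundary_Suc_chain_map)
  have a: "u (p - 1) (alt_push (Suc n - p) p (nerve_face L p) (chain_map (Suc n - p) f c)) =
      pullback K n f u (p - 1) (alt_push (Suc n - p) p (nerve_face K p) c)" if p1: "1 \<le> p"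
  proof -
    obtain r where r: "p = Suc r"
      using p1 by (cases p) auto
    have "chain_map (Suc n - p) (nerve_face L p j) (chain_map (Suc n - p) f c) =
        chain_map (Suc n - p) f (chain_map (Suc n - p) (nerve_face K p j) c)" if "j \<le> p" for j
      unfolding chain_map_comp using face[of j r] that c by (intro chain_map_cong[of c K p]) (auto simp: r)
    then have "alt_push (Suc n - p) p (nerve_face L p) (chain_map (Suc n - p) f c) =
        chain_map (Suc n - p) f (alt_push (Suc n - p) p (nerve_face K p) c)"
      by (simp add: alt_push_def chain_map_sum)
    then show ?thesis
      using K.keys_alt_push_face[OF p1 c] p r by (simp add: pullback_def)
  qed
  show "pullback K (Suc n) f (cdiff (tot_complex L) n u) p c = cdiff (tot_complex K) n (pullback K n f u) p c"
    using p c tot_diff[OF p c] tot_diff[OF p fc] a b by (simp add: pullback_def del: power_Suc)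
qed

section \<open>The simplicial homotopy given by inserting a loop\<close>

text \<open>The sign bookkeeping of a prism operator, with \<open>a i j\<close> in the role of the
  j-th face of the i-th prism. Terms off the two diagonals \<open>j = i\<close> and
  \<open>j = Suc i\<close> match those of \<open>b\<close> with opposite sign; the diagonals
  telescope down to the two ends, which cancel.\<close>

lemma prism_sum:
  fixes a b :: "nat \<Rightarrow> nat \<Rightarrow> int"
  assumes lt: "\<And>i j. j < i \<Longrightarrow> i \<le> l \<Longrightarrow> a i j = b (i - 1) j"
    and gt: "\<And>i j. Suc i < j \<Longrightarrow> j \<le> Suc l \<Longrightarrow> a i j = b i (j - 1)"
    and mid: "\<And>i. i < l \<Longrightarrow> a i (Suc i) = a (Suc i) (Suc i)"
    and ends: "a 0 0 = a l (Suc l)"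
  shows "(\<Sum>i\<le>l. \<Sum>j\<le>Suc l. (-1) ^ (i + j) * a i j) = - (\<Sum>i<l. \<Sum>j\<le>l. (-1) ^ (i + j) * b i j)"
proof -
  define A where "A i j = (-1) ^ (i + j) * a i j" for i j
  define B where "B i j = (-1) ^ (i + j) * b i j" for i j
  have "(\<Sum>j\<le>Suc l. A i j) = (\<Sum>j<i. A i j) + (A i i + A i (Suc i)) + (\<Sum>j=Suc i..l. A i (Suc j))"
    if "i \<le> l" for i
  proof -
    \<comment> \<open>The columns \<open>i\<close> and \<open>Suc i\<close> form the diagonals; the
      others lie below or above them.\<close>
    have "{..Suc l} = {..<i} \<union> ({i, Suc i} \<union> Suc ` {Suc i..l})"
      using that by (auto simp: image_Suc_atLeastAtMost)
    then have "(\<Sum>j\<le>Suc l. A i j) = (\<Sum>j\<in>{..<i} \<union> ({i, Suc i} \<union> Suc ` {Suc i..l}). A i j)"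
      by simp
    also have "\<dots> = (\<Sum>j<i. A i j) + (\<Sum>j\<in>{i, Suc i} \<union> Suc ` {Suc i..l}. A i j)"
      by (rule sum.union_disjoint) auto
    also have "(\<Sum>j\<in>{i, Suc i} \<union> Suc ` {Suc i..l}. A i j) = (\<Sum>j\<in>{i, Suc i}. A i j) + (\<Sum>j\<in>Suc ` {Suc i..l}. A i j)"
      by (rule sum.union_disjoint) auto
    also have "(\<Sum>j\<in>Suc ` {Suc i..l}. A i j) = (\<Sum>j=Suc i..l. A i (Suc j))"
      by (subst sum.reindex) (simp_all add: o_def)
    also have "(\<Sum>j\<in>{i, Suc i}. A i j) = A i i + A i (Suc i)"
      by simp
    finally show ?thesis
      by (simp only: add.assoc)
  qed
  then have "(\<Sum>i\<le>l. \<Sum>j\<le>Suc l. A i j) =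
      (\<Sum>i\<le>l. \<Sum>j<i. A i j) + (\<Sum>i\<le>l. A i i + A i (Suc i)) + (\<Sum>i\<le>l. \<Sum>j=Suc i..l. A i (Suc j))"
    by (simp add: sum.distrib)
  \<comment> \<open>Below the diagonals the row index is shifted by one (row 0 is empty). This shift
    produces the minus sign in the comparison with \<open>B\<close>.\<close>
  also have "(\<Sum>i\<le>l. \<Sum>j<i. A i j) = (\<Sum>i<l. \<Sum>j\<le>i. A (Suc i) j)"
    by (simp add: sum.atMost_shift lessThan_Suc_atMost)
  also have "\<dots> = - (\<Sum>i<l. \<Sum>j\<le>i. B i j)"
    by (simp add: A_def B_def lt sum_negf)
  also have "(\<Sum>i\<le>l. A i i + A i (Suc i)) = (\<Sum>i\<le>l. a i i) - (\<Sum>i\<le>l. a i (Suc i))"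
    by (simp add: A_def sum_subtractf)
  \<comment> \<open>After splitting off \<open>a 0 0\<close>, the rule \<open>mid\<close> replaces
    each \<open>a (Suc i) (Suc i)\<close> by \<open>a i (Suc i)\<close>, and \<open>ends\<close>
    supplies the missing term \<open>a l (Suc l)\<close>.\<close>
  also have "(\<Sum>i\<le>l. a i i) = (\<Sum>i\<le>l. a i (Suc i))"
    using ends mid by (subst sum.atMost_shift) (simp add: lessThan_Suc_atMost[symmetric])
  \<comment> \<open>The row \<open>i = l\<close> has an empty range.\<close>
  also have "(\<Sum>i\<le>l. \<Sum>j=Suc i..l. A i (Suc j)) = (\<Sum>i<l. \<Sum>j=Suc i..l. A i (Suc j))"
    by (simp add: lessThan_Suc_atMost[symmetric])
  also have "\<dots> = - (\<Sum>i<l. \<Sum>j=Suc i..l. B i j)"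
    by (simp add: A_def B_def gt sum_negf)
  finally have "(\<Sum>i\<le>l. \<Sum>j\<le>Suc l. A i j) = - (\<Sum>i<l. (\<Sum>j\<le>i. B i j) + (\<Sum>j=Suc i..l. B i j))"
    by (simp add: sum.distrib)
  also have "(\<Sum>i<l. (\<Sum>j\<le>i. B i j) + (\<Sum>j=Suc i..l. B i j)) = (\<Sum>i<l. \<Sum>j\<le>l. B i j)"
  proof (rule sum.cong[OF refl])
    fix i assume "i \<in> {..<l}"
    then have "{..l} = {..i} \<union> {Suc i..l}"
      by auto
    then show "(\<Sum>j\<le>i. B i j) + (\<Sum>j=Suc i..l. B i j) = (\<Sum>j\<le>l. B i j)"
      by (simp add: sum.union_disjoint)
  qed
  finally show ?thesis
    by (simp add: A_def B_def)
qed

section \<open>The product of a groupoid with the integers\<close>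

lemma groupoid_int_grpd: "groupoid int_grpd"
  by (simp add: groupoid_def int_grpd_def composable_def)

lemma groupoid_prod_grpd:
  assumes "groupoid H" "groupoid K"
  shows "groupoid (prod_grpd H K)"
  using assms unfolding groupoid_def prod_grpd_def composable_def
  by (clarsimp simp: Pi_iff)

text \<open>Components in the integers and in the one-point space are locally constant, so every
  operation on them preserves plots; the other components are handled by \<open>K\<close>.\<close>

lemma plot_groupoid_int_prod:
  assumes "plot_groupoid K"
  shows "plot_groupoid (prod_grpd int_grpd K)"
proof -
  interpret plot_groupoid K by fact
  have unit: "plot q (discrete_mfd UNIV) (\<lambda>y. h (s y))" if "plot q (discrete_mfd UNIV) s" for q s h
    using plot_discrete_op[OF that that, of "\<lambda>x _. h x"] .
  show ?thesis
  proof
    show "groupoid (prod_grpd int_grpd K)"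
      by (rule groupoid_prod_grpd[OF groupoid_int_grpd groupoid])
  next
    fix q and s :: "_ \<Rightarrow> int \<times> 'b"
    assume "plot q (arr_mfd (prod_grpd int_grpd K)) s"
      "\<And>y. y \<in> standard_simplex q \<Longrightarrow> s y \<in> arrs (prod_grpd int_grpd K)"
    then show "plot q (obj_mfd (prod_grpd int_grpd K)) (\<lambda>y. gsrc (prod_grpd int_grpd K) (s y))"
      using plot_src[of q "snd \<circ> s"] unit[of q "fst \<circ> s" "\<lambda>_. ()"]
      by (auto simp: prod_grpd_def int_grpd_def plot_prod_iff o_def mem_Times_iff)
  next
    fix q and s :: "_ \<Rightarrow> unit \<times> 'a"
    assume "plot q (obj_mfd (prod_grpd int_grpd K)) s"
      "\<And>y. y \<in> standard_simplex q \<Longrightarrow> s y \<in> objs (prod_grpd int_grpd K)"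
    then show "plot q (arr_mfd (prod_grpd int_grpd K)) (\<lambda>y. gid (prod_grpd int_grpd K) (s y))"
      using plot_id[of q "snd \<circ> s"] unit[of q "fst \<circ> s" "\<lambda>_. 0"]
      by (auto simp: prod_grpd_def int_grpd_def plot_prod_iff o_def mem_Times_iff)
  next
    fix q and s t :: "_ \<Rightarrow> int \<times> 'b"
    assume "plot q (arr_mfd (prod_grpd int_grpd K)) s" "plot q (arr_mfd (prod_grpd int_grpd K)) t"
      "\<And>y. y \<in> standard_simplex q \<Longrightarrow> (s y, t y) \<in> composable (prod_grpd int_grpd K)"
    then show "plot q (arr_mfd (prod_grpd int_grpd K)) (\<lambda>y. gmul (prod_grpd int_grpd K) (s y) (t y))"
      using plot_mul[of q "snd \<circ> s" "snd \<circ> t"] plot_discrete_op[of q "fst \<circ> s" "fst \<circ> t" "(+)"]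
      by (auto simp: prod_grpd_def int_grpd_def plot_prod_iff o_def mem_Times_iff composable_def
          map_prod_def case_prod_beta)
  qed
qed

text \<open>The shuffle of the edge 1 of the integers with a string of \<open>K\<close>. All arrows
  of the string get the label 0, and the inserted arrow is a loop at the i-th object because
  \<open>int_grpd\<close> has a single object.\<close>

definition insert_loop ::
  "('o, 'a) grpd \<Rightarrow> nat \<Rightarrow> 'o \<times> 'a list \<Rightarrow> (unit \<times> 'o) \<times> (int \<times> 'a) list" where
  "insert_loop K i z = (((), fst z),
     map (Pair 0) (take i (snd z)) @ (1, gid K (nerve_vertex K z i)) # map (Pair 0) (drop i (snd z)))"

text \<open>Degeneracies are applied in increasing order: those below \<open>i\<close> push
  \<open>m\<close> to the right until it occupies position \<open>i\<close>, and those above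
  \<open>i\<close> append zeros behind it. Each phase is an induction on the number of
  zeros.\<close>

lemma nerve_degens_int_singleton:
  assumes "i \<le> l"
  shows "nerve_degens int_grpd ({..<Suc l} - {i}) ((), [m]) = ((), replicate i 0 @ m # replicate (l - i) 0)"
proof -
  have "sorted_list_of_set (set ([0..<i] @ [Suc i..<Suc l])) = [0..<i] @ [Suc i..<Suc l]"
    by (rule sorted_list_of_set.idem_if_sorted_distinct) (auto simp: sorted_append)
  moreover have "set ([0..<i] @ [Suc i..<Suc l]) = {..<Suc l} - {i}"
    using assms by auto
  ultimately have *: "sorted_list_of_set ({..<Suc l} - {i}) = [0..<i] @ [Suc i..<Suc i + (l - i)]"
    using assms by simp
  have 1: "fold (nerve_degen int_grpd) [0..<i] ((), [m]) = ((), replicate i 0 @ [m])"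
    by (induction i) (auto simp: nerve_degen_def int_grpd_def replicate_append_same)
  have 2: "fold (nerve_degen int_grpd) [Suc i..<Suc i + k] ((), replicate i 0 @ [m]) =
      ((), replicate i 0 @ m # replicate k 0)" for k
    by (induction k) (auto simp: nerve_degen_def int_grpd_def replicate_append_same)
  show ?thesis
    unfolding nerve_degens_def * using 1 2 by simp
qed

lemma shuffle_map_singleton:
  assumes "length (snd y) = l" "i \<le> l"
  shows "shuffle_map int_grpd K (Suc l) {i} (((), [1]), y) = insert_loop K i y"
  using assms nerve_degens_int_singleton[OF assms(2), of 1]
  by (auto simp: shuffle_map_def nerve_degens_def[of K] nerve_degen_def[of K] nerve_zip_def
      insert_loop_def case_prod_beta zip_append zip_replicate1 min_def)

lemma length_insert_loop: "i \<le> length (snd z) \<Longrightarrow> length (snd (insert_loop K i z)) = Suc (length (snd z))"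
  by (simp add: insert_loop_def)

lemma fst_insert_loop: "fst (insert_loop K i z) = ((), fst z)"
  by (simp add: insert_loop_def)

lemma nth_insert_loop:
  assumes "i \<le> length (snd z)" "m \<le> length (snd z)"
  shows "snd (insert_loop K i z) ! m = (if m < i then (0, snd z ! m)
     else if m = i then (1, gid K (nerve_vertex K z i)) else (0, snd z ! (m - 1)))"
  using assms by (auto simp: insert_loop_def nth_append nth_Cons' min_def)

lemma nerve_eqI:
  assumes "fst z = fst z'" "length (snd z) = p" "length (snd z') = p"
    and "\<And>m. m < p \<Longrightarrow> snd z ! m = snd z' ! m"
  shows "z = z'"
  using assms by (intro prod_eqI nth_equalityI) auto

context plot_groupoid
begin

abbreviation "ZK \<equiv> prod_grpd int_grpd K"

lemma ZK_simps:
  "gsrc ZK a = ((), gsrc K (snd a))" "gtgt ZK a = ((), gtgt K (snd a))"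
  "gmul ZK a b = (fst a + fst b, gmul K (snd a) (snd b))"
  "x \<in> objs ZK \<longleftrightarrow> snd x \<in> objs K" "a \<in> arrs ZK \<longleftrightarrow> snd a \<in> arrs K"
  by (auto simp: prod_grpd_def int_grpd_def map_prod_def case_prod_beta mem_Times_iff)

lemma plot_groupoid_ZK: "plot_groupoid ZK"
  by (rule plot_groupoid_int_prod) (rule plot_groupoid_axioms)

lemmas ZK_nerve_iff = plot_groupoid.nerve_iff[OF plot_groupoid_ZK]

text \<open>The loop repeats the i-th object, so the later objects are shifted by one.\<close>

lemma nerve_vertex_insert_loop:
  assumes z: "z \<in> nerve K l" and i: "i \<le> l" and m: "m \<le> Suc l"
  shows "nerve_vertex ZK (insert_loop K i z) m = ((), nerve_vertex K z (if m \<le> i then m else m - 1))"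
proof (cases m)
  case (Suc k)
  have "nerve_vertex K z i \<in> objs K"
    using nerve_vertex_in_objs[OF z i] .
  then have "gsrc K (gid K (nerve_vertex K z i)) = nerve_vertex K z i"
    by (rule src_id)
  moreover have "nerve_vertex K z k = gsrc K (snd z ! (k - 1))" if "i < k"
    using that by (cases k) auto
  ultimately show ?thesis
    using z i m Suc by (auto simp: nerve_iff ZK_simps nth_insert_loop)
qed (simp add: fst_insert_loop)

lemma insert_loop_in_nerve:
  assumes z: "z \<in> nerve K l" and i: "i \<le> l"
  shows "insert_loop K i z \<in> nerve ZK (Suc l)"
  unfolding ZK_nerve_iff
proof (intro conjI allI impI)
  show "length (snd (insert_loop K i z)) = Suc l" "fst (insert_loop K i z) \<in> objs ZK"
    using z i by (auto simp: nerve_iff length_insert_loop fst_insert_loop ZK_simps)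
  have v: "nerve_vertex K z i \<in> objs K"
    using nerve_vertex_in_objs[OF z i] .
  fix m assume m: "m < Suc l"
  show "snd (insert_loop K i z) ! m \<in> arrs ZK"
    using z i m id_closed[OF v] by (auto simp: nerve_iff nth_insert_loop ZK_simps)
  show "gtgt ZK (snd (insert_loop K i z) ! m) = nerve_vertex ZK (insert_loop K i z) m"
    using z i m tgt_id[OF v] nerve_vertex_insert_loop[OF z i, of m]
    by (auto simp: nerve_iff nth_insert_loop ZK_simps)
qed

lemma nerve_plot_map_insert_loop:
  assumes i: "i \<le> l"
  shows "nerve_plot_map K l ZK (Suc l) (insert_loop K i)"
  unfolding nerve_plot_map_def
proof (intro allI impI)
  fix q s assume s: "nerve_plot K l q s"
  have n: "s y \<in> nerve K l" if "y \<in> standard_simplex q" for y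
    using s that by (auto simp: nerve_plot_def)
  have a: "plot q (arr_mfd K) (\<lambda>y. snd (s y) ! m)" if "m < l" for m
    using s that by (auto simp: nerve_plot_def)
  have const: "plot q (discrete_mfd UNIV) (\<lambda>_. z)" for z
    by (rule plot_const[of 0 "{z}" "\<lambda>_ _. 0"]) (auto simp: discrete_mfd_def)
  have v: "plot q (obj_mfd K) (\<lambda>y. nerve_vertex K (s y) i)"
    using s n plot_src[OF a[of "i - 1"]] i by (cases i) (auto simp: nerve_plot_def nerve_iff)
  have e: "plot q (arr_mfd K) (\<lambda>y. gid K (nerve_vertex K (s y) i))"
    using plot_id[OF v] nerve_vertex_in_objs n i by blast
  show "nerve_plot ZK (Suc l) q (\<lambda>y. insert_loop K i (s y))"
    unfolding nerve_plot_def
  proof (intro conjI ballI allI impI)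
    show "insert_loop K i (s y) \<in> nerve ZK (Suc l)" if "y \<in> standard_simplex q" for y
      using insert_loop_in_nerve[OF n[OF that] i] .
    show "plot q (obj_mfd ZK) (\<lambda>y. fst (insert_loop K i (s y)))"
      using s const by (auto simp: fst_insert_loop prod_grpd_def int_grpd_def plot_prod_iff o_def nerve_plot_def)
    fix m assume m: "m < Suc l"
    have "plot q (arr_mfd K) (\<lambda>y. snd (if m < i then (0::int, snd (s y) ! m)
       else if m = i then (1, gid K (nerve_vertex K (s y) i)) else (0, snd (s y) ! (m - 1))))"
      using a[of m] a[of "m - 1"] e m i by (cases m i rule: linorder_cases) auto
    moreover have "plot q (discrete_mfd UNIV) (\<lambda>y. fst (if m < i then (0::int, snd (s y) ! m)
       else if m = i then (1, gid K (nerve_vertex K (s y) i)) else (0, snd (s y) ! (m - 1))))"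
      using const by (cases m i rule: linorder_cases) auto
    ultimately have "plot q (arr_mfd ZK) (\<lambda>y. if m < i then (0, snd (s y) ! m)
       else if m = i then (1, gid K (nerve_vertex K (s y) i)) else (0, snd (s y) ! (m - 1)))"
      by (simp add: prod_grpd_def int_grpd_def plot_prod_iff o_def)
    then show "plot q (arr_mfd ZK) (\<lambda>y. snd (insert_loop K i (s y)) ! m)"
      by (rule plot_cong[rotated]) (use n m i in \<open>auto simp: nth_insert_loop nerve_iff\<close>)
  qed
qed

text \<open>The identities of a simplicial homotopy. Faces away from the loop act on the string
  before or behind it. The face \<open>Suc i\<close> merges the loop with the arrow behind it or, if
  inserted one place later, with the arrow before it; either product with a unit is that arrow, with
  label 1. In the last identity both faces drop the loop and leave the string with labels 0.\<close>

lemma nerve_face_insert_loop: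
  assumes z: "z \<in> nerve K l" and i: "i \<le> l"
  shows "j < i \<Longrightarrow> nerve_face ZK (Suc l) j (insert_loop K i z) = insert_loop K (i - 1) (nerve_face K l j z)"
    and "Suc i < j \<Longrightarrow> j \<le> Suc l \<Longrightarrow>
      nerve_face ZK (Suc l) j (insert_loop K i z) = insert_loop K i (nerve_face K l (j - 1) z)"
    and "i < l \<Longrightarrow> nerve_face ZK (Suc l) (Suc i) (insert_loop K i z) =
      nerve_face ZK (Suc l) (Suc i) (insert_loop K (Suc i) z)"
    and "nerve_face ZK (Suc l) 0 (insert_loop K 0 z) = nerve_face ZK (Suc l) (Suc l) (insert_loop K l z)"
proof -
  have l: "length (snd z) = l"
    using z by (simp add: nerve_iff)
  note simps = fst_nerve_face length_nerve_face nth_nerve_face fst_insert_loop length_insert_loop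
    nth_insert_loop ZK_simps l
  show "nerve_face ZK (Suc l) j (insert_loop K i z) = insert_loop K (i - 1) (nerve_face K l j z)"
    if j: "j < i"
  proof (rule nerve_eqI[where p = l])
    obtain l' where l': "l = Suc l'"
      using i j by (cases l) auto
    have v: "nerve_vertex K (nerve_face K l j z) (i - 1) = nerve_vertex K z i"
      using nerve_vertex_face[OF plot_groupoid_axioms, of z l' j "i - 1"] z i j l' by auto
    show "fst (nerve_face ZK (Suc l) j (insert_loop K i z)) = fst (insert_loop K (i - 1) (nerve_face K l j z))"
      using i j l' by (simp add: simps)
    show "length (snd (nerve_face ZK (Suc l) j (insert_loop K i z))) = l"
      "length (snd (insert_loop K (i - 1) (nerve_face K l j z))) = l"
      using i j l' by (simp_all add: simps)
    fix m assume "m < l"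
    then show "snd (nerve_face ZK (Suc l) j (insert_loop K i z)) ! m =
        snd (insert_loop K (i - 1) (nerve_face K l j z)) ! m"
      using i j l' v by (auto simp: simps)
  qed
  show "nerve_face ZK (Suc l) j (insert_loop K i z) = insert_loop K i (nerve_face K l (j - 1) z)"
    if j: "Suc i < j" "j \<le> Suc l"
  proof (rule nerve_eqI[where p = l])
    obtain l' where l': "l = Suc l'"
      using i j by (cases l) auto
    have v: "nerve_vertex K (nerve_face K l (j - 1) z) i = nerve_vertex K z i"
      using nerve_vertex_face[OF plot_groupoid_axioms, of z l' "j - 1" i] z i j l' by auto
    show "fst (nerve_face ZK (Suc l) j (insert_loop K i z)) = fst (insert_loop K i (nerve_face K l (j - 1) z))"
      using i j l' by (simp add: simps)
    show "length (snd (nerve_face ZK (Suc l) j (insert_loop K i z))) = l"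
      "length (snd (insert_loop K i (nerve_face K l (j - 1) z))) = l"
      using i j l' by (simp_all add: simps)
    fix m assume "m < l"
    then show "snd (nerve_face ZK (Suc l) j (insert_loop K i z)) ! m =
        snd (insert_loop K i (nerve_face K l (j - 1) z)) ! m"
      using i j l' v Suc_diff_Suc[of "Suc 0" j] by (auto simp: simps)
  qed
  show "nerve_face ZK (Suc l) (Suc i) (insert_loop K i z) = nerve_face ZK (Suc l) (Suc i) (insert_loop K (Suc i) z)"
    if j: "i < l"
  proof (rule nerve_eqI[where p = l])
    have u: "gmul K (gid K (nerve_vertex K z i)) (snd z ! i) = snd z ! i"
      "gmul K (snd z ! i) (gid K (gsrc K (snd z ! i))) = snd z ! i"
      using z j id_mul[of "snd z ! i"] mul_id[of "snd z ! i"] by (auto simp: nerve_iff)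
    fix m assume "m < l"
    then show "snd (nerve_face ZK (Suc l) (Suc i) (insert_loop K i z)) ! m =
        snd (nerve_face ZK (Suc l) (Suc i) (insert_loop K (Suc i) z)) ! m"
      using j u by (auto simp: simps)
  qed (use j in \<open>simp_all add: simps\<close>)
  show "nerve_face ZK (Suc l) 0 (insert_loop K 0 z) = nerve_face ZK (Suc l) (Suc l) (insert_loop K l z)"
  proof (rule nerve_eqI[where p = l])
    have "gsrc K (gid K (fst z)) = fst z"
      using z by (simp add: nerve_iff src_id)
    then show "fst (nerve_face ZK (Suc l) 0 (insert_loop K 0 z)) =
        fst (nerve_face ZK (Suc l) (Suc l) (insert_loop K l z))"
      by (simp add: simps)
  qed (auto simp: simps)
qed

end

section \<open>Shuffles and the cap product\<close>

lemma nerve_plot_map_comp: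
  "nerve_plot_map K r L p g \<Longrightarrow> nerve_plot_map L p M m f \<Longrightarrow> nerve_plot_map K r M m (\<lambda>z. f (g z))"
  by (simp add: nerve_plot_map_def)

text \<open>The composite of \<open>shuffle_pullback\<close> and \<open>cap_xi\<close>, by
  \<open>cap_xi_shuffle_pullback\<close>. The minus sign is that of \<open>shuffle_chain\<close>:
  positions are counted from 0 here and from 1 in the sign convention for the shuffle map.\<close>

definition loop_transgression ::
  "('o, 'a) grpd \<Rightarrow> nat \<Rightarrow> (unit \<times> 'o, int \<times> 'a) tot_cochain \<Rightarrow> ('o, 'a) tot_cochain" where
  "loop_transgression K n u = (\<lambda>l\<in>{..n}. \<lambda>c\<in>nerve_chains K l (n - l).
     - (\<Sum>i\<le>l. (-1) ^ i * u (Suc l) (chain_map (n - l) (insert_loop K i) c)))"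

context plot_groupoid
begin

lemma keys_insert_loop:
  "i \<le> l \<Longrightarrow> Poly_Mapping.keys c \<subseteq> nerve_simplices K l q \<Longrightarrow>
     Poly_Mapping.keys (chain_map q (insert_loop K i) c) \<subseteq> nerve_simplices ZK (Suc l) q"
  by (rule keys_chain_map[OF nerve_plot_map_insert_loop])

lemma loop_transgression_hom:
  "loop_transgression K n \<in> hom (cgrp (tot_complex ZK) (Suc n)) (cgrp (tot_complex K) n)"
proof -
  have "(\<lambda>u. \<lambda>l\<in>{..n}. \<lambda>c\<in>nerve_chains K l (n - l).
      - (\<Sum>i\<le>l. (-1) ^ i * u (Suc l) (chain_map (n - l) (insert_loop K i) c)))
      \<in> hom (cgrp (tot_complex ZK) (Suc n)) (cgrp (tot_complex K) n)"
  proof (rule tot_homI)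
    fix u :: "(unit \<times> 'o, int \<times> 'a) tot_cochain" and l
    assume u: "u \<in> carrier (cgrp (tot_complex ZK) (Suc n))" and l: "l \<le> n"
    have *: "u (Suc l) \<in> carrier (cochain_group (nerve_simplices ZK (Suc l) (n - l)))"
      using u l unfolding tot_carrier_iff by (metis Suc_le_mono diff_Suc_Suc)
    show "(\<lambda>c\<in>nerve_chains K l (n - l).
       - (\<Sum>i\<le>l. (-1) ^ i * u (Suc l) (chain_map (n - l) (insert_loop K i) c)))
        \<in> carrier (cochain_group (nerve_simplices K l (n - l)))"
      by (rule cochain_groupI)
         (simp add: chain_map_add cochain_add[OF *] keys_insert_loop distrib_left sum.distrib)
  next
    fix u v :: "(unit \<times> 'o, int \<times> 'a) tot_cochain" and l and c :: "('o \<times> 'a list) chain"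
    assume "l \<le> n" and c: "Poly_Mapping.keys c \<subseteq> nerve_simplices K l (n - l)"
    then show "- (\<Sum>i\<le>l. (-1) ^ i * (u \<otimes>\<^bsub>cgrp (tot_complex ZK) (Suc n)\<^esub> v) (Suc l) (chain_map (n - l) (insert_loop K i) c)) =
      - (\<Sum>i\<le>l. (-1) ^ i * u (Suc l) (chain_map (n - l) (insert_loop K i) c)) +
      - (\<Sum>i\<le>l. (-1) ^ i * v (Suc l) (chain_map (n - l) (insert_loop K i) c))"
      using keys_insert_loop[OF _ c] by (simp add: tot_mult distrib_left sum.distrib)
  qed
  then show ?thesis
    by (simp add: loop_transgression_def[abs_def])
qed

text \<open>The prism operator identity: the maps \<open>insert_loop K i\<close> form a simplicial homotopy
  from the embedding \<open>K \<rightarrow> \<int> \<times> K\<close> to itself, whose two ends cancel.\<close>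

lemma prism_insert_loop:
  assumes u: "u \<in> carrier (cochain_group (nerve_simplices ZK l q))"
    and c: "Poly_Mapping.keys c \<subseteq> nerve_simplices K l q"
  shows "(\<Sum>i\<le>l. (-1) ^ i * u (alt_push q (Suc l) (nerve_face ZK (Suc l)) (chain_map q (insert_loop K i) c)))
    = - (\<Sum>i<l. (-1) ^ i * u (chain_map q (insert_loop K i) (alt_push q l (nerve_face K l) c)))"
proof -
  define a where "a i j = u (chain_map q (\<lambda>z. nerve_face ZK (Suc l) j (insert_loop K i z)) c)" for i j
  define b where "b i j = u (chain_map q (\<lambda>z. insert_loop K i (nerve_face K l j z)) c)" for i j
  have eq: "u (chain_map q f c) = u (chain_map q g c)" if "\<And>z. z \<in> nerve K l \<Longrightarrow> f z = g z" for f g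
    using chain_map_cong[OF c that] by simp
  have "(\<Sum>i\<le>l. \<Sum>j\<le>Suc l. (-1) ^ (i + j) * a i j) = - (\<Sum>i<l. \<Sum>j\<le>l. (-1) ^ (i + j) * b i j)"
    unfolding a_def b_def
    by (rule prism_sum; rule eq)
       (simp_all add: nerve_face_insert_loop(1-3) nerve_face_insert_loop(4)[OF _ le_refl])
  moreover have "u (alt_push q (Suc l) (nerve_face ZK (Suc l)) (chain_map q (insert_loop K i) c)) =
      (\<Sum>j\<le>Suc l. (-1) ^ j * a i j)" if "i \<le> l" for i
    using cochain_alt_push[OF u, of "Suc l" ZK "Suc l" "nerve_face ZK (Suc l)"]
      plot_groupoid.nerve_plot_map_face[OF plot_groupoid_ZK] keys_insert_loop[OF that c]
    by (simp add: a_def chain_map_comp del: sum.atMost_Suc)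
  moreover have "u (chain_map q (insert_loop K i) (alt_push q l (nerve_face K l) c)) =
      (\<Sum>j\<le>l. (-1) ^ j * b i j)" if "i < l" for i
  proof -
    obtain l' where l': "l = Suc l'" and i: "i \<le> l'"
      using \<open>i < l\<close> by (cases l) auto
    have "chain_map q (insert_loop K i) (alt_push q l (nerve_face K l) c) =
        alt_push q l (\<lambda>j z. insert_loop K i (nerve_face K l j z)) c"
      by (simp add: alt_push_def chain_map_sum chain_map_comp)
    then show ?thesis
      unfolding b_def using cochain_alt_push[OF u, of l K l] c l'
        nerve_plot_map_comp[OF nerve_plot_map_face nerve_plot_map_insert_loop[OF i]] by simp
  qed
  ultimately show ?thesis
    by (simp add: power_add sum_distrib_left mult.assoc del: sum.atMost_Suc)
qed

text \<open>Component \<open>l\<close> of the result is read off component \<open>Suc l\<close> of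
  \<open>u\<close>, so the sign at the singular boundary changes from (-1)^(l+1) to (-1)^l; the face
  terms change sign by \<open>prism_insert_loop\<close>.\<close>

lemma loop_transgression_diff:
  assumes u: "u \<in> carrier (cgrp (tot_complex ZK) (Suc n))"
  shows "loop_transgression K (Suc n) (cdiff (tot_complex ZK) (Suc n) u) =
    inv\<^bsub>cgrp (tot_complex K) (Suc n)\<^esub> (cdiff (tot_complex K) n (loop_transgression K n u))"
proof (rule tot_eqI)
  let ?T = "loop_transgression K n u"
  have DT: "cdiff (tot_complex K) n ?T \<in> carrier (cgrp (tot_complex K) (Suc n))"
    by (rule hom_in_carrier[OF tot_diff_hom hom_in_carrier[OF loop_transgression_hom u]])
  then show "inv\<^bsub>cgrp (tot_complex K) (Suc n)\<^esub> (cdiff (tot_complex K) n ?T) \<in> carrier (cgrp (tot_complex K) (Suc n))"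
    by (intro group.inv_closed comm_group.axioms(2) comm_group_tot_complex)
  show "loop_transgression K (Suc n) (cdiff (tot_complex ZK) (Suc n) u) \<in> carrier (cgrp (tot_complex K) (Suc n))"
    by (rule hom_in_carrier[OF loop_transgression_hom
        hom_in_carrier[OF plot_groupoid.tot_diff_hom[OF plot_groupoid_ZK] u]])
  fix l and c :: "('o \<times> 'a list) chain"
  assume l: "l \<le> Suc n" and c: "Poly_Mapping.keys c \<subseteq> nerve_simplices K l (Suc n - l)"
  define q where "q = Suc n - l"
  note c = c[folded q_def]
  have ul: "u l \<in> carrier (cochain_group (nerve_simplices ZK l q))"
    using u l unfolding tot_carrier_iff q_def by blast
  have "cdiff (tot_complex ZK) (Suc n) u (Suc l) (chain_map q (insert_loop K i) c) =
      (if l \<le> n then (-1) ^ Suc l * u (Suc l) (chain_map (n - l) (insert_loop K i) (chain_boundary q c)) else 0) +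
      u l (alt_push q (Suc l) (nerve_face ZK (Suc l)) (chain_map q (insert_loop K i) c))" if i: "i \<le> l" for i
    using tot_diff[of "Suc l" "Suc n" "chain_map q (insert_loop K i) c" ZK u] keys_insert_loop[OF i c] l
      chain_boundary_Suc_chain_map[of "n - l" "insert_loop K i" c]
    by (auto simp: q_def Suc_diff_le)
  then have "loop_transgression K (Suc n) (cdiff (tot_complex ZK) (Suc n) u) l c =
      (if l \<le> n then (-1) ^ l * (\<Sum>i\<le>l. (-1) ^ i * u (Suc l) (chain_map (n - l) (insert_loop K i) (chain_boundary q c))) else 0) -
      (\<Sum>i\<le>l. (-1) ^ i * u l (alt_push q (Suc l) (nerve_face ZK (Suc l)) (chain_map q (insert_loop K i) c)))"
    using l c by (auto simp: loop_transgression_def q_def distrib_left sum.distrib sum_distrib_left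
        sum_negf mult.left_commute simp del: power_Suc2)
  also have "\<dots> = - ((if l \<le> n then (-1) ^ l * ?T l (chain_boundary q c) else 0) +
      (if 1 \<le> l then ?T (l - 1) (alt_push q l (nerve_face K l) c) else 0))"
  proof -
    have "?T l (chain_boundary q c) =
        - (\<Sum>i\<le>l. (-1) ^ i * u (Suc l) (chain_map (n - l) (insert_loop K i) (chain_boundary q c)))" if "l \<le> n"
      using keys_chain_boundary[of c K l "n - l"] c that
      by (simp add: loop_transgression_def q_def Suc_diff_le)
    \<comment> \<open>For \<open>l = 0\<close> the sum over \<open>i < l\<close> is empty, in
      agreement with the absent face term.\<close>
    moreover have "(if 1 \<le> l then ?T (l - 1) (alt_push q l (nerve_face K l) c) else 0) =
        - (\<Sum>i<l. (-1) ^ i * u l (chain_map q (insert_loop K i) (alt_push q l (nerve_face K l) c)))"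
    proof (cases l)
      case (Suc l')
      then show ?thesis
        using keys_alt_push_face[of l c q] c l
        by (simp add: loop_transgression_def q_def lessThan_Suc_atMost)
    qed simp
    ultimately show ?thesis
      by (simp add: prism_insert_loop[OF ul c])
  qed
  also have "\<dots> = - cdiff (tot_complex K) n ?T l c"
    using tot_diff[OF l c[unfolded q_def], of ?T] by (simp add: q_def)
  finally show "loop_transgression K (Suc n) (cdiff (tot_complex ZK) (Suc n) u) l c =
      (inv\<^bsub>cgrp (tot_complex K) (Suc n)\<^esub> (cdiff (tot_complex K) n ?T)) l c"
    using l c by (simp add: tot_inv[OF DT] q_def)
qed

text \<open>In degree 0 the only coboundary is the unit, so the image must vanish outright. It does,
  since the prism identity with \<open>l = 0\<close> has an empty right-hand side.\<close>

lemma loop_transgression_diff_0: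
  assumes u: "u \<in> carrier (cgrp (tot_complex ZK) 0)"
  shows "loop_transgression K 0 (cdiff (tot_complex ZK) 0 u) = \<one>\<^bsub>cgrp (tot_complex K) 0\<^esub>"
proof (rule tot_eqI)
  show "loop_transgression K 0 (cdiff (tot_complex ZK) 0 u) \<in> carrier (cgrp (tot_complex K) 0)"
    by (rule hom_in_carrier[OF loop_transgression_hom
        hom_in_carrier[OF plot_groupoid.tot_diff_hom[OF plot_groupoid_ZK] u]])
  show "\<one>\<^bsub>cgrp (tot_complex K) 0\<^esub> \<in> carrier (cgrp (tot_complex K) 0)"
    by (intro group.is_monoid[THEN monoid.one_closed] comm_group.axioms(2) comm_group_tot_complex)
  fix l and c :: "('o \<times> 'a list) chain"
  assume l: "l \<le> 0" and c: "Poly_Mapping.keys c \<subseteq> nerve_simplices K l (0 - l)"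
  have "u 0 \<in> carrier (cochain_group (nerve_simplices ZK 0 0))"
    using u by (simp add: tot_carrier_iff)
  from prism_insert_loop[OF this, of c] c l
  have "u 0 (alt_push 0 1 (nerve_face ZK 1) (chain_map 0 (insert_loop K 0) c)) = 0"
    by simp
  then show "loop_transgression K 0 (cdiff (tot_complex ZK) 0 u) l c = \<one>\<^bsub>cgrp (tot_complex K) 0\<^esub> l c"
    using c l tot_diff[of 1 0 "chain_map 0 (insert_loop K 0) c" ZK u] keys_insert_loop[of 0 0 c 0]
    by (simp add: loop_transgression_def tot_one)
qed

end

lemma shuffle_sign_singleton: "i < p \<Longrightarrow> shuffle_sign p {i} = (-1) ^ i"
proof -
  assume "i < p"
  then have "{(a, b). a \<in> {i} \<and> b \<in> {..<p} - {i} \<and> b < a} = Pair i ` {..<i}"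
    by auto
  then show ?thesis
    by (simp add: shuffle_sign_def card_image inj_on_def)
qed

text \<open>\<open>cap_xi\<close> reads the components \<open>(1, l)\<close>, where a shuffle is a
  one-element set of positions \<open>{i}\<close> with \<open>i \<le> l\<close>. Its sign is (-1)^i,
  since \<open>i\<close> positions precede it, and on the point 1 it acts as
  \<open>insert_loop\<close>.\<close>

lemma (in plot_groupoid) cap_xi_shuffle_pullback:
  assumes u: "u \<in> carrier (cgrp (tot_complex ZK) (Suc n))"
  shows "cap_xi K n (shuffle_pullback int_grpd K (Suc n) u) = loop_transgression K n u"
proof -
  have "shuffle_pullback int_grpd K (Suc n) u (1, l) (chain_map (n - l) (\<lambda>y. (((), [1]), y)) c) =
     - (\<Sum>i\<le>l. (-1) ^ i * u (Suc l) (chain_map (n - l) (insert_loop K i) c))"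
    if l: "l \<le> n" and c: "c \<in> nerve_chains K l (n - l)" for l c
  proof -
    have k: "Poly_Mapping.keys c \<subseteq> nerve_simplices K l (n - l)"
      using c by simp
    have ul: "u (Suc l) \<in> carrier (cochain_group (nerve_simplices ZK (Suc l) (n - l)))"
      using u l unfolding tot_carrier_iff by (metis Suc_le_mono diff_Suc_Suc)
    have I: "{I. I \<subseteq> {..<1 + l} \<and> card I = 1} = (\<lambda>i. {i}) ` {..l}"
      by (auto simp: card_1_singleton_iff)
    have "chain_map (n - l) (shuffle_map int_grpd K (Suc l) {i}) (chain_map (n - l) (\<lambda>y. (((), [1]), y)) c) =
        chain_map (n - l) (insert_loop K i) c" if "i \<le> l" for i
      unfolding chain_map_comp
      by (rule chain_map_cong[OF k]) (use that in \<open>auto simp: nerve_iff shuffle_map_singleton\<close>)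
    then have "shuffle_chain int_grpd K (n - l) 1 l (chain_map (n - l) (\<lambda>y. (((), [1]), y)) c) =
        - (\<Sum>i\<le>l. frag_cmul ((-1) ^ i) (chain_map (n - l) (insert_loop K i) c))"
      unfolding shuffle_chain_def I by (simp add: sum.reindex inj_on_def shuffle_sign_singleton)
    moreover have "u (Suc l) \<dots> = - (\<Sum>i\<le>l. (-1) ^ i * u (Suc l) (chain_map (n - l) (insert_loop K i) c))"
    proof -
      have k': "Poly_Mapping.keys (frag_cmul ((-1) ^ i) (chain_map (n - l) (insert_loop K i) c))
          \<subseteq> nerve_simplices ZK (Suc l) (n - l)" if "i \<in> {..l}" for i
        using keys_insert_loop[OF _ k] that by (intro keys_frag_cmul_subset) auto
      have "u (Suc l) (frag_cmul ((-1) ^ i) (chain_map (n - l) (insert_loop K i) c)) =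
          (-1) ^ i * u (Suc l) (chain_map (n - l) (insert_loop K i) c)" if "i \<in> {..l}" for i
        using cochain_sign[OF ul keys_insert_loop[OF _ k]] that by simp
      moreover have "u (Suc l) (- (\<Sum>i\<le>l. frag_cmul ((-1) ^ i) (chain_map (n - l) (insert_loop K i) c))) =
          - u (Suc l) (\<Sum>i\<le>l. frag_cmul ((-1) ^ i) (chain_map (n - l) (insert_loop K i) c))"
        by (rule cochain_minus[OF ul keys_sum_subset]) (rule k')
      moreover have "u (Suc l) (\<Sum>i\<le>l. frag_cmul ((-1) ^ i) (chain_map (n - l) (insert_loop K i) c)) =
          (\<Sum>i\<le>l. u (Suc l) (frag_cmul ((-1) ^ i) (chain_map (n - l) (insert_loop K i) c)))"
        by (rule cochain_sum[OF ul]) (rule k')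
      ultimately show ?thesis
        by simp
    qed
    ultimately show ?thesis
      using l chain_map_binerve[OF c, of 1] by (simp add: shuffle_pullback_def)
  qed
  then show ?thesis
    by (auto simp: cap_xi_def loop_transgression_def fun_eq_iff)
qed

section \<open>The complex of a product of nerves, and the cap product\<close>

lemma bi_carrier_iff:
  "w \<in> carrier (cgrp (bi_complex H K) n) \<longleftrightarrow> w \<in> extensional {(k, l). k + l \<le> n} \<and>
     (\<forall>k l. k + l \<le> n \<longrightarrow> w (k, l) \<in> carrier (cochain_group (binerve_simplices H K k l (n - k - l))))"
  by (auto simp: bi_complex_def PiE_iff)

lemma group_bi_complex: "group (cgrp (bi_complex H K) n)"
proof -
  have "comm_group (cgrp (bi_complex H K) n)"
    unfolding bi_complex_def cochain_complex.simps
    by (rule comm_group_product_group) (auto intro: comm_group_cochain_group)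
  then show ?thesis
    by (rule comm_group.axioms(2))
qed

text \<open>Stated for arbitrary \<open>v\<close> and \<open>w\<close>, so that
  \<open>induced_induced\<close> can be applied to the values of
  \<open>shuffle_pullback\<close>.\<close>

lemma cap_xi_mult:
  "cap_xi K n (v \<otimes>\<^bsub>cgrp (bi_complex int_grpd K) (Suc n)\<^esub> w) =
     cap_xi K n v \<otimes>\<^bsub>cgrp (tot_complex K) n\<^esub> cap_xi K n w"
proof -
  have "(v \<otimes>\<^bsub>cgrp (bi_complex int_grpd K) (Suc n)\<^esub> w) (1, l) (chain_map (n - l) (\<lambda>y. (((), [1]), y)) c) =
     v (1, l) (chain_map (n - l) (\<lambda>y. (((), [1]), y)) c) + w (1, l) (chain_map (n - l) (\<lambda>y. (((), [1]), y)) c)"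
    if "l \<le> n" "c \<in> nerve_chains K l (n - l)" for l c
    using that chain_map_binerve[OF that(2), of 1] by (simp add: bi_complex_def cochain_group_def)
  then show ?thesis
    unfolding tot_mult by (auto simp: cap_xi_def fun_eq_iff)
qed

context plot_groupoid
begin

lemma tot_diff_inv:
  assumes "u \<in> carrier (cgrp (tot_complex K) n)"
  shows "cdiff (tot_complex K) n (inv\<^bsub>cgrp (tot_complex K) n\<^esub> u) =
    inv\<^bsub>cgrp (tot_complex K) (Suc n)\<^esub> (cdiff (tot_complex K) n u)"
proof -
  interpret A: comm_group "cgrp (tot_complex K) n"
    by (rule comm_group_tot_complex)
  interpret B: comm_group "cgrp (tot_complex K) (Suc n)"
    by (rule comm_group_tot_complex)
  interpret group_hom "cgrp (tot_complex K) n" "cgrp (tot_complex K) (Suc n)" "cdiff (tot_complex K) n"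
    by unfold_locales (rule tot_diff_hom)
  show ?thesis
    by (rule hom_inv[OF assms])
qed

lemma cap_xi_in_carrier:
  assumes w: "w \<in> carrier (cgrp (bi_complex int_grpd K) (Suc n))"
  shows "cap_xi K n w \<in> carrier (cgrp (tot_complex K) n)"
proof -
  have "(\<lambda>c\<in>nerve_chains K l (n - l). w (1, l) (chain_map (n - l) (\<lambda>y. (((), [1]), y)) c))
      \<in> carrier (cochain_group (nerve_simplices K l (n - l)))" if l: "l \<le> n" for l
  proof (rule cochain_pullback)
    show "w (1, l) \<in> carrier (cochain_group (binerve_simplices int_grpd K 1 l (n - l)))"
      using w l unfolding bi_carrier_iff by (metis Suc_le_mono diff_Suc_1 diff_Suc_Suc plus_1_eq_Suc diff_diff_left)
    show "Poly_Mapping.keys (chain_map (n - l) (\<lambda>y. (((), [1::int]), y)) c) \<subseteq> binerve_simplices int_grpd K 1 l (n - l)"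
      if "Poly_Mapping.keys c \<subseteq> nerve_simplices K l (n - l)" for c
      using chain_map_binerve[of c K l "n - l" 1] that by simp
  qed (rule chain_map_add)
  then show ?thesis
    by (auto simp: cap_xi_def tot_carrier_iff simp del: carrier_free_Abelian_group_iff)
qed

text \<open>The point 1 is a cycle: its two faces are the unique object of the integers and cancel.
  This is what makes capping with it compatible with the differentials.\<close>

lemma alt_push_const_loop:
  "alt_push q 1 (\<lambda>j. map_prod (nerve_face int_grpd 1 j) id) (chain_map q (\<lambda>y. (((), [m]), y)) c) = 0"
proof -
  have "map_prod (nerve_face int_grpd 1 j) id (((), [m]), y) = (((), []), y)" if "j \<le> 1" for j and y :: "'o \<times> 'a list"
    using that by (cases j) (auto simp: nerve_face_def int_grpd_def)
  then show ?thesis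
    by (simp add: alt_push_def chain_map_comp)
qed

text \<open>At \<open>(1, l)\<close> the singular boundary carries the sign (-1)^(1+l) and the faces
  of \<open>K\<close> the sign (-1)^1, while the faces of the integers contribute nothing by
  \<open>alt_push_const_loop\<close>. So capping anticommutes with the differentials.\<close>

lemma cap_xi_diff_apply:
  assumes w: "w \<in> carrier (cgrp (bi_complex int_grpd K) n)"
    and l: "l \<le> n" and c: "Poly_Mapping.keys c \<subseteq> nerve_simplices K l (n - l)"
  shows "cap_xi K n (cdiff (bi_complex int_grpd K) n w) l c =
    - ((if l < n then (-1) ^ l * w (1, l) (chain_map (n - l - 1) (\<lambda>y. (((), [1]), y)) (chain_boundary (n - l) c)) else 0) +
       (if 1 \<le> l then w (1, l - 1) (chain_map (n - l) (\<lambda>y. (((), [1]), y)) (alt_push (n - l) l (nerve_face K l) c)) else 0))"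
proof -
  let ?\<iota> = "\<lambda>y. (((), [1::int]), y)"
  have k: "Poly_Mapping.keys (chain_map (n - l) ?\<iota> c) \<subseteq> binerve_simplices int_grpd K 1 l (n - l)"
    using chain_map_binerve[of c K l "n - l" 1] c by simp
  have "w (0, l) \<in> carrier (cochain_group (binerve_simplices int_grpd K 0 l (n - 0 - l)))"
    using conjunct2[OF w[unfolded bi_carrier_iff], rule_format, of 0 l] l by simp
  then have w0: "w (0, l) 0 = 0"
    by (rule cochain_0)
  have f: "alt_push (n - l) l (\<lambda>j. map_prod id (nerve_face K l j)) (chain_map (n - l) ?\<iota> c) =
      chain_map (n - l) ?\<iota> (alt_push (n - l) l (nerve_face K l) c)"
    by (simp add: alt_push_def chain_map_sum chain_map_comp)
  have b: "chain_boundary (n - l) (chain_map (n - l) ?\<iota> c) = chain_map (n - l - 1) ?\<iota> (chain_boundary (n - l) c)"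
    if "l < n"
    using chain_boundary_Suc_chain_map[of "n - l - 1" ?\<iota> c] that by (simp add: Suc_diff_Suc)
  have "cap_xi K n (cdiff (bi_complex int_grpd K) n w) l c =
      (if 1 + l \<le> n then (-1) ^ (1 + l) * w (1, l) (chain_boundary (n - l) (chain_map (n - l) ?\<iota> c)) else 0) +
      w (0, l) (alt_push (n - l) 1 (\<lambda>j. map_prod (nerve_face int_grpd 1 j) id) (chain_map (n - l) ?\<iota> c)) +
      (if 1 \<le> l then - w (1, l - 1) (alt_push (n - l) l (\<lambda>j. map_prod id (nerve_face K l j)) (chain_map (n - l) ?\<iota> c)) else 0)"
    using l c k by (simp add: cap_xi_def bi_complex_def)
  then show ?thesis
    unfolding alt_push_const_loop w0 f using b by (auto simp: Suc_le_eq)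
qed

text \<open>By anticommutation the image of \<open>D w\<close> is the inverse of the differential of
  the capped \<open>w\<close>; the inverse is then moved inside by
  \<open>tot_diff_inv\<close>.\<close>

lemma cap_xi_coboundaries:
  "cap_xi K n ` coboundaries (bi_complex int_grpd K) (Suc n) \<subseteq> coboundaries (tot_complex K) n"
proof
  fix x assume "x \<in> cap_xi K n ` coboundaries (bi_complex int_grpd K) (Suc n)"
  then obtain w where w: "w \<in> carrier (cgrp (bi_complex int_grpd K) n)"
    and x: "x = cap_xi K n (cdiff (bi_complex int_grpd K) n w)"
    by (auto simp: coboundaries_def)
  have xl: "x l = (\<lambda>c\<in>nerve_chains K l (n - l). x l c)" if "l \<le> n" for l
    using that by (auto simp: x cap_xi_def)
  have x': "x = (\<lambda>l\<in>{..n}. \<lambda>c\<in>nerve_chains K l (n - l). x l c)"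
    by (auto simp: x cap_xi_def)
  show "x \<in> coboundaries (tot_complex K) n"
  proof (cases n)
    \<comment> \<open>Both terms of \<open>cap_xi_diff_apply\<close> are absent, and the unit is the
      only coboundary in degree 0.\<close>
    case 0
    have "x = \<one>\<^bsub>cgrp (tot_complex K) n\<^esub>"
      by (subst x', unfold tot_one x, intro restrict_ext)
         (use cap_xi_diff_apply[OF w] 0 in simp)
    then show ?thesis
      using 0 by (simp add: coboundaries_def)
  next
    case (Suc m)
    let ?v = "cap_xi K m w"
    have v: "?v \<in> carrier (cgrp (tot_complex K) m)"
      using cap_xi_in_carrier w Suc by blast
    have Dv: "cdiff (tot_complex K) m ?v \<in> carrier (cgrp (tot_complex K) n)"
      using hom_in_carrier[OF tot_diff_hom v] Suc by simp
    interpret T: comm_group "cgrp (tot_complex K) m"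
      by (rule comm_group_tot_complex)
    have "x = inv\<^bsub>cgrp (tot_complex K) n\<^esub> (cdiff (tot_complex K) m ?v)"
      unfolding tot_inv[OF Dv]
    proof (subst x', intro restrict_ext)
      fix l c assume l: "l \<in> {..n}" and "c \<in> nerve_chains K l (n - l)"
      then have l': "l \<le> Suc m" and c: "Poly_Mapping.keys c \<subseteq> nerve_simplices K l (Suc m - l)"
        using Suc by auto
      have b: "?v l (chain_boundary (Suc m - l) c) =
          w (1, l) (chain_map (m - l) (\<lambda>y. (((), [1]), y)) (chain_boundary (Suc m - l) c))" if "l \<le> m"
        using keys_chain_boundary[of c K l "m - l"] c that by (simp add: cap_xi_def Suc_diff_le)
      have a: "?v (l - 1) (alt_push (Suc m - l) l (nerve_face K l) c) =
          w (1, l - 1) (chain_map (Suc m - l) (\<lambda>y. (((), [1]), y)) (alt_push (Suc m - l) l (nerve_face K l) c))"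
        if "1 \<le> l"
        using keys_alt_push_face[OF that c] that l' by (cases l) (auto simp: cap_xi_def)
      show "x l c = - cdiff (tot_complex K) m ?v l c"
        using cap_xi_diff_apply[OF w, of l c] tot_diff[OF l' c, of ?v] l' c a b
        by (auto simp: x Suc less_Suc_eq_le simp del: diff_is_0_eq')
    qed
    also have "\<dots> = cdiff (tot_complex K) m (inv\<^bsub>cgrp (tot_complex K) m\<^esub> ?v)"
      using tot_diff_inv[OF v] Suc by simp
    finally show ?thesis
      using v Suc by (simp add: coboundaries_def)
  qed
qed

end

section \<open>Cohomology classes\<close>

locale additive_complex =
  fixes C :: "'c cochain_complex"
  assumes comm_group_cgrp: "comm_group (cgrp C n)"
    and cdiff_hom: "cdiff C n \<in> hom (cgrp C n) (cgrp C (Suc n))"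
begin

lemma group_cgrp: "group (cgrp C n)"
  by (rule comm_group.axioms(2)[OF comm_group_cgrp])

lemma group_hom_cdiff: "group_hom (cgrp C n) (cgrp C (Suc n)) (cdiff C n)"
  by (simp add: group_hom_def group_hom_axioms_def group_cgrp cdiff_hom)

lemma subgroup_coboundaries: "subgroup (coboundaries C n) (cgrp C n)"
proof (cases n)
  case 0
  then show ?thesis
    using group.triv_subgroup[OF group_cgrp] by (simp add: coboundaries_def)
next
  case (Suc m)
  then show ?thesis
    using group_hom.img_is_subgroup[OF group_hom_cdiff] by (simp add: coboundaries_def)
qed

lemma normal_coboundaries: "coboundaries C n \<lhd> cgrp C n"
  by (rule comm_group.subgroup_imp_normal[OF comm_group_cgrp subgroup_coboundaries])

lemma subgroup_cocycles: "subgroup (cocycles C n) (cgrp C n)"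
  using group_hom.subgroup_kernel[OF group_hom_cdiff[of n]] by (simp add: cocycles_def kernel_def)

text \<open>Classes are cosets in the whole cochain group, which is commutative; so the coboundaries
  are normal there and the product of cosets can be computed without passing to cocycles.\<close>

lemma coclass_mult:
  "u \<in> carrier (cgrp C n) \<Longrightarrow> v \<in> carrier (cgrp C n) \<Longrightarrow>
     coclass C n u <#>\<^bsub>cgrp C n\<^esub> coclass C n v = coclass C n (u \<otimes>\<^bsub>cgrp C n\<^esub> v)"
  unfolding coclass_def by (rule normal.rcos_sum[OF normal_coboundaries])

lemma carrier_cohomology: "carrier (cohomology C n) = coclass C n ` cocycles C n"
  by (auto simp: cohomology_def FactGroup_def RCOSETS_def coclass_def r_coset_def)

lemma mult_cohomology: "A \<otimes>\<^bsub>cohomology C n\<^esub> B = A <#>\<^bsub>cgrp C n\<^esub> B"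
  by (simp add: cohomology_def set_mult_def)

lemma one_cohomology: "\<one>\<^bsub>cohomology C n\<^esub> = coclass C n \<one>\<^bsub>cgrp C n\<^esub>"
  using group.coset_mult_one[OF group_cgrp subgroup.subset[OF subgroup_coboundaries]]
  by (simp add: cohomology_def FactGroup_def coclass_def)

text \<open>The inverse in a monoid record is a definite description. The class of the inverse
  cochain satisfies it, and any other candidate agrees after multiplication by that class.\<close>

lemma inv_cohomology:
  assumes u: "u \<in> cocycles C n"
  shows "inv\<^bsub>cohomology C n\<^esub> (coclass C n u) = coclass C n (inv\<^bsub>cgrp C n\<^esub> u)"
  unfolding m_inv_def[of "cohomology C n"]
proof (rule the_equality)
  interpret comm_group "cgrp C n"
    by (rule comm_group_cgrp)
  have uc: "u \<in> carrier (cgrp C n)"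
    using u by (simp add: cocycles_def)
  have "inv\<^bsub>cgrp C n\<^esub> u \<in> cocycles C n"
    by (rule subgroup.m_inv_closed[OF subgroup_cocycles u])
  then show "coclass C n (inv\<^bsub>cgrp C n\<^esub> u) \<in> carrier (cohomology C n) \<and>
    coclass C n u \<otimes>\<^bsub>cohomology C n\<^esub> coclass C n (inv\<^bsub>cgrp C n\<^esub> u) = \<one>\<^bsub>cohomology C n\<^esub> \<and>
    coclass C n (inv\<^bsub>cgrp C n\<^esub> u) \<otimes>\<^bsub>cohomology C n\<^esub> coclass C n u = \<one>\<^bsub>cohomology C n\<^esub>"
    using uc by (simp add: carrier_cohomology mult_cohomology one_cohomology coclass_mult)
  fix A
  assume A: "A \<in> carrier (cohomology C n) \<and> coclass C n u \<otimes>\<^bsub>cohomology C n\<^esub> A = \<one>\<^bsub>cohomology C n\<^esub> \<and>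
    A \<otimes>\<^bsub>cohomology C n\<^esub> coclass C n u = \<one>\<^bsub>cohomology C n\<^esub>"
  then obtain v where v: "v \<in> carrier (cgrp C n)" "A = coclass C n v"
    by (auto simp: carrier_cohomology cocycles_def)
  have "A = coclass C n (inv\<^bsub>cgrp C n\<^esub> u \<otimes>\<^bsub>cgrp C n\<^esub> (u \<otimes>\<^bsub>cgrp C n\<^esub> v))"
    using uc v by (simp add: m_assoc[symmetric])
  also have "\<dots> = coclass C n (inv\<^bsub>cgrp C n\<^esub> u) <#>\<^bsub>cgrp C n\<^esub> (coclass C n u <#>\<^bsub>cgrp C n\<^esub> A)"
    using uc v by (simp add: coclass_mult)
  also have "coclass C n u <#>\<^bsub>cgrp C n\<^esub> A = coclass C n \<one>\<^bsub>cgrp C n\<^esub>"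
    using A by (simp add: mult_cohomology one_cohomology)
  finally show "A = coclass C n (inv\<^bsub>cgrp C n\<^esub> u)"
    using uc by (simp add: coclass_mult)
qed

end

text \<open>The image of a coset under \<open>f\<close> may miss some coboundaries of the target;
  the factor \<open>coboundaries D n\<close> in \<open>induced\<close> completes it to a full
  coset.\<close>

lemma induced_coclass:
  assumes C: "additive_complex C" and D: "additive_complex D"
    and f: "f \<in> hom (cgrp C m) (cgrp D n)" and cob: "f ` coboundaries C m \<subseteq> coboundaries D n"
    and u: "u \<in> carrier (cgrp C m)"
  shows "induced D n f (coclass C m u) = coclass D n (f u)"
proof -
  interpret C: additive_complex C by fact
  interpret D: additive_complex D by fact
  interpret Cm: comm_group "cgrp C m" by (rule C.comm_group_cgrp)
  interpret Dn: comm_group "cgrp D n" by (rule D.comm_group_cgrp)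
  note sC = C.subgroup_coboundaries[of m] and sD = D.subgroup_coboundaries[of n]
  have fu: "f u \<in> carrier (cgrp D n)"
    using f u by (rule hom_in_carrier)
  show ?thesis
  proof
    show "induced D n f (coclass C m u) \<subseteq> coclass D n (f u)"
    proof
      fix x assume "x \<in> induced D n f (coclass C m u)"
      then obtain b c where b: "b \<in> coboundaries D n" and c: "c \<in> coboundaries C m"
        and x: "x = b \<otimes>\<^bsub>cgrp D n\<^esub> f (c \<otimes>\<^bsub>cgrp C m\<^esub> u)"
        by (auto simp: induced_def coclass_def set_mult_def r_coset_def)
      have fc: "f c \<in> coboundaries D n"
        using cob c by blast
      have "x = (b \<otimes>\<^bsub>cgrp D n\<^esub> f c) \<otimes>\<^bsub>cgrp D n\<^esub> f u"
        using x hom_mult[OF f subgroup.mem_carrier[OF sC c] u] fu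
          subgroup.mem_carrier[OF sD b] subgroup.mem_carrier[OF sD fc] by (simp add: Dn.m_assoc)
      then show "x \<in> coclass D n (f u)"
        using subgroup.m_closed[OF sD b fc] by (auto simp: coclass_def r_coset_def)
    qed
    show "coclass D n (f u) \<subseteq> induced D n f (coclass C m u)"
    proof
      fix x assume "x \<in> coclass D n (f u)"
      then obtain b where b: "b \<in> coboundaries D n" and x: "x = b \<otimes>\<^bsub>cgrp D n\<^esub> f u"
        by (auto simp: coclass_def r_coset_def)
      have "u \<in> coclass C m u"
        using u subgroup.one_closed[OF sC] unfolding coclass_def r_coset_def by force
      then show "x \<in> induced D n f (coclass C m u)"
        unfolding induced_def set_mult_def using b x by blast
    qed
  qed
qed

text \<open>The coboundary attached to \<open>f a\<close> in the middle is carried by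
  \<open>g\<close> to a coboundary and absorbed. Additivity is asked of \<open>g\<close> and on all
  arguments, so that \<open>f\<close> may be the shuffle pullback and \<open>g\<close> the cap
  product.\<close>

lemma induced_induced:
  assumes E: "additive_complex E"
    and mult: "\<And>x y. g (x \<otimes>\<^bsub>cgrp D k\<^esub> y) = g x \<otimes>\<^bsub>cgrp E n\<^esub> g y"
    and cob: "g ` coboundaries D k \<subseteq> coboundaries E n" and ne: "coboundaries D k \<noteq> {}"
    and gf: "\<And>a. a \<in> A \<Longrightarrow> g (f a) \<in> carrier (cgrp E n)"
  shows "induced E n g (induced D k f A) = induced E n (\<lambda>a. g (f a)) A"
proof -
  interpret E: additive_complex E by fact
  interpret En: comm_group "cgrp E n" by (rule E.comm_group_cgrp)
  note sE = E.subgroup_coboundaries[of n]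
  show ?thesis
  proof
    show "induced E n g (induced D k f A) \<subseteq> induced E n (\<lambda>a. g (f a)) A"
    proof
      fix x assume "x \<in> induced E n g (induced D k f A)"
      then obtain b c a where b: "b \<in> coboundaries E n" and c: "c \<in> coboundaries D k" and a: "a \<in> A"
        and x: "x = b \<otimes>\<^bsub>cgrp E n\<^esub> g (c \<otimes>\<^bsub>cgrp D k\<^esub> f a)"
        by (auto simp: induced_def set_mult_def)
      have gc: "g c \<in> coboundaries E n"
        using cob c by blast
      have "x = (b \<otimes>\<^bsub>cgrp E n\<^esub> g c) \<otimes>\<^bsub>cgrp E n\<^esub> g (f a)"
        using x gf[OF a] subgroup.mem_carrier[OF sE b] subgroup.mem_carrier[OF sE gc]
        by (simp add: mult En.m_assoc)
      then show "x \<in> induced E n (\<lambda>a. g (f a)) A"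
        using subgroup.m_closed[OF sE b gc] a unfolding induced_def set_mult_def by blast
    qed
    show "induced E n (\<lambda>a. g (f a)) A \<subseteq> induced E n g (induced D k f A)"
    proof
      fix x assume "x \<in> induced E n (\<lambda>a. g (f a)) A"
      then obtain b a where b: "b \<in> coboundaries E n" and a: "a \<in> A" and x: "x = b \<otimes>\<^bsub>cgrp E n\<^esub> g (f a)"
        by (auto simp: induced_def set_mult_def)
      obtain c where c: "c \<in> coboundaries D k"
        using ne by blast
      have gc: "g c \<in> coboundaries E n"
        using cob c by blast
      note car = subgroup.mem_carrier[OF sE b] subgroup.mem_carrier[OF sE gc] gf[OF a]
      \<comment> \<open>Any coboundary \<open>c\<close> will do: its image is inserted together with
        its inverse, and the inverse is merged into \<open>b\<close>.\<close>
      have "x = (b \<otimes>\<^bsub>cgrp E n\<^esub> inv\<^bsub>cgrp E n\<^esub> g c) \<otimes>\<^bsub>cgrp E n\<^esub> (g c \<otimes>\<^bsub>cgrp E n\<^esub> g (f a))"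
        using x car by (simp add: En.m_assoc En.m_assoc[symmetric, of "inv\<^bsub>cgrp E n\<^esub> g c" "g c"])
      moreover have "b \<otimes>\<^bsub>cgrp E n\<^esub> inv\<^bsub>cgrp E n\<^esub> g c \<in> coboundaries E n"
        using subgroup.m_closed[OF sE b subgroup.m_inv_closed[OF sE gc]] .
      moreover have "g c \<otimes>\<^bsub>cgrp E n\<^esub> g (f a) \<in> g ` induced D k f A"
        using c a unfolding induced_def set_mult_def by (force simp: mult)
      ultimately show "x \<in> induced E n g (induced D k f A)"
        unfolding induced_def[of E] set_mult_def by blast
    qed
  qed
qed

lemma induced_cong: "(\<And>a. a \<in> A \<Longrightarrow> f a = g a) \<Longrightarrow> induced D n f A = induced D n g A"
  by (simp add: induced_def cong: image_cong)

lemma descends_compose: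
  "descends C m D n f \<Longrightarrow> descends D n E k g \<Longrightarrow> descends C m E k (\<lambda>u. g (f u))"
  unfolding descends_def using hom_compose[of f _ _ g] by (fastforce simp: o_def)

lemma descends_cong:
  assumes C: "additive_complex C" and "descends C m D n f" "\<And>u. u \<in> carrier (cgrp C m) \<Longrightarrow> g u = f u"
  shows "descends C m D n g"
proof -
  interpret additive_complex C by fact
  interpret group "cgrp C m" by (rule group_cgrp)
  have "g \<in> hom (cgrp C m) (cgrp D n)"
    using assms by (auto simp: descends_def hom_def Pi_iff)
  moreover have "g ` S = f ` S" if "S \<subseteq> carrier (cgrp C m)" for S
    using assms(3) that by (auto simp: image_iff subset_iff)
  ultimately show ?thesis
    using assms(2) subgroup.subset[OF subgroup_cocycles[of m]] subgroup.subset[OF subgroup_coboundaries[of m]]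
    by (simp add: descends_def)
qed

lemma descends_inv:
  assumes D: "additive_complex D" and f: "descends C m D n f"
  shows "descends C m D n (\<lambda>u. inv\<^bsub>cgrp D n\<^esub> (f u))"
proof -
  interpret additive_complex D by fact
  interpret comm_group "cgrp D n" by (rule comm_group_cgrp)
  have "(\<lambda>u. inv\<^bsub>cgrp D n\<^esub> (f u)) \<in> hom (cgrp C m) (cgrp D n)"
    using f by (auto simp: descends_def hom_def Pi_iff inv_mult)
  then show ?thesis
    using f subgroup.m_inv_closed[OF subgroup_cocycles] subgroup.m_inv_closed[OF subgroup_coboundaries]
    by (fastforce simp: descends_def)
qed

lemma hom_cohomologyI:
  assumes C: "additive_complex C" and D: "additive_complex D" and f: "descends C m D n f"
    and F: "\<And>u. u \<in> cocycles C m \<Longrightarrow> F (coclass C m u) = coclass D n (f u)"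
  shows "F \<in> hom (cohomology C m) (cohomology D n)"
proof (rule homI)
  interpret C: additive_complex C by fact
  interpret D: additive_complex D by fact
  have fh: "f \<in> hom (cgrp C m) (cgrp D n)" and fZ: "f ` cocycles C m \<subseteq> cocycles D n"
    using f by (auto simp: descends_def)
  show "F A \<in> carrier (cohomology D n)" if "A \<in> carrier (cohomology C m)" for A
    using that fZ by (auto simp: C.carrier_cohomology D.carrier_cohomology F)
  fix A B assume "A \<in> carrier (cohomology C m)" "B \<in> carrier (cohomology C m)"
  then obtain u v where u: "u \<in> cocycles C m" "A = coclass C m u" and v: "v \<in> cocycles C m" "B = coclass C m v"
    by (auto simp: C.carrier_cohomology)
  have uv: "u \<otimes>\<^bsub>cgrp C m\<^esub> v \<in> cocycles C m"
    by (rule subgroup.m_closed[OF C.subgroup_cocycles u(1) v(1)])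
  have car: "u \<in> carrier (cgrp C m)" "v \<in> carrier (cgrp C m)"
    using u v by (auto simp: cocycles_def)
  show "F (A \<otimes>\<^bsub>cohomology C m\<^esub> B) = F A \<otimes>\<^bsub>cohomology D n\<^esub> F B"
    using car uv u v hom_in_carrier[OF fh] hom_mult[OF fh]
    by (simp add: C.mult_cohomology D.mult_cohomology C.coclass_mult D.coclass_mult F)
qed

section \<open>Passage to cohomology for nerves\<close>

lemma additive_complex_tot_complex: "plot_groupoid K \<Longrightarrow> additive_complex (tot_complex K)"
  by (simp add: additive_complex_def comm_group_tot_complex plot_groupoid.tot_diff_hom)

context plot_groupoid
begin

text \<open>Anticommuting with the differentials suffices, because cocycles and coboundaries are
  closed under inverses. Degree 0 of the target is separate, since its coboundaries are not given by
  a differential.\<close>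

lemma loop_transgression_descends:
  "descends (tot_complex ZK) (Suc n) (tot_complex K) n (loop_transgression K n)"
  unfolding descends_def
proof (intro conjI subsetI)
  interpret K: additive_complex "tot_complex K"
    by (rule additive_complex_tot_complex[OF plot_groupoid_axioms])
  show "loop_transgression K n \<in> hom (cgrp (tot_complex ZK) (Suc n)) (cgrp (tot_complex K) n)"
    by (rule loop_transgression_hom)
  have T1: "loop_transgression K m \<one>\<^bsub>cgrp (tot_complex ZK) (Suc m)\<^esub> = \<one>\<^bsub>cgrp (tot_complex K) m\<^esub>" for m
    by (rule hom_one[OF loop_transgression_hom])
       (rule comm_group.axioms(2)[OF comm_group_tot_complex])+
  interpret Kn: group "cgrp (tot_complex K) n" by (rule K.group_cgrp)
  interpret KSn: group "cgrp (tot_complex K) (Suc n)" by (rule K.group_cgrp)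
  fix x assume "x \<in> loop_transgression K n ` cocycles (tot_complex ZK) (Suc n)"
  then obtain u where u: "u \<in> carrier (cgrp (tot_complex ZK) (Suc n))"
      "cdiff (tot_complex ZK) (Suc n) u = \<one>\<^bsub>cgrp (tot_complex ZK) (Suc (Suc n))\<^esub>"
    and x: "x = loop_transgression K n u"
    by (auto simp: cocycles_def)
  have xc: "x \<in> carrier (cgrp (tot_complex K) n)"
    unfolding x by (rule hom_in_carrier[OF loop_transgression_hom u(1)])
  have "inv\<^bsub>cgrp (tot_complex K) (Suc n)\<^esub> (cdiff (tot_complex K) n x) = \<one>\<^bsub>cgrp (tot_complex K) (Suc n)\<^esub>"
    using loop_transgression_diff[OF u(1)] u(2) T1 x by simp
  then show "x \<in> cocycles (tot_complex K) n"
    using xc hom_in_carrier[OF tot_diff_hom xc] by (simp add: cocycles_def)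
next
  interpret K: additive_complex "tot_complex K"
    by (rule additive_complex_tot_complex[OF plot_groupoid_axioms])
  fix x assume "x \<in> loop_transgression K n ` coboundaries (tot_complex ZK) (Suc n)"
  then obtain u where u: "u \<in> carrier (cgrp (tot_complex ZK) n)"
    and x: "x = loop_transgression K n (cdiff (tot_complex ZK) n u)"
    by (auto simp: coboundaries_def)
  show "x \<in> coboundaries (tot_complex K) n"
  proof (cases n)
    case 0
    then show ?thesis
      using x loop_transgression_diff_0 u by (simp add: coboundaries_def)
  next
    case (Suc m)
    have "loop_transgression K m u \<in> carrier (cgrp (tot_complex K) m)"
      using hom_in_carrier[OF loop_transgression_hom] u Suc by blast
    then have "cdiff (tot_complex K) m (loop_transgression K m u) \<in> coboundaries (tot_complex K) n"
      by (simp add: coboundaries_def Suc)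
    then show ?thesis
      using subgroup.m_inv_closed[OF K.subgroup_coboundaries] x loop_transgression_diff u Suc by simp
  qed
qed

text \<open>The two steps through \<open>bi_complex\<close> are treated as one: on every
  representative of the class the composite is \<open>loop_transgression\<close>, which
  descends.\<close>

lemma induced_cap_xi_shuffle:
  assumes u: "u \<in> carrier (cgrp (tot_complex ZK) (Suc n))"
  shows "induced (tot_complex K) n (cap_xi K n)
      (induced (bi_complex int_grpd K) (Suc n) (shuffle_pullback int_grpd K (Suc n)) (coclass (tot_complex ZK) (Suc n) u))
    = coclass (tot_complex K) n (loop_transgression K n u)"
proof -
  interpret Z: additive_complex "tot_complex ZK"
    by (rule additive_complex_tot_complex[OF plot_groupoid_ZK])
  have A: "a \<in> carrier (cgrp (tot_complex ZK) (Suc n))" if "a \<in> coclass (tot_complex ZK) (Suc n) u" for a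
    using monoid.r_coset_subset_G[OF group.is_monoid[OF Z.group_cgrp] subgroup.subset[OF Z.subgroup_coboundaries] u] that
    by (auto simp: coclass_def)
  have "coboundaries (bi_complex int_grpd K) (Suc n) \<noteq> {}"
    using monoid.one_closed[OF group.is_monoid[OF group_bi_complex]] by (auto simp: coboundaries_def)
  then have "induced (tot_complex K) n (cap_xi K n)
      (induced (bi_complex int_grpd K) (Suc n) (shuffle_pullback int_grpd K (Suc n)) (coclass (tot_complex ZK) (Suc n) u))
    = induced (tot_complex K) n (\<lambda>a. cap_xi K n (shuffle_pullback int_grpd K (Suc n) a)) (coclass (tot_complex ZK) (Suc n) u)"
    by (intro induced_induced additive_complex_tot_complex plot_groupoid_axioms cap_xi_mult cap_xi_coboundaries)
       (use A hom_in_carrier[OF loop_transgression_hom] in \<open>simp_all add: cap_xi_shuffle_pullback\<close>)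
  also have "\<dots> = induced (tot_complex K) n (loop_transgression K n) (coclass (tot_complex ZK) (Suc n) u)"
    using A by (intro induced_cong cap_xi_shuffle_pullback)
  also have "\<dots> = coclass (tot_complex K) n (loop_transgression K n u)"
    using loop_transgression_descends u
    by (intro induced_coclass additive_complex_tot_complex plot_groupoid_axioms plot_groupoid_ZK)
       (auto simp: descends_def)
  finally show ?thesis .
qed

end

lemma pullback_descends:
  assumes K: "plot_groupoid K" and L: "plot_groupoid L"
    and f: "\<And>p. nerve_plot_map K p L p f"
    and face: "\<And>p j z. j \<le> Suc p \<Longrightarrow> z \<in> nerve K (Suc p) \<Longrightarrow>
      f (nerve_face K (Suc p) j z) = nerve_face L (Suc p) j (f z)"
  shows "descends (tot_complex L) (Suc n) (tot_complex K) (Suc n) (pullback K (Suc n) f)"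
proof -
  interpret K: plot_groupoid K by fact
  interpret L: plot_groupoid L by fact
  note hom = pullback_hom[OF f]
  have "pullback K m f \<one>\<^bsub>cgrp (tot_complex L) m\<^esub> = \<one>\<^bsub>cgrp (tot_complex K) m\<^esub>" for m
    by (rule hom_one[OF hom])
       (rule comm_group.axioms(2)[OF comm_group_tot_complex])+
  then have "pullback K (Suc n) f u \<in> cocycles (tot_complex K) (Suc n)"
    if "u \<in> cocycles (tot_complex L) (Suc n)" for u
    using that hom_in_carrier[OF hom, of u "Suc n"] pullback_diff[OF K L f face, of u "Suc n"]
    by (simp add: cocycles_def)
  moreover have "pullback K (Suc n) f ` coboundaries (tot_complex L) (Suc n) \<subseteq> coboundaries (tot_complex K) (Suc n)"
    unfolding coboundaries_def using hom_in_carrier[OF hom, of _ n] pullback_diff[OF K L f face, of _ n] by auto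
  ultimately show ?thesis
    using hom by (auto simp: descends_def)
qed

section \<open>The crossed product\<close>

lemma plot_groupoid_lie_groupoid:
  assumes "lie_groupoid K"
  shows "plot_groupoid K"
proof
  have K: "groupoid K" "smooth_manifold (obj_mfd K)" "mcarrier (obj_mfd K) = objs K"
    "smooth_manifold (arr_mfd K)" "mcarrier (arr_mfd K) = arrs K"
    "smooth_map (arr_mfd K) (obj_mfd K) (gsrc K)" "smooth_map (obj_mfd K) (arr_mfd K) (gid K)"
    "smooth_on (composable K) (prod_mfd (arr_mfd K) (arr_mfd K)) (arr_mfd K) (\<lambda>(g, h). gmul K g h)"
    using assms by (auto simp: lie_groupoid_def submersion_def)
  have c: "coherent_atlas (obj_mfd K)" "coherent_atlas (arr_mfd K)"
    "coherent_atlas (prod_mfd (arr_mfd K) (arr_mfd K))"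
    using K by (auto intro: coherent_atlas_smooth_manifold coherent_atlas_prod)
  show "groupoid K"
    by (rule K(1))
  show "plot q (obj_mfd K) (\<lambda>y. gsrc K (s y))"
    if "plot q (arr_mfd K) s" "\<And>y. y \<in> standard_simplex q \<Longrightarrow> s y \<in> arrs K" for q s
    using plot_compose[OF c(2) that(1) K(6)] that(2) K(5) by simp
  show "plot q (arr_mfd K) (\<lambda>y. gid K (s y))"
    if "plot q (obj_mfd K) s" "\<And>y. y \<in> standard_simplex q \<Longrightarrow> s y \<in> objs K" for q s
    using plot_compose[OF c(1) that(1) K(7)] that(2) K(3) by simp
  show "plot q (arr_mfd K) (\<lambda>y. gmul K (s y) (t y))"
    if "plot q (arr_mfd K) s" "plot q (arr_mfd K) t"
      "\<And>y. y \<in> standard_simplex q \<Longrightarrow> (s y, t y) \<in> composable K" for q s t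
    using plot_compose[OF c(3), of q "\<lambda>y. (s y, t y)" "composable K" _ "\<lambda>(g, h). gmul K g h"] that K(8)
    by (simp add: plot_prod_iff o_def)
qed

text \<open>Smoothness is again tested on plots. For rho this reduces powers with a varying integer
  exponent to fixed exponents locally.\<close>

definition plot_functor ::
  "('o, 'a) grpd \<Rightarrow> ('p, 'b) grpd \<Rightarrow> ('o \<Rightarrow> 'p) \<Rightarrow> ('a \<Rightarrow> 'b) \<Rightarrow> bool" where
  "plot_functor K L f0 f \<longleftrightarrow>
     (\<forall>x\<in>objs K. f0 x \<in> objs L) \<and>
     (\<forall>g\<in>arrs K. f g \<in> arrs L \<and> gsrc L (f g) = f0 (gsrc K g) \<and> gtgt L (f g) = f0 (gtgt K g)) \<and>
     (\<forall>(g, h)\<in>composable K. f (gmul K g h) = gmul L (f g) (f h)) \<and>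
     (\<forall>q s. plot q (obj_mfd K) s \<longrightarrow> (\<forall>y\<in>standard_simplex q. s y \<in> objs K) \<longrightarrow>
        plot q (obj_mfd L) (\<lambda>y. f0 (s y))) \<and>
     (\<forall>q s. plot q (arr_mfd K) s \<longrightarrow> (\<forall>y\<in>standard_simplex q. s y \<in> arrs K) \<longrightarrow>
        plot q (arr_mfd L) (\<lambda>y. f (s y)))"

lemma nerve_map_in_nerve:
  assumes K: "plot_groupoid K" and L: "plot_groupoid L" and f: "plot_functor K L f0 f"
    and z: "z \<in> nerve K p"
  shows "nerve_map f0 f z \<in> nerve L p"
proof -
  have "nerve_vertex L (nerve_map f0 f z) m = f0 (nerve_vertex K z m)" if "m < p" for m
    using that z f by (cases m) (auto simp: nerve_map_def plot_groupoid.nerve_iff[OF K] plot_functor_def)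
  then show ?thesis
    using z f
    by (auto simp: nerve_map_def plot_groupoid.nerve_iff[OF K] plot_groupoid.nerve_iff[OF L] plot_functor_def)
qed

lemma nerve_plot_map_nerve_map:
  assumes K: "plot_groupoid K" and L: "plot_groupoid L" and f: "plot_functor K L f0 f"
  shows "nerve_plot_map K p L p (nerve_map f0 f)"
  unfolding nerve_plot_map_def
proof (intro allI impI)
  fix q s assume s: "nerve_plot K p q s"
  have n: "s y \<in> nerve K p" if "y \<in> standard_simplex q" for y
    using s that by (auto simp: nerve_plot_def)
  show "nerve_plot L p q (\<lambda>y. nerve_map f0 f (s y))"
    unfolding nerve_plot_def
  proof (intro conjI ballI allI impI)
    show "nerve_map f0 f (s y) \<in> nerve L p" if "y \<in> standard_simplex q" for y
      by (rule nerve_map_in_nerve[OF K L f n[OF that]])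
    show "plot q (obj_mfd L) (\<lambda>y. fst (nerve_map f0 f (s y)))"
      using s f n by (auto simp: nerve_map_def nerve_plot_def plot_functor_def plot_groupoid.nerve_iff[OF K])
    fix i assume i: "i < p"
    have "plot q (arr_mfd L) (\<lambda>y. f (snd (s y) ! i))"
      using s f n i by (auto simp: nerve_plot_def plot_functor_def plot_groupoid.nerve_iff[OF K])
    then show "plot q (arr_mfd L) (\<lambda>y. snd (nerve_map f0 f (s y)) ! i)"
      by (rule plot_cong[rotated]) (use n i in \<open>auto simp: nerve_map_def plot_groupoid.nerve_iff[OF K]\<close>)
  qed
qed

lemma nerve_map_face:
  assumes K: "plot_groupoid K" and f: "plot_functor K L f0 f"
    and j: "j \<le> Suc p" and z: "z \<in> nerve K (Suc p)"
  shows "nerve_map f0 f (nerve_face K (Suc p) j z) = nerve_face L (Suc p) j (nerve_map f0 f z)"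
proof (rule nerve_eqI[where p = p])
  note n = z[unfolded plot_groupoid.nerve_iff[OF K]]
  have l: "length (snd z) = Suc p" "length (snd (nerve_map f0 f z)) = Suc p"
    using n by (auto simp: nerve_map_def)
  show "fst (nerve_map f0 f (nerve_face K (Suc p) j z)) = fst (nerve_face L (Suc p) j (nerve_map f0 f z))"
    using n f l by (auto simp: fst_nerve_face nerve_map_def plot_functor_def)
  show "length (snd (nerve_map f0 f (nerve_face K (Suc p) j z))) = p"
    "length (snd (nerve_face L (Suc p) j (nerve_map f0 f z))) = p"
    using l j by (auto simp: length_nerve_face nerve_map_def)
  fix m assume m: "m < p"
  have "(snd z ! m, snd z ! Suc m) \<in> composable K"
    using n m by (auto simp: composable_def)
  then have "f (gmul K (snd z ! m) (snd z ! Suc m)) = gmul L (f (snd z ! m)) (f (snd z ! Suc m))"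
    using f by (auto simp: plot_functor_def)
  then show "snd (nerve_map f0 f (nerve_face K (Suc p) j z)) ! m = snd (nerve_face L (Suc p) j (nerve_map f0 f z)) ! m"
    using m l j by (auto simp: nth_nerve_face length_nerve_face nerve_map_def)
qed

lemma pullback_nerve_map_descends:
  assumes "plot_groupoid K" "plot_groupoid L" "plot_functor K L f0 f"
  shows "descends (tot_complex L) (Suc n) (tot_complex K) (Suc n) (pullback K (Suc n) (nerve_map f0 f))"
  using assms by (intro pullback_descends nerve_plot_map_nerve_map nerve_map_face)

section \<open>Crossed modules and their crossed products\<close>

locale lie_crossed_module =
  fixes N :: "('o, 'n) grpd" and G :: "('o, 'g) grpd"
    and \<phi> :: "'n \<Rightarrow> 'g" and act :: "'n \<Rightarrow> 'g \<Rightarrow> 'n"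
  assumes crossed_module: "crossed_module N G \<phi> act"
begin

lemma lie_N: "lie_groupoid N" and lie_G: "lie_groupoid G"
  and objs_eq: "objs N = objs G" and obj_mfd_eq: "obj_mfd N = obj_mfd G"
  and src_N: "x \<in> arrs N \<Longrightarrow> gsrc N x = gtgt N x"
  using crossed_module by (auto simp: crossed_module_def)

sublocale N: plot_groupoid N
  by (rule plot_groupoid_lie_groupoid[OF lie_N])

sublocale G: plot_groupoid G
  by (rule plot_groupoid_lie_groupoid[OF lie_G])

lemma phi_closed: "x \<in> arrs N \<Longrightarrow> \<phi> x \<in> arrs G"
  and src_phi: "x \<in> arrs N \<Longrightarrow> gsrc G (\<phi> x) = gtgt N x"
  and tgt_phi: "x \<in> arrs N \<Longrightarrow> gtgt G (\<phi> x) = gtgt N x"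
  using crossed_module by (auto simp: crossed_module_def)

lemma phi_mul:
  "x \<in> arrs N \<Longrightarrow> y \<in> arrs N \<Longrightarrow> gtgt N x = gtgt N y \<Longrightarrow> \<phi> (gmul N x y) = gmul G (\<phi> x) (\<phi> y)"
  using crossed_module by (auto simp: crossed_module_def composable_def)

lemma act_closed: "x \<in> arrs N \<Longrightarrow> g \<in> arrs G \<Longrightarrow> gtgt N x = gtgt G g \<Longrightarrow> act x g \<in> arrs N"
  and tgt_act: "x \<in> arrs N \<Longrightarrow> g \<in> arrs G \<Longrightarrow> gtgt N x = gtgt G g \<Longrightarrow> gtgt N (act x g) = gsrc G g"
  and act_id: "x \<in> arrs N \<Longrightarrow> act x (gid G (gtgt N x)) = x"
  using crossed_module by (auto simp: crossed_module_def right_action_def)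

lemma act_act:
  "x \<in> arrs N \<Longrightarrow> g \<in> arrs G \<Longrightarrow> h \<in> arrs G \<Longrightarrow> gtgt N x = gtgt G g \<Longrightarrow> gsrc G g = gtgt G h \<Longrightarrow>
     act x (gmul G g h) = act (act x g) h"
  using crossed_module by (auto simp: crossed_module_def right_action_def composable_def)

lemma act_mul:
  "x \<in> arrs N \<Longrightarrow> y \<in> arrs N \<Longrightarrow> g \<in> arrs G \<Longrightarrow> gtgt N x = gtgt G g \<Longrightarrow> gtgt N y = gtgt G g \<Longrightarrow>
     act (gmul N x y) g = gmul N (act x g) (act y g)"
  using crossed_module unfolding crossed_module_def composable_def by auto

lemma phi_act:
  "x \<in> arrs N \<Longrightarrow> g \<in> arrs G \<Longrightarrow> gtgt N x = gtgt G g \<Longrightarrow> \<phi> (act x g) = gconj G (\<phi> x) g"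
  using crossed_module by (auto simp: crossed_module_def)

lemma act_phi:
  "x \<in> arrs N \<Longrightarrow> y \<in> arrs N \<Longrightarrow> gtgt N x = gtgt N y \<Longrightarrow> act x (\<phi> y) = gconj N x y"
  using crossed_module unfolding crossed_module_def composable_def by auto

lemma plot_phi:
  assumes "plot q (arr_mfd N) s" "\<And>y. y \<in> standard_simplex q \<Longrightarrow> s y \<in> arrs N"
  shows "plot q (arr_mfd G) (\<lambda>y. \<phi> (s y))"
proof (rule plot_compose[OF _ assms(1)])
  show "coherent_atlas (arr_mfd N)"
    using lie_N by (auto simp: lie_groupoid_def intro: coherent_atlas_smooth_manifold)
  show "smooth_map (arr_mfd N) (arr_mfd G) \<phi>"
    using crossed_module by (auto simp: crossed_module_def)
qed (use assms(2) lie_N in \<open>auto simp: lie_groupoid_def\<close>)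

text \<open>In a bundle of groups the target is the source, whose action on plots is part of
  \<open>plot_groupoid\<close>.\<close>

lemma plot_tgt_N:
  assumes "plot q (arr_mfd N) s" "\<And>y. y \<in> standard_simplex q \<Longrightarrow> s y \<in> arrs N"
  shows "plot q (obj_mfd G) (\<lambda>y. gtgt N (s y))"
  using plot_cong[OF _ N.plot_src[OF assms]] assms(2) src_N obj_mfd_eq by simp

lemma plot_act:
  assumes "plot q (arr_mfd N) s" "plot q (arr_mfd G) t"
    and "\<And>y. y \<in> standard_simplex q \<Longrightarrow> s y \<in> arrs N \<and> t y \<in> arrs G \<and> gtgt N (s y) = gtgt G (t y)"
  shows "plot q (arr_mfd N) (\<lambda>y. act (s y) (t y))"
proof -
  have "coherent_atlas (prod_mfd (arr_mfd N) (arr_mfd G))"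
    using lie_N lie_G by (auto simp: lie_groupoid_def intro: coherent_atlas_smooth_manifold coherent_atlas_prod)
  moreover have "smooth_on {(x, g). x \<in> arrs N \<and> g \<in> arrs G \<and> gtgt N x = gtgt G g}
      (prod_mfd (arr_mfd N) (arr_mfd G)) (arr_mfd N) (\<lambda>(x, g). act x g)"
    using crossed_module by (auto simp: crossed_module_def right_action_def)
  ultimately show ?thesis
    using plot_compose[of "prod_mfd (arr_mfd N) (arr_mfd G)" q "\<lambda>y. (s y, t y)" _ _ "\<lambda>(x, g). act x g"] assms
    by (simp add: plot_prod_iff o_def)
qed

abbreviation "NG \<equiv> crossed_product N G act"

lemma NG_simps [simp]:
  "gsrc NG (x, g) = act x g" "gtgt NG a = fst a" "gid NG x = (x, gid G (gtgt N x))"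
  "gmul NG (x, g) (y, h) = (x, gmul G g h)" "ginv NG (x, g) = (act x g, ginv G g)"
  "objs NG = arrs N" "(x, g) \<in> arrs NG \<longleftrightarrow> x \<in> arrs N \<and> g \<in> arrs G \<and> gtgt N x = gtgt G g"
  "obj_mfd NG = arr_mfd N" "arr_mfd NG = prod_mfd (arr_mfd N) (arr_mfd G)"
  by (auto simp: crossed_product_def)

lemma inv_G:
  "g \<in> arrs G \<Longrightarrow> ginv G g \<in> arrs G" "g \<in> arrs G \<Longrightarrow> gsrc G (ginv G g) = gtgt G g"
  "g \<in> arrs G \<Longrightarrow> gtgt G (ginv G g) = gsrc G g"
  "g \<in> arrs G \<Longrightarrow> gmul G g (ginv G g) = gid G (gtgt G g)"
  "g \<in> arrs G \<Longrightarrow> gmul G (ginv G g) g = gid G (gsrc G g)"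
  using G.groupoid by (auto simp: groupoid_def)

lemma assoc_G:
  "g \<in> arrs G \<Longrightarrow> h \<in> arrs G \<Longrightarrow> k \<in> arrs G \<Longrightarrow> gsrc G g = gtgt G h \<Longrightarrow> gsrc G h = gtgt G k \<Longrightarrow>
     gmul G (gmul G g h) k = gmul G g (gmul G h k)"
  using G.groupoid by (auto simp: groupoid_def composable_def)

lemma act_inv:
  "x \<in> arrs N \<Longrightarrow> g \<in> arrs G \<Longrightarrow> gtgt N x = gtgt G g \<Longrightarrow> act (act x g) (ginv G g) = x"
  using act_act[of x g "ginv G g"] act_id[of x] by (simp add: inv_G)

lemma groupoid_NG: "groupoid NG"
  unfolding groupoid_def composable_def
  by (auto simp: act_closed tgt_act act_act act_id act_inv inv_G assoc_G G.mul_closed G.id_closed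
      G.src_id G.tgt_id G.id_mul G.mul_id G.tgt_closed N.tgt_closed objs_eq[symmetric])

lemma plot_groupoid_NG: "plot_groupoid NG"
proof
  show "groupoid NG"
    by (rule groupoid_NG)
  show "plot q (obj_mfd NG) (\<lambda>y. gsrc NG (s y))"
    if s: "plot q (arr_mfd NG) s" "\<And>y. y \<in> standard_simplex q \<Longrightarrow> s y \<in> arrs NG" for q s
  proof -
    have "gsrc NG (s y) = act (fst (s y)) (snd (s y))" for y
      by (cases "s y") simp
    moreover have "fst (s y) \<in> arrs N \<and> snd (s y) \<in> arrs G \<and> gtgt N (fst (s y)) = gtgt G (snd (s y))"
      if "y \<in> standard_simplex q" for y
      using s(2)[OF that] by (cases "s y") simp
    ultimately show ?thesis
      using plot_act[of q "fst \<circ> s" "snd \<circ> s"] s(1) by (simp add: plot_prod_iff)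
  qed
  show "plot q (arr_mfd NG) (\<lambda>y. gid NG (s y))"
    if s: "plot q (obj_mfd NG) s" "\<And>y. y \<in> standard_simplex q \<Longrightarrow> s y \<in> objs NG" for q s
    using s G.plot_id[OF plot_tgt_N] N.tgt_closed by (simp add: plot_prod_iff o_def objs_eq)
  show "plot q (arr_mfd NG) (\<lambda>y. gmul NG (s y) (t y))"
    if s: "plot q (arr_mfd NG) s" "plot q (arr_mfd NG) t"
      "\<And>y. y \<in> standard_simplex q \<Longrightarrow> (s y, t y) \<in> composable NG" for q s t
  proof -
    have "gmul NG (s y) (t y) = (fst (s y), gmul G (snd (s y)) (snd (t y)))" for y
      by (cases "s y"; cases "t y") simp
    \<comment> \<open>Composability in \<open>NG\<close> says that \<open>act x g\<close> is the
      base of the next arrow. Its projection is \<open>gsrc G g\<close> by \<open>tgt_act\<close>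
      and also the target of that arrow's component in \<open>G\<close>.\<close>
    moreover have "(snd (s y), snd (t y)) \<in> composable G" if "y \<in> standard_simplex q" for y
      using s(3)[OF that] tgt_act by (cases "s y"; cases "t y") (auto simp: composable_def)
    ultimately show ?thesis
      using G.plot_mul[of q "snd \<circ> s" "snd \<circ> t"] s(1,2) by (simp add: plot_prod_iff o_def)
  qed
qed

sublocale NG: plot_groupoid NG
  by (rule plot_groupoid_NG)

end

section \<open>The action of the integers and the transgression map\<close>

context lie_crossed_module
begin

text \<open>The fibre of \<open>N\<close> over \<open>b\<close> as an algebraic group, so that the
  laws of integer powers become available for \<open>gpow\<close>.\<close>

definition vertex_group :: "'o \<Rightarrow> 'n monoid" where
  "vertex_group b = \<lparr>carrier = {y \<in> arrs N. gtgt N y = b}, monoid.mult = gmul N, one = gid N b\<rparr>"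

lemma vertex_group_simps [simp]:
  "y \<in> carrier (vertex_group b) \<longleftrightarrow> y \<in> arrs N \<and> gtgt N y = b"
  "\<one>\<^bsub>vertex_group b\<^esub> = gid N b" "x \<otimes>\<^bsub>vertex_group b\<^esub> y = gmul N x y"
  by (auto simp: vertex_group_def)

lemma inv_N:
  "x \<in> arrs N \<Longrightarrow> ginv N x \<in> arrs N" "x \<in> arrs N \<Longrightarrow> gtgt N (ginv N x) = gtgt N x"
  "x \<in> arrs N \<Longrightarrow> gmul N (ginv N x) x = gid N (gtgt N x)"
  using N.groupoid src_N by (auto simp: groupoid_def)

lemma assoc_N:
  "x \<in> arrs N \<Longrightarrow> y \<in> arrs N \<Longrightarrow> z \<in> arrs N \<Longrightarrow> gtgt N x = gtgt N y \<Longrightarrow> gtgt N y = gtgt N z \<Longrightarrow>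
     gmul N (gmul N x y) z = gmul N x (gmul N y z)"
  using N.groupoid src_N by (auto simp: groupoid_def composable_def)

lemma group_vertex_group:
  assumes "b \<in> objs N"
  shows "group (vertex_group b)"
proof (rule groupI)
  fix x y z assume x: "x \<in> carrier (vertex_group b)"
  then show "\<exists>y\<in>carrier (vertex_group b). y \<otimes>\<^bsub>vertex_group b\<^esub> x = \<one>\<^bsub>vertex_group b\<^esub>"
    by (intro bexI[of _ "ginv N x"]) (auto simp: inv_N)
  show "\<one>\<^bsub>vertex_group b\<^esub> \<otimes>\<^bsub>vertex_group b\<^esub> x = x"
    using x N.id_mul by auto
  assume y: "y \<in> carrier (vertex_group b)"
  show "x \<otimes>\<^bsub>vertex_group b\<^esub> y \<in> carrier (vertex_group b)"
    using x y N.mul_closed src_N by auto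
  assume z: "z \<in> carrier (vertex_group b)"
  show "x \<otimes>\<^bsub>vertex_group b\<^esub> y \<otimes>\<^bsub>vertex_group b\<^esub> z = x \<otimes>\<^bsub>vertex_group b\<^esub> (y \<otimes>\<^bsub>vertex_group b\<^esub> z)"
    using x y z assoc_N by simp
qed (use assms N.id_closed N.tgt_id in auto)

lemma gpow_eq_int_pow:
  assumes x: "x \<in> arrs N"
  shows "gpow N x k = x [^]\<^bsub>vertex_group (gtgt N x)\<^esub> k"
proof -
  interpret V: group "vertex_group (gtgt N x)"
    by (rule group_vertex_group[OF N.tgt_closed[OF x]])
  have pow: "(gmul N y ^^ m) (gid N (gtgt N x)) = y [^]\<^bsub>vertex_group (gtgt N x)\<^esub> m"
    if "y \<in> carrier (vertex_group (gtgt N x))" for y and m :: nat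
    by (induction m) (use V.nat_pow_Suc2[OF that] in auto)
  have "inv\<^bsub>vertex_group (gtgt N x)\<^esub> x = ginv N x"
    by (rule V.inv_equality) (use x inv_N in auto)
  then show ?thesis
    using pow[of x] pow[of "ginv N x"] x V.nat_pow_inv[of x "nat (- k)"]
    by (auto simp: gpow_def int_pow_def2 inv_N simp del: pow_nat)
qed

lemma gpow_closed: "x \<in> arrs N \<Longrightarrow> gpow N x k \<in> arrs N" "x \<in> arrs N \<Longrightarrow> gtgt N (gpow N x k) = gtgt N x"
  using group.int_pow_closed[OF group_vertex_group[OF N.tgt_closed], of x x k]
  by (auto simp: gpow_eq_int_pow)

lemma gpow_add: "x \<in> arrs N \<Longrightarrow> gpow N x (j + k) = gmul N (gpow N x j) (gpow N x k)"
  using group.int_pow_mult[OF group_vertex_group[OF N.tgt_closed], of x x j k]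
  by (simp add: gpow_eq_int_pow)

lemma gpow_0: "gpow N x 0 = gid N (gtgt N x)"
  by (simp add: gpow_def)

lemma gpow_1: "x \<in> arrs N \<Longrightarrow> gpow N x 1 = x"
  using N.mul_id[of x] src_N[of x] by (simp add: gpow_def)

text \<open>Acting by \<open>g\<close> is a homomorphism from the fibre group over the target of
  \<open>g\<close> to the one over its source.\<close>

lemma gpow_act:
  assumes x: "x \<in> arrs N" and g: "g \<in> arrs G" "gtgt N x = gtgt G g"
  shows "gpow N (act x g) k = act (gpow N x k) g"
proof -
  have V: "group (vertex_group (gtgt G g))" "group (vertex_group (gsrc G g))"
    using G.tgt_closed G.src_closed g(1) by (auto simp: objs_eq intro: group_vertex_group)
  have "(\<lambda>y. act y g) \<in> hom (vertex_group (gtgt G g)) (vertex_group (gsrc G g))"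
    using g act_closed tgt_act act_mul by (auto simp: hom_def)
  from hom_int_pow[OF this _ V, of x k] show ?thesis
    using x g act_closed tgt_act by (simp add: gpow_eq_int_pow)
qed

text \<open>\<open>x\<close> commutes with its powers. Through the Peiffer identity this says that
  the image of a power of \<open>x\<close> acts trivially on \<open>x\<close>, so rho does not
  change the source of an arrow.\<close>

lemma gconj_gpow:
  assumes x: "x \<in> arrs N"
  shows "gconj N x (gpow N x k) = x"
proof -
  let ?y = "gpow N x k"
  have y: "?y \<in> arrs N" "gtgt N ?y = gtgt N x"
    using gpow_closed[OF x] by auto
  have "gmul N x ?y = gmul N ?y x"
    using gpow_add[OF x, of 1 k] gpow_add[OF x, of k 1] x by (simp add: gpow_1 add.commute)
  then have "gconj N x ?y = gmul N (gmul N (ginv N ?y) ?y) x"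
    using x y inv_N[OF y(1)] assoc_N[of "ginv N ?y" ?y x] by (simp add: gconj_def)
  then show ?thesis
    using y x N.id_mul[OF x] by (simp add: inv_N)
qed

lemma plot_gpow:
  assumes s: "plot q (arr_mfd N) s" "\<And>y. y \<in> standard_simplex q \<Longrightarrow> s y \<in> arrs N"
  shows "plot q (arr_mfd N) (\<lambda>y. gpow N (s y) k)"
proof -
  \<comment> \<open>The induction also carries membership and the fibre of the partial product,
    which make the next factor composable.\<close>
  have pow: "plot q (arr_mfd N) (\<lambda>y. (gmul N (t y) ^^ m) (gid N (gtgt N (s y)))) \<and>
    (\<forall>y\<in>standard_simplex q. (gmul N (t y) ^^ m) (gid N (gtgt N (s y))) \<in> arrs N \<and>
       gtgt N ((gmul N (t y) ^^ m) (gid N (gtgt N (s y)))) = gtgt N (s y))"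
    if t: "plot q (arr_mfd N) t" "\<And>y. y \<in> standard_simplex q \<Longrightarrow> t y \<in> arrs N \<and> gtgt N (t y) = gtgt N (s y)"
    for t and m :: nat
  proof (induction m)
    case 0
    then show ?case
      using N.plot_id[OF plot_tgt_N[OF s, folded obj_mfd_eq]] s(2) N.tgt_closed N.id_closed N.tgt_id by simp
  next
    case (Suc m)
    then show ?case
      using t N.plot_mul[OF t(1), of "\<lambda>y. (gmul N (t y) ^^ m) (gid N (gtgt N (s y)))"] N.mul_closed src_N
      by (auto simp: composable_def)
  qed
  have "plot q (arr_mfd N) (\<lambda>y. ginv N (s y))"
  proof (rule plot_compose[OF _ s(1)])
    show "coherent_atlas (arr_mfd N)"
      using lie_N by (auto simp: lie_groupoid_def intro: coherent_atlas_smooth_manifold)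
    show "smooth_map (arr_mfd N) (arr_mfd N) (ginv N)"
      using lie_N by (auto simp: lie_groupoid_def)
  qed (use s(2) lie_N in \<open>auto simp: lie_groupoid_def\<close>)
  moreover have "gtgt N (ginv N (s y)) = gtgt N (s y)" if "y \<in> standard_simplex q" for y
    using inv_N s(2) that by blast
  ultimately have i: "plot q (arr_mfd N) (\<lambda>y. (gmul N (ginv N (s y)) ^^ nat (- k)) (gid N (gtgt N (s y))))"
    using pow[of "\<lambda>y. ginv N (s y)" "nat (- k)"] inv_N s(2) by blast
  have "plot q (arr_mfd N) (\<lambda>y. (gmul N (s y) ^^ nat k) (gid N (gtgt N (s y))))"
    using pow[of s "nat k"] s by blast
  with i show ?thesis
    by (cases "0 \<le> k") (simp_all add: gpow_def)
qed

text \<open>Near each point the exponent is constant, which leaves a finite iteration of the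
  multiplication, covered by \<open>plot_gpow\<close>.\<close>

lemma plot_gpow_locally_constant:
  assumes s: "plot q (arr_mfd N) s" "\<And>y. y \<in> standard_simplex q \<Longrightarrow> s y \<in> arrs N"
    and k: "plot q (discrete_mfd UNIV) k"
  shows "plot q (arr_mfd N) (\<lambda>y. gpow N (s y) (k y))"
proof (rule plot_local)
  fix x assume "x \<in> standard_simplex q"
  then obtain W where W: "openin (Euclidean_space (Suc q)) W" "x \<in> W"
      "\<forall>y\<in>standard_simplex q \<inter> W. k y = k x"
    using k unfolding plot_discrete_iff by meson
  show "\<exists>W t. openin (Euclidean_space (Suc q)) W \<and> x \<in> W \<and> plot q (arr_mfd N) t \<and>
      (\<forall>y\<in>standard_simplex q \<inter> W. gpow N (s y) (k y) = t y)"
    by (rule exI[of _ W], rule exI[of _ "\<lambda>y. gpow N (s y) (k x)"]) (use W plot_gpow[OF s] in auto)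
qed

section \<open>The functors pi and rho\<close>

definition rho_arr :: "int \<times> 'n \<times> 'g \<Rightarrow> 'n \<times> 'g" where
  "rho_arr = (\<lambda>(k, (x, g)). (x, gmul G (\<phi> (gpow N x k)) g))"

lemma plot_functor_pi: "plot_functor NG G (gtgt N) snd"
  unfolding plot_functor_def
  using plot_tgt_N N.tgt_closed tgt_act
  by (auto simp: objs_eq plot_prod_iff o_def composable_def)

text \<open>For the last claim the action of the product is split: the power of \<open>x\<close>
  fixes \<open>x\<close> by \<open>act_phi\<close> and \<open>gconj_gpow\<close>, and what remains
  is the action of \<open>g\<close>.\<close>

lemma rho_arr_closed:
  assumes x: "x \<in> arrs N" "g \<in> arrs G" "gtgt N x = gtgt G g"
  shows "gmul G (\<phi> (gpow N x k)) g \<in> arrs G" "gtgt G (gmul G (\<phi> (gpow N x k)) g) = gtgt G g"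
    "gsrc G (gmul G (\<phi> (gpow N x k)) g) = gsrc G g" "act x (gmul G (\<phi> (gpow N x k)) g) = act x g"
proof -
  let ?p = "\<phi> (gpow N x k)"
  have p: "?p \<in> arrs G" "gsrc G ?p = gtgt G g" "gtgt G ?p = gtgt G g"
    using gpow_closed[of x k] phi_closed src_phi tgt_phi x by auto
  then show "gmul G ?p g \<in> arrs G" "gtgt G (gmul G ?p g) = gtgt G g" "gsrc G (gmul G ?p g) = gsrc G g"
    using G.mul_closed x by auto
  show "act x (gmul G ?p g) = act x g"
    using act_act[of x ?p g] p x act_phi[of x "gpow N x k"] gpow_closed[of x k] gconj_gpow by simp
qed

text \<open>Equivariance of \<phi> moves the second factor past \<open>g\<close>: g phi((x^g)^k) =
  phi(x^k) g. Then the powers j and k of \<open>x\<close> stand side by side and add up.\<close>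

lemma rho_arr_mul:
  assumes x: "x \<in> arrs N" "g \<in> arrs G" "gtgt N x = gtgt G g" and h: "h \<in> arrs G" "gsrc G g = gtgt G h"
  shows "gmul G (\<phi> (gpow N x (j + k))) (gmul G g h) =
    gmul G (gmul G (\<phi> (gpow N x j)) g) (gmul G (\<phi> (gpow N (act x g) k)) h)"
proof -
  let ?a = "\<phi> (gpow N x j)" and ?b = "\<phi> (gpow N x k)"
  have ab: "?a \<in> arrs G" "gsrc G ?a = gtgt G g" "gtgt G ?a = gtgt G g"
    "?b \<in> arrs G" "gsrc G ?b = gtgt G g" "gtgt G ?b = gtgt G g"
    using gpow_closed[of x] phi_closed src_phi tgt_phi x by auto
  have bg: "gmul G ?b g \<in> arrs G" "gsrc G (gmul G ?b g) = gsrc G g" "gtgt G (gmul G ?b g) = gtgt G g"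
    using G.mul_closed ab x by auto
  have gh: "gmul G g h \<in> arrs G" "gtgt G (gmul G g h) = gtgt G g"
    using G.mul_closed x h by auto
  have bgh: "gmul G (gmul G ?b g) h \<in> arrs G" "gtgt G (gmul G (gmul G ?b g) h) = gtgt G g"
    using G.mul_closed bg h by auto
  have "gmul G g (gmul G (\<phi> (gpow N (act x g) k)) h) = gmul G g (gmul G (gmul G (ginv G g) (gmul G ?b g)) h)"
    using x phi_act[of "gpow N x k" g] gpow_closed[of x k] by (simp add: gpow_act gconj_def)
  also have "\<dots> = gmul G g (gmul G (ginv G g) (gmul G (gmul G ?b g) h))"
    using bg inv_G x h by (simp add: assoc_G)
  also have "\<dots> = gmul G (gmul G g (ginv G g)) (gmul G (gmul G ?b g) h)"
    using bgh inv_G[OF x(2)] assoc_G[of g "ginv G g" "gmul G (gmul G ?b g) h"] x by simp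
  also have "\<dots> = gmul G (gmul G ?b g) h"
    using G.id_mul[OF bgh(1)] bgh(2) inv_G x by simp
  finally have *: "gmul G g (gmul G (\<phi> (gpow N (act x g) k)) h) = gmul G (gmul G ?b g) h" .
  have c: "\<phi> (gpow N (act x g) k) \<in> arrs G" "gsrc G (\<phi> (gpow N (act x g) k)) = gsrc G g"
      "gtgt G (\<phi> (gpow N (act x g) k)) = gsrc G g"
    using gpow_closed[of "act x g" k] act_closed[OF x] tgt_act[OF x] phi_closed src_phi tgt_phi by auto
  have ch: "gmul G (\<phi> (gpow N (act x g) k)) h \<in> arrs G"
      "gtgt G (gmul G (\<phi> (gpow N (act x g) k)) h) = gsrc G g"
    using G.mul_closed c h by auto
  have "gmul G (gmul G ?a g) (gmul G (\<phi> (gpow N (act x g) k)) h) = gmul G ?a (gmul G (gmul G ?b g) h)"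
    using ab x ch by (simp add: assoc_G *)
  also have "\<dots> = gmul G ?a (gmul G ?b (gmul G g h))"
    using ab x h by (simp add: assoc_G)
  also have "\<dots> = gmul G (gmul G ?a ?b) (gmul G g h)"
    using ab gh by (simp add: assoc_G)
  also have "gmul G ?a ?b = \<phi> (gpow N x (j + k))"
    using gpow_add[OF x(1)] phi_mul[of "gpow N x j" "gpow N x k"] gpow_closed x by simp
  finally show ?thesis ..
qed

lemma plot_functor_rho: "plot_functor (prod_grpd int_grpd NG) NG snd rho_arr"
  unfolding plot_functor_def
proof (intro conjI allI impI ballI)
  fix a assume "a \<in> arrs (prod_grpd int_grpd NG)"
  then obtain k x g where a: "a = (k, (x, g))" "x \<in> arrs N" "g \<in> arrs G" "gtgt N x = gtgt G g"
    by (cases a) (auto simp: NG.ZK_simps)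
  show "rho_arr a \<in> arrs NG" "gsrc NG (rho_arr a) = snd (gsrc (prod_grpd int_grpd NG) a)"
    "gtgt NG (rho_arr a) = snd (gtgt (prod_grpd int_grpd NG) a)"
    using a rho_arr_closed[OF a(2-4), of k] by (auto simp: rho_arr_def NG.ZK_simps)
next
  fix ab assume "ab \<in> composable (prod_grpd int_grpd NG)"
  then obtain j x g k h where ab: "ab = ((j, (x, g)), (k, (act x g, h)))"
    "x \<in> arrs N" "g \<in> arrs G" "gtgt N x = gtgt G g" "h \<in> arrs G" "gsrc G g = gtgt G h"
    using tgt_act by (cases ab) (force simp: composable_def NG.ZK_simps)
  show "case ab of (a, b) \<Rightarrow> rho_arr (gmul (prod_grpd int_grpd NG) a b) = gmul NG (rho_arr a) (rho_arr b)"
    using rho_arr_mul[OF ab(2-6), of j k] by (simp add: ab(1) NG.ZK_simps rho_arr_def)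
next
  fix q and s :: "_ \<Rightarrow> unit \<times> 'n"
  assume "plot q (obj_mfd (prod_grpd int_grpd NG)) s"
  then show "plot q (obj_mfd NG) (\<lambda>y. snd (s y))"
    by (simp add: prod_grpd_def plot_prod_iff o_def)
next
  fix q and s :: "_ \<Rightarrow> int \<times> 'n \<times> 'g"
  assume s: "plot q (arr_mfd (prod_grpd int_grpd NG)) s"
    "\<forall>y\<in>standard_simplex q. s y \<in> arrs (prod_grpd int_grpd NG)"
  have c: "plot q (discrete_mfd UNIV) (\<lambda>y. fst (s y))" "plot q (arr_mfd N) (\<lambda>y. fst (snd (s y)))"
    "plot q (arr_mfd G) (\<lambda>y. snd (snd (s y)))"
    using s(1) by (simp_all add: prod_grpd_def int_grpd_def plot_prod_iff o_def)
  have i: "fst (snd (s y)) \<in> arrs N" "snd (snd (s y)) \<in> arrs G"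
      "gtgt N (fst (snd (s y))) = gtgt G (snd (snd (s y)))" if "y \<in> standard_simplex q" for y
    using s(2) that by (cases "snd (s y)"; force simp: NG.ZK_simps)+
  have "plot q (arr_mfd N) (\<lambda>y. gpow N (fst (snd (s y))) (fst (s y)))"
    by (rule plot_gpow_locally_constant[OF c(2) i(1) c(1)])
  then have "plot q (arr_mfd G) (\<lambda>y. \<phi> (gpow N (fst (snd (s y))) (fst (s y))))"
    by (rule plot_phi) (rule gpow_closed(1)[OF i(1)])
  then have "plot q (arr_mfd G) (\<lambda>y. gmul G (\<phi> (gpow N (fst (snd (s y))) (fst (s y)))) (snd (snd (s y))))"
    by (rule G.plot_mul[OF _ c(3)]) (use i gpow_closed phi_closed src_phi in \<open>simp add: composable_def\<close>)
  then show "plot q (arr_mfd NG) (\<lambda>y. rho_arr (s y))"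
    using c(2) by (simp add: rho_arr_def plot_prod_iff o_def case_prod_beta)
qed (auto simp: NG.ZK_simps)

text \<open>Derived from multiplicativity: the image of a unit is idempotent, and an idempotent
  arrow of a groupoid is a unit.\<close>

lemma phi_id: "b \<in> objs N \<Longrightarrow> \<phi> (gid N b) = gid G b"
proof -
  assume b: "b \<in> objs N"
  let ?e = "\<phi> (gid N b)"
  have e: "?e \<in> arrs G" "gsrc G ?e = b" "gtgt G ?e = b"
    using b phi_closed src_phi tgt_phi N.id_closed N.tgt_id by auto
  have "gmul G ?e ?e = ?e"
    using phi_mul[of "gid N b" "gid N b"] N.id_closed[OF b] N.tgt_id[OF b] N.id_mul[of "gid N b"] by simp
  then have "gmul G (ginv G ?e) (gmul G ?e ?e) = gid G b"
    using e inv_G by simp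
  then show ?thesis
    using e inv_G[OF e(1)] G.id_mul[OF e(1)] assoc_G[of "ginv G ?e" ?e ?e] by simp
qed

text \<open>The i-th object of a string starting at \<open>x\<close> is x acted on by the product of
  the first i arrows of \<open>G\<close>. The induction peels off the first arrow, replaces
  \<open>x\<close> by \<open>act x g\<close> and reassembles with \<open>act_act\<close>; the facts
  on membership and target make the products defined.\<close>

lemma nerve_vertex_NG:
  "path_from NG x as \<Longrightarrow> i \<le> length as \<Longrightarrow>
     gprod G (gtgt N x) (take i (map snd as)) \<in> arrs G \<and>
     gtgt G (gprod G (gtgt N x) (take i (map snd as))) = gtgt N x \<and>
     nerve_vertex NG (x, as) i = act x (gprod G (gtgt N x) (take i (map snd as)))"
proof (induction as arbitrary: x i)
  case Nil
  then show ?case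
    using N.tgt_closed act_id by (simp add: G.id_closed G.tgt_id flip: objs_eq)
next
  case (Cons a as)
  obtain g where a: "a = (x, g)" "x \<in> arrs N" "g \<in> arrs G" "gtgt N x = gtgt G g"
    using Cons.prems by (cases a) auto
  show ?case
  proof (cases i)
    case 0
    then show ?thesis
      using N.tgt_closed[OF a(2)] act_id a(2) by (simp add: G.id_closed G.tgt_id flip: objs_eq)
  next
    case (Suc m)
    have "path_from NG (act x g) as" "m \<le> length as"
      using Cons.prems Suc by (auto simp: a(1))
    from Cons.IH[OF this] show ?thesis
      using a G.mul_closed act_act tgt_act
        nerve_vertex_Cons[of NG a as m] by (auto simp: Suc)
  qed
qed

lemma pi_rho_insert_loop:
  assumes y: "y \<in> nerve NG l" and i: "i \<le> l"
  shows "pi_map N (rho_map N G \<phi> (insert_loop NG i y)) = f_tilde N G \<phi> i (crossed_nerve_iso y)"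
proof -
  obtain x as where xa: "y = (x, as)" "path_from NG x as" "length as = l"
    using y by (auto simp: nerve_def)
  let ?v = "nerve_vertex NG y i" and ?g = "gprod G (gtgt N x) (take i (map snd as))"
  have x: "x \<in> arrs N"
    using y xa by (simp add: NG.nerve_iff)
  have v: "?v \<in> arrs N"
    using NG.nerve_vertex_in_objs[OF y i] by simp
  have g: "?g \<in> arrs G" "gtgt G ?g = gtgt N x" "?v = act x ?g"
    using nerve_vertex_NG[OF xa(2), of i] i xa by auto
  \<comment> \<open>Arrows with label 0 are unchanged: the power 0 is a unit of \<open>N\<close>,
    which \<phi> sends to a unit of \<open>G\<close>.\<close>
  have 0: "snd (rho_arr (0, a)) = snd a" if "a \<in> set as" for a
  proof -
    have "a \<in> arrs NG"
      using y xa that by (auto simp: NG.nerve_iff in_set_conv_nth)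
    then show ?thesis
      using G.id_mul[of "snd a"] N.tgt_closed[of "fst a"] by (cases a) (simp add: rho_arr_def gpow_0 phi_id)
  qed
  have "snd (rho_arr (1, gid NG ?v)) = \<phi> ?v"
    using G.mul_id[OF phi_closed[OF v]] v by (simp add: rho_arr_def gpow_1 src_phi)
  then have 1: "snd (rho_arr (1, gid NG ?v)) = gconj G (\<phi> x) ?g"
    using phi_act[OF x g(1)] g by simp
  have "map (snd \<circ> rho_arr \<circ> Pair 0) (take i as) = map snd (take i as)"
    "map (snd \<circ> rho_arr \<circ> Pair 0) (drop i as) = map snd (drop i as)"
    using 0 set_take_subset set_drop_subset by (fastforce intro!: map_cong)+
  then show ?thesis
    using 1 by (simp add: xa(1) pi_map_def rho_map_def rho_arr_def[symmetric] nerve_map_def insert_loop_def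
        f_tilde_def crossed_nerve_iso_def take_map drop_map o_assoc)
qed

end

section \<open>The transgression on cochains and on classes\<close>

lemma descends_in_carrier:
  "descends C m D n f \<Longrightarrow> u \<in> carrier (cgrp C m) \<Longrightarrow> f u \<in> carrier (cgrp D n)"
  unfolding descends_def by (blast intro: hom_in_carrier)

lemma f_map_Suc: "f_map N G \<phi> (Suc i) = f_tilde N G \<phi> i"
  by (simp add: f_map_def f_tilde_def)

text \<open>Lowering the index by one identifies the maps \<open>f_map\<close> with
  \<open>f_tilde\<close> and costs a factor -1, which is the whole difference between
  \<open>f_cochain\<close> and \<open>T1_cochain\<close>.\<close>

lemma f_cochain_eq_f_tilde:
  "f_cochain N G \<phi> act n u =
     (\<lambda>l\<in>{..n}. \<lambda>c\<in>nerve_chains (crossed_product N G act) l (n - l).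
        - (\<Sum>i\<le>l. (-1) ^ i * u (Suc l) (chain_map (n - l) (f_tilde N G \<phi> i \<circ> crossed_nerve_iso) c)))"
  unfolding f_cochain_def by (simp add: sum.atLeast1_atMost_eq f_map_Suc sum_negf flip: lessThan_Suc_atMost)

context lie_crossed_module
begin

lemma rho_map_eq: "rho_map N G \<phi> = nerve_map snd rho_arr"
  by (simp add: rho_map_def rho_arr_def)

lemma f_cochain_eq:
  assumes u: "u \<in> carrier (cgrp (tot_complex G) (Suc n))"
  shows "f_cochain N G \<phi> act n u = loop_transgression NG n
    (pullback (prod_grpd int_grpd NG) (Suc n) (rho_map N G \<phi>) (pullback NG (Suc n) (pi_map N) u))"
proof -
  have "pullback (prod_grpd int_grpd NG) (Suc n) (rho_map N G \<phi>) (pullback NG (Suc n) (pi_map N) u)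
        (Suc l) (chain_map (n - l) (insert_loop NG i) c) =
      u (Suc l) (chain_map (n - l) (f_tilde N G \<phi> i \<circ> crossed_nerve_iso) c)"
    if l: "l \<le> n" and i: "i \<le> l" and c: "Poly_Mapping.keys c \<subseteq> nerve_simplices NG l (n - l)" for l i c
  proof -
    note 1 = NG.keys_insert_loop[OF i c]
    have 2: "Poly_Mapping.keys (chain_map (n - l) (rho_map N G \<phi>) (chain_map (n - l) (insert_loop NG i) c))
        \<subseteq> nerve_simplices NG (Suc l) (n - l)"
      unfolding rho_map_eq
      by (rule keys_chain_map[OF nerve_plot_map_nerve_map[OF NG.plot_groupoid_ZK plot_groupoid_NG plot_functor_rho] 1])
    have "chain_map (n - l) (pi_map N) (chain_map (n - l) (rho_map N G \<phi>) (chain_map (n - l) (insert_loop NG i) c))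
        = chain_map (n - l) (f_tilde N G \<phi> i \<circ> crossed_nerve_iso) c"
      unfolding chain_map_comp by (rule chain_map_cong[OF c]) (simp add: pi_rho_insert_loop i)
    then show ?thesis
      using l 1 2 by (simp add: pullback_def)
  qed
  then show ?thesis
    unfolding f_cochain_eq_f_tilde loop_transgression_def by (auto simp: fun_eq_iff)
qed

text \<open>Inherited from the composite of two pullbacks and \<open>loop_transgression\<close>; the
  two maps are compared on cochains of the carrier, hence \<open>descends_cong\<close>.\<close>

lemma f_cochain_descends: "descends (tot_complex G) (Suc n) (tot_complex NG) n (f_cochain N G \<phi> act n)"
proof (rule descends_cong[OF additive_complex_tot_complex[OF G.plot_groupoid_axioms] _ f_cochain_eq])
  show "descends (tot_complex G) (Suc n) (tot_complex NG) n (\<lambda>u. loop_transgression NG n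
    (pullback (prod_grpd int_grpd NG) (Suc n) (rho_map N G \<phi>) (pullback NG (Suc n) (pi_map N) u)))"
    unfolding rho_map_eq pi_map_def
    by (intro descends_compose[OF _ NG.loop_transgression_descends]
        descends_compose[OF _ pullback_nerve_map_descends[OF NG.plot_groupoid_ZK plot_groupoid_NG plot_functor_rho]]
        pullback_nerve_map_descends plot_groupoid_NG G.plot_groupoid_axioms plot_functor_pi)
qed

lemma T1_cochain_eq:
  assumes u: "u \<in> carrier (cgrp (tot_complex G) (Suc n))"
  shows "T1_cochain N G \<phi> act n u = inv\<^bsub>cgrp (tot_complex NG) n\<^esub> (f_cochain N G \<phi> act n u)"
proof -
  have "f_cochain N G \<phi> act n u \<in> carrier (cgrp (tot_complex NG) n)"
    by (rule descends_in_carrier[OF f_cochain_descends u])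
  then show ?thesis
    by (auto simp: tot_inv T1_cochain_def f_cochain_eq_f_tilde atMost_atLeast0 fun_eq_iff)
qed

lemma T1_cochain_descends: "descends (tot_complex G) (Suc n) (tot_complex NG) n (T1_cochain N G \<phi> act n)"
  using descends_inv[OF additive_complex_tot_complex[OF plot_groupoid_NG] f_cochain_descends]
  by (rule descends_cong[OF additive_complex_tot_complex[OF G.plot_groupoid_axioms] _ T1_cochain_eq])

lemma Phi_coclass:
  assumes u: "u \<in> carrier (cgrp (tot_complex G) (Suc n))"
  shows "Phi N G \<phi> act n (coclass (tot_complex G) (Suc n) u) = coclass (tot_complex NG) n (f_cochain N G \<phi> act n u)"
proof -
  note cG = additive_complex_tot_complex[OF G.plot_groupoid_axioms]
    and cNG = additive_complex_tot_complex[OF plot_groupoid_NG]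
    and cZ = additive_complex_tot_complex[OF NG.plot_groupoid_ZK]
  let ?v = "pullback NG (Suc n) (pi_map N) u"
  let ?w = "pullback (prod_grpd int_grpd NG) (Suc n) (rho_map N G \<phi>) ?v"
  have d1: "descends (tot_complex G) (Suc n) (tot_complex NG) (Suc n) (pullback NG (Suc n) (pi_map N))"
    unfolding pi_map_def
    by (rule pullback_nerve_map_descends[OF plot_groupoid_NG G.plot_groupoid_axioms plot_functor_pi])
  have d2: "descends (tot_complex NG) (Suc n) (tot_complex (prod_grpd int_grpd NG)) (Suc n)
      (pullback (prod_grpd int_grpd NG) (Suc n) (rho_map N G \<phi>))"
    unfolding rho_map_eq
    by (rule pullback_nerve_map_descends[OF NG.plot_groupoid_ZK plot_groupoid_NG plot_functor_rho])
  have v: "?v \<in> carrier (cgrp (tot_complex NG) (Suc n))"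
    by (rule descends_in_carrier[OF d1 u])
  have w: "?w \<in> carrier (cgrp (tot_complex (prod_grpd int_grpd NG)) (Suc n))"
    by (rule descends_in_carrier[OF d2 v])
  have "induced (tot_complex NG) (Suc n) (pullback NG (Suc n) (pi_map N)) (coclass (tot_complex G) (Suc n) u)
      = coclass (tot_complex NG) (Suc n) ?v"
    using d1 u by (intro induced_coclass cG cNG) (auto simp: descends_def)
  moreover have "induced (tot_complex (prod_grpd int_grpd NG)) (Suc n)
        (pullback (prod_grpd int_grpd NG) (Suc n) (rho_map N G \<phi>)) (coclass (tot_complex NG) (Suc n) ?v)
      = coclass (tot_complex (prod_grpd int_grpd NG)) (Suc n) ?w"
    using d2 v by (intro induced_coclass cNG cZ) (auto simp: descends_def)
  ultimately show ?thesis
    by (simp add: Phi_def Let_def NG.induced_cap_xi_shuffle[OF w] f_cochain_eq[OF u])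
qed

lemma Phi_hom: "Phi N G \<phi> act n \<in> hom (cohomology (tot_complex G) (Suc n)) (cohomology (tot_complex NG) n)"
  by (rule hom_cohomologyI[OF additive_complex_tot_complex[OF G.plot_groupoid_axioms]
        additive_complex_tot_complex[OF plot_groupoid_NG] f_cochain_descends])
     (simp add: Phi_coclass cocycles_def)

lemma Phi_eq_inv_T1:
  assumes a: "a \<in> carrier (cohomology (tot_complex G) (Suc n))"
  shows "Phi N G \<phi> act n a = inv\<^bsub>cohomology (tot_complex NG) n\<^esub> (T1 N G \<phi> act n a)"
proof -
  note cG = additive_complex_tot_complex[OF G.plot_groupoid_axioms]
    and cNG = additive_complex_tot_complex[OF plot_groupoid_NG]
  interpret group "cgrp (tot_complex NG) n"
    by (rule additive_complex.group_cgrp[OF cNG])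
  obtain u where u: "u \<in> cocycles (tot_complex G) (Suc n)" "a = coclass (tot_complex G) (Suc n) u"
    using a by (auto simp: additive_complex.carrier_cohomology[OF cG])
  then have uc: "u \<in> carrier (cgrp (tot_complex G) (Suc n))"
    by (simp add: cocycles_def)
  have "T1 N G \<phi> act n a = coclass (tot_complex NG) n (T1_cochain N G \<phi> act n u)"
    unfolding T1_def u(2) using T1_cochain_descends uc by (intro induced_coclass cG cNG) (auto simp: descends_def)
  moreover have "T1_cochain N G \<phi> act n u \<in> cocycles (tot_complex NG) n"
    using T1_cochain_descends u(1) by (auto simp: descends_def)
  moreover have "f_cochain N G \<phi> act n u \<in> carrier (cgrp (tot_complex NG) n)"
    by (rule descends_in_carrier[OF f_cochain_descends uc])
  \<comment> \<open>Inverting twice returns \<open>f_cochain\<close>, so the sign may be put on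
    either side.\<close>
  then have "inv\<^bsub>cgrp (tot_complex NG) n\<^esub> (T1_cochain N G \<phi> act n u) = f_cochain N G \<phi> act n u"
    by (simp add: T1_cochain_eq[OF uc])
  ultimately show ?thesis
    by (simp add: additive_complex.inv_cohomology[OF cNG] Phi_coclass[OF uc] u(2))
qed

end

theorem mainTheorem1:
  fixes N :: "('o, 'n) grpd" and G :: "('o, 'g) grpd"
    and \<phi> :: "'n \<Rightarrow> 'g" and act :: "'n \<Rightarrow> 'g \<Rightarrow> 'n" and n :: nat
  assumes "crossed_module N G \<phi> act"
  shows "let CG = tot_complex G; CK = tot_complex (crossed_product N G act) in
    Phi N G \<phi> act n \<in> hom (cohomology CG (Suc n)) (cohomology CK n) \<and>
    descends CG (Suc n) CK n (f_cochain N G \<phi> act n) \<and>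
    (\<forall>u\<in>cocycles CG (Suc n).
       Phi N G \<phi> act n (coclass CG (Suc n) u) = coclass CK n (f_cochain N G \<phi> act n u)) \<and>
    descends CG (Suc n) CK n (T1_cochain N G \<phi> act n) \<and>
    (\<forall>a\<in>carrier (cohomology CG (Suc n)).
       Phi N G \<phi> act n a = inv\<^bsub>cohomology CK n\<^esub> (T1 N G \<phi> act n a))"
proof -
  interpret lie_crossed_module N G \<phi> act
    by unfold_locales (rule assms)
  show ?thesis
    using Phi_hom f_cochain_descends Phi_coclass T1_cochain_descends Phi_eq_inv_T1
    by (simp add: Let_def cocycles_def)
qed

end
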